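(* Let $X(A,\theta)$ be a semi-projective toric orbifold, where $A$ is a $d\times n$ integer matrix with relatively prime $d\times d$ minors and $\theta\in\mathbb{N}\mathcal{A}$ is a generic integral degree. The embedding of the core $C(A,\theta)$ in $X(A,\theta)$ induces an isomorphism on cohomology with integer coefficients.
   Context: Write $A=[a_1,\dots,a_n]$, $\mathcal{A}=\{a_1,\dots,a_n\}$. Grade $S=\mathbb{C}[x_1,\dots,x_n]$ by $\deg x_i=a_i$; $X(A,\theta)=\mathrm{Proj}\bigoplus_{r\ge0}S_{r\theta}$. Let $P_\theta=\{u\in\mathbb{R}^n:Au=\theta,\ u\ge0\}$. The vector $\theta$ is generic if it lies in no cone $\mathrm{pos}\{a_{i_1},\dots,a_{i_{d-1}}\}$, and an integral degree if all vertices of $P_\theta$ are in $\mathbb{Z}^n$. Then $X(A,\theta)$ is the toric variety whose fan $\Sigma_\theta$ is the normal fan of $P_\theta$ (in the lattice dual to $\ker_{\mathbb{Z}}A$). The core $C(A,\theta)=\bigcup_{\sigma\in\Sigma_\theta\setminus\partial\Sigma_\theta}O_\sigma$ is the union of the torus orbits $O_\sigma$ over the cones $\sigma$ of $\Sigma_\theta$ not contained in the boundary of the support $|\Sigma_\theta|$; equivalently, it is the union of all compact torus orbit closures in $X(A,\theta)$. *)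

theory Defs
  imports "HOL-Analysis.Analysis" "HOL-Homology.Homology"
begin

section \<open>Singular cohomology with integer coefficients\<close>

text \<open>The cochain group is \<open>Hom(C\<^sub>p(X), \<int>)\<close> under pointwise addition, where
  \<open>C\<^sub>p(X)\<close> is the singular chain group of HOL-Homology. Homomorphisms are taken extensional
  on the chain group, so that equality of cochains is equality of functions.\<close>

definition cochain_group :: "nat \<Rightarrow> 'a topology \<Rightarrow> ('a chain \<Rightarrow> int) monoid" where
  "cochain_group p X =
     \<lparr>carrier = hom (chain_group p X) integer_group \<inter> extensional (carrier (chain_group p X)),
      monoid.mult = (\<lambda>\<phi> \<psi>. restrict (\<lambda>c. \<phi> c + \<psi> c) (carrier (chain_group p X))),
      one = restrict (\<lambda>c. 0) (carrier (chain_group p X))\<rparr>"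

definition coboundary :: "nat \<Rightarrow> 'a topology \<Rightarrow> ('a chain \<Rightarrow> int) \<Rightarrow> 'a chain \<Rightarrow> int" where
  "coboundary p X \<phi> =
     restrict (\<lambda>c. \<phi> (chain_boundary (Suc p) c)) (carrier (chain_group (Suc p) X))"

definition singular_cocycle_set :: "nat \<Rightarrow> 'a topology \<Rightarrow> ('a chain \<Rightarrow> int) set" where
  "singular_cocycle_set p X =
     {\<phi> \<in> carrier (cochain_group p X). coboundary p X \<phi> = \<one>\<^bsub>cochain_group (Suc p) X\<^esub>}"

definition singular_coboundary_set :: "nat \<Rightarrow> 'a topology \<Rightarrow> ('a chain \<Rightarrow> int) set" where
  "singular_coboundary_set p X =
     (case p of 0 \<Rightarrow> {\<one>\<^bsub>cochain_group 0 X\<^esub>}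
      | Suc q \<Rightarrow> coboundary q X ` carrier (cochain_group q X))"

definition cohomology_group :: "nat \<Rightarrow> 'a topology \<Rightarrow> ('a chain \<Rightarrow> int) set monoid" where
  "cohomology_group p X =
     subgroup_generated (cochain_group p X) (singular_cocycle_set p X)
       Mod singular_coboundary_set p X"

definition cochain_map ::
  "nat \<Rightarrow> 'a topology \<Rightarrow> ('a \<Rightarrow> 'b) \<Rightarrow> ('b chain \<Rightarrow> int) \<Rightarrow> 'a chain \<Rightarrow> int" where
  "cochain_map p X f \<phi> = restrict (\<lambda>c. \<phi> (chain_map p f c)) (carrier (chain_group p X))"

text \<open>For a continuous \<open>f : X \<rightarrow> Y\<close> this is \<open>f\<^sup>* : H\<^sup>p(Y) \<rightarrow> H\<^sup>p(X)\<close>. It sends a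
  cohomology class, i.e. a coset \<open>K\<close> of the coboundaries of \<open>Y\<close>, to the coset of the
  coboundaries of \<open>X\<close> that contains the pullbacks of the elements of \<open>K\<close>.\<close>

definition cohomology_induced ::
  "nat \<Rightarrow> 'a topology \<Rightarrow> ('a \<Rightarrow> 'b) \<Rightarrow> ('b chain \<Rightarrow> int) set \<Rightarrow> ('a chain \<Rightarrow> int) set" where
  "cohomology_induced p X f K =
     singular_coboundary_set p X <#>\<^bsub>cochain_group p X\<^esub> (cochain_map p X f ` K)"


section \<open>The matrix \<open>A\<close> and the degree \<open>\<theta>\<close>\<close>

text \<open>A \<open>d \<times> n\<close> integer matrix has type \<^typ>\<open>int^'n^'d\<close>. Its maximal minors
  are obtained from the injective choices \<open>s\<close> of \<open>d\<close> columns; permuting the chosen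
  columns only changes the sign.\<close>

definition coprime_maximal_minors :: "int^'n^'d \<Rightarrow> bool" where
  "coprime_maximal_minors A \<longleftrightarrow>
     Gcd {det (\<chi> i j. A $ i $ s j) | s :: 'd \<Rightarrow> 'n. inj s} = 1"

definition real_vec :: "int^'d \<Rightarrow> real^'d" where
  "real_vec v = (\<chi> i. real_of_int (v $ i))"

definition real_mat :: "int^'n^'d \<Rightarrow> real^'n^'d" where
  "real_mat A = (\<chi> i j. real_of_int (A $ i $ j))"

definition nat_vec :: "nat^'n \<Rightarrow> real^'n" where
  "nat_vec u = (\<chi> j. real (u $ j))"

text \<open>The degree \<open>\<Sum>\<^sub>j u\<^sub>j a\<^sub>j\<close> of the monomial \<open>x\<^sup>u\<close>.\<close>

definition monom_degree :: "int^'n^'d \<Rightarrow> nat^'n \<Rightarrow> int^'d" where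
  "monom_degree A u = A *v (\<chi> j. int (u $ j))"

definition column_semigroup :: "int^'n^'d \<Rightarrow> (int^'d) set" where
  "column_semigroup A = range (monom_degree A)"

definition pos_columns :: "int^'n^'d \<Rightarrow> 'n set \<Rightarrow> (real^'d) set" where
  "pos_columns A I =
     {(\<Sum>i\<in>I. c i *\<^sub>R column i (real_mat A)) | c :: 'n \<Rightarrow> real. \<forall>i\<in>I. 0 \<le> c i}"

definition generic_degree :: "int^'n^'d \<Rightarrow> int^'d \<Rightarrow> bool" where
  "generic_degree A \<theta> \<longleftrightarrow>
     (\<forall>I :: 'n set. card I = CARD('d) - 1 \<longrightarrow> real_vec \<theta> \<notin> pos_columns A I)"

definition degree_polyhedron :: "int^'n^'d \<Rightarrow> int^'d \<Rightarrow> (real^'n) set" where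
  "degree_polyhedron A \<theta> = {u. real_mat A *v u = real_vec \<theta> \<and> (\<forall>j. 0 \<le> u $ j)}"

definition integral_degree :: "int^'n^'d \<Rightarrow> int^'d \<Rightarrow> bool" where
  "integral_degree A \<theta> \<longleftrightarrow>
     (\<forall>v. v extreme_point_of degree_polyhedron A \<theta> \<longrightarrow> (\<forall>j. v $ j \<in> \<int>))"


section \<open>The toric variety \<open>X(A,\<theta>)\<close>\<close>

text \<open>The polynomial ring \<open>S = \<complex>[x\<^sub>1,\<dots>,x\<^sub>n]\<close>, as finitely supported coefficient functions
  on exponent vectors with the convolution product of \<open>Poly_Mapping\<close>.\<close>

type_synonym 'n cpoly = "(nat^'n) \<Rightarrow>\<^sub>0 complex"

abbreviation const_poly :: "complex \<Rightarrow> 'n::finite cpoly" where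
  "const_poly c \<equiv> Poly_Mapping.single 0 c"

definition graded_piece :: "int^'n^'d \<Rightarrow> int^'d \<Rightarrow> 'n cpoly set" where
  "graded_piece A \<eta> = {f. \<forall>u\<in>Poly_Mapping.keys f. monom_degree A u = \<eta>}"

text \<open>The degree \<open>r\<close> part \<open>S\<^bsub>r\<theta>\<^esub>\<close> of the ring \<open>R = \<Oplus>\<^bsub>r\<ge>0\<^esub> S\<^bsub>r\<theta>\<^esub>\<close>. A generic \<open>\<theta>\<close> is
  nonzero, so the pieces lie in distinct degrees of \<open>S\<close> and the direct sum may be formed
  inside \<open>S\<close>.\<close>

definition veronese_piece :: "int^'n^'d \<Rightarrow> int^'d \<Rightarrow> nat \<Rightarrow> 'n cpoly set" where
  "veronese_piece A \<theta> r = graded_piece A (int r *s \<theta>)"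

definition veronese_ring :: "int^'n^'d \<Rightarrow> int^'d \<Rightarrow> 'n cpoly ring" where
  "veronese_ring A \<theta> =
     \<lparr>carrier = {(\<Sum>r<N. f r) | N f. \<forall>r. f r \<in> veronese_piece A \<theta> r},
      monoid.mult = (*), one = 1, ring.zero = 0, add = (+)\<rparr>"

definition homogeneous_ideal :: "int^'n^'d \<Rightarrow> int^'d \<Rightarrow> 'n cpoly set \<Rightarrow> bool" where
  "homogeneous_ideal A \<theta> I \<longleftrightarrow> ideal I (veronese_ring A \<theta>) \<and>
     (\<forall>N f. (\<forall>r. f r \<in> veronese_piece A \<theta> r) \<longrightarrow> (\<Sum>r<N. f r) \<in> I \<longrightarrow> (\<forall>r<N. f r \<in> I))"

text \<open>The complex points of \<open>Proj R\<close>: homogeneous prime ideals not containing the irrelevant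
  ideal \<open>R\<^sub>+\<close>, with residue field \<open>\<complex>\<close>. The residue field at \<open>\<pp>\<close> consists of the fractions
  \<open>g/f\<close> with \<open>f, g\<close> homogeneous of the same degree and \<open>f \<notin> \<pp>\<close>, taken modulo \<open>\<pp>\<close>. The
  last condition says that each of them is the class of a constant, the value of \<open>g/f\<close> at
  the point.\<close>

definition proj_points :: "int^'n^'d \<Rightarrow> int^'d \<Rightarrow> 'n cpoly set set" where
  "proj_points A \<theta> =
     {\<pp>. primeideal \<pp> (veronese_ring A \<theta>) \<and> homogeneous_ideal A \<theta> \<pp> \<and>
        (\<exists>r>0. \<not> veronese_piece A \<theta> r \<subseteq> \<pp>) \<and>
        (\<forall>r. \<forall>f\<in>veronese_piece A \<theta> r - \<pp>. \<forall>g\<in>veronese_piece A \<theta> r.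
           \<exists>c. g - const_poly c * f \<in> \<pp>)}"

text \<open>The classical (complex analytic) topology: the coarsest one in which every basic
  chart \<open>D\<^sub>+(f)\<close> is open and every regular function \<open>g/f\<close> on it is continuous.
  (A regular function \<open>g/f\<^sup>k\<close> on \<open>D\<^sub>+(f) = D\<^sub>+(f\<^sup>k)\<close> is covered by replacing \<open>f\<close> by \<open>f\<^sup>k\<close>,
  and taking \<open>U = \<complex>\<close> gives \<open>D\<^sub>+(f)\<close> itself.)\<close>

definition toric_variety :: "int^'n^'d \<Rightarrow> int^'d \<Rightarrow> 'n cpoly set topology" where
  "toric_variety A \<theta> = topology_generated_by
     {{\<pp> \<in> proj_points A \<theta>. f \<notin> \<pp> \<and> (\<exists>c\<in>U. g - const_poly c * f \<in> \<pp>)} | r f g U.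
        r > 0 \<and> f \<in> veronese_piece A \<theta> r \<and> g \<in> veronese_piece A \<theta> r \<and> open U}"


section \<open>The fan \<open>\<Sigma>\<^sub>\<theta>\<close> and the torus orbits\<close>

text \<open>\<open>N\<^sub>\<real>\<close>, the dual of \<open>ker\<^sub>\<real> A\<close>, is identified with \<open>ker\<^sub>\<real> A\<close> by means of the standard
  inner product: \<open>w\<close> represents the functional \<open>u \<mapsto> w \<bullet> u\<close>. All functionals are only
  compared at points of one affine space parallel to \<open>ker\<^sub>\<real> A\<close>.\<close>

definition kernel_space :: "int^'n^'d \<Rightarrow> (real^'n) set" where
  "kernel_space A = {w. real_mat A *v w = 0}"

text \<open>The (inner) normal cone of a face \<open>F\<close>: the functionals whose minimum over the
  polyhedron is attained at all points of \<open>F\<close>.\<close>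

definition normal_cone :: "int^'n^'d \<Rightarrow> int^'d \<Rightarrow> (real^'n) set \<Rightarrow> (real^'n) set" where
  "normal_cone A \<theta> F =
     {w \<in> kernel_space A. \<forall>u\<in>F. \<forall>v\<in>degree_polyhedron A \<theta>. w \<bullet> u \<le> w \<bullet> v}"

definition normal_fan :: "int^'n^'d \<Rightarrow> int^'d \<Rightarrow> (real^'n) set set" where
  "normal_fan A \<theta> =
     {normal_cone A \<theta> F | F. F face_of degree_polyhedron A \<theta> \<and> F \<noteq> {}}"

definition fan_boundary :: "int^'n^'d \<Rightarrow> int^'d \<Rightarrow> (real^'n) set" where
  "fan_boundary A \<theta> =
     top_of_set (kernel_space A) frontier_of (\<Union>(normal_fan A \<theta>))"

text \<open>The torus \<open>(\<complex>\<^sup>*)\<^sup>n\<close> acts by \<open>x\<^sub>j \<mapsto> t\<^sub>j x\<^sub>j\<close>; on \<open>X(A,\<theta>)\<close> it acts through its quotient,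
  the dense torus \<open>Hom(ker\<^sub>\<int> A, \<complex>\<^sup>*)\<close>, so it has the same orbits as the latter.\<close>

definition torus_scale :: "complex^'n \<Rightarrow> 'n cpoly \<Rightarrow> 'n cpoly" where
  "torus_scale t f =
     (\<Sum>u\<in>Poly_Mapping.keys f.
        Poly_Mapping.single u ((\<Prod>j\<in>UNIV. (t $ j) ^ (u $ j)) * Poly_Mapping.lookup f u))"

definition torus_act :: "complex^'n \<Rightarrow> 'n cpoly set \<Rightarrow> 'n cpoly set" where
  "torus_act t \<pp> = {f. torus_scale t f \<in> \<pp>}"

text \<open>The exponent \<open>u\<close> of a monomial \<open>x\<^sup>u\<close> of degree \<open>r\<theta>\<close> lies on the face of \<open>r P\<^sub>\<theta>\<close>
  dual to \<open>\<sigma>\<close>. For \<open>r = 0\<close> this is the recession cone of the face, which is why the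
  condition is not phrased by scaling the face itself.\<close>

definition on_dual_face ::
  "int^'n^'d \<Rightarrow> int^'d \<Rightarrow> (real^'n) set \<Rightarrow> nat \<Rightarrow> nat^'n \<Rightarrow> bool" where
  "on_dual_face A \<theta> \<sigma> r u \<longleftrightarrow> monom_degree A u = int r *s \<theta> \<and>
     (\<forall>w\<in>\<sigma>. \<forall>v\<in>degree_polyhedron A \<theta>. w \<bullet> nat_vec u \<le> real r * (w \<bullet> v))"

text \<open>The distinguished point \<open>\<gamma>\<^sub>\<sigma>\<close> of the affine chart \<open>Spec \<complex>[\<sigma>\<^sup>\<or> \<inter> ker\<^sub>\<int> A]\<close>, the semigroup
  homomorphism with value 1 on \<open>\<sigma>\<^sup>\<bottom>\<close> and 0 elsewhere. As a point of \<open>Proj R\<close> it is the kernel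
  of the graded homomorphism \<open>R \<rightarrow> \<complex>[z]\<close> that sends \<open>x\<^sup>u\<close> of degree \<open>r\<theta>\<close> to \<open>z\<^sup>r\<close> if
  \<open>u\<close> lies on the face of \<open>r P\<^sub>\<theta>\<close> dual to \<open>\<sigma>\<close>, and to 0 otherwise.\<close>

definition distinguished_point ::
  "int^'n^'d \<Rightarrow> int^'d \<Rightarrow> (real^'n) set \<Rightarrow> 'n cpoly set" where
  "distinguished_point A \<theta> \<sigma> =
     {f \<in> carrier (veronese_ring A \<theta>).
        \<forall>r. (\<Sum>u\<in>{u \<in> Poly_Mapping.keys f. on_dual_face A \<theta> \<sigma> r u}. Poly_Mapping.lookup f u) = 0}"

definition torus_orbit ::
  "int^'n^'d \<Rightarrow> int^'d \<Rightarrow> (real^'n) set \<Rightarrow> 'n cpoly set set" where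
  "torus_orbit A \<theta> \<sigma> =
     {torus_act t (distinguished_point A \<theta> \<sigma>) | t. \<forall>j. t $ j \<noteq> 0}"

definition core :: "int^'n^'d \<Rightarrow> int^'d \<Rightarrow> 'n cpoly set set" where
  "core A \<theta> =
     \<Union>{torus_orbit A \<theta> \<sigma> | \<sigma>. \<sigma> \<in> normal_fan A \<theta> \<and> \<not> \<sigma> \<subseteq> fan_boundary A \<theta>}"

end

theory Submission
  imports Defs "HOL-Computational_Algebra.Polynomial"
begin

text \<open>Let \<open>Z\<close> be the set of \<open>z \<in> \<complex>\<^sup>n\<close> with \<open>(|z\<^sub>1|, \<dots>, |z\<^sub>n|) \<in> P\<^sub>\<theta>\<close>. As in the theorem of Kempf and
  Ness, sending \<open>z\<close> to the ideal of the homogeneous elements of \<open>R\<close> that vanish at \<open>z\<close> presents \<open>X(A,\<theta>)\<close>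
  as a quotient of \<open>Z\<close> by a proper map. For \<open>p \<in> P\<^sub>\<theta>\<close> let \<open>r(p)\<close> be the shortest vector among the
  \<open>u \<in> P\<^sub>\<theta>\<close> with \<open>u \<le> p\<close> coordinatewise. The difference \<open>p - r(p)\<close> is a recession direction of
  \<open>P\<^sub>\<theta>\<close>, so the segment from \<open>p\<close> to \<open>r(p)\<close> stays in the face of \<open>p\<close>, and \<open>r(p)\<close> lies on a bounded
  face. Moving the moduli of \<open>z\<close> along these segments and keeping the phases descends to a
  deformation retraction of \<open>X(A,\<theta>)\<close> onto the part over the bounded faces, which is the core.\<close>

text \<open>A motion on Z descends to X(A,\<theta>) if it respects the fibres. Vectors z and z' with
  the same ideal satisfy z'^u = c^r z^u for all monomials of degree r \<theta>. Taking moduli and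
  using strict monotonicity of ln gives |z_j| = |z'_j|, so only phases vary within a fibre. Hence
  every motion that is prescribed by the moduli, keeps the phases and leaves zero coordinates zero
  descends. The shortest vector serves as r(p) because it is unique, which yields continuity, and
  because the norm is monotone on nonnegative vectors, which makes r(p) minimal for the
  coordinatewise order. The obstacle is topological: the topology of X(A,\<theta>) is generated by
  ratios of homogeneous elements, and a homotopy has to pass to the quotient together with its time
  parameter. Properness settles this. It needs compactness from finitely many ratios, obtained by
  playing the superlinear growth of the sum of p ln p against bounds that finite generation carries
  over to all monomials. Integral vertices supply, for each z in Z, a monomial of degree \<theta>
  that is nonzero at z; it is the denominator of these ratios.\<close>

section \<open>Cohomology of a pair with vanishing relative homology\<close>

text \<open>Singular chain groups are free, so vanishing of the homology of \<open>(X, S)\<close> yields, generator by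
  generator, an operator \<open>D\<close> for which \<open>1 - \<partial>D - D\<partial>\<close> is a chain retraction onto the chains of \<open>S\<close>. Unlike
  an isomorphism in homology, this can be dualised directly.\<close>

definition rel_filling :: "'a topology \<Rightarrow> 'a set \<Rightarrow> nat \<Rightarrow> 'a chain \<Rightarrow> 'a chain" where
  "rel_filling X S p c =
     (SOME e. singular_chain (Suc p) X e \<and> singular_chain p (subtopology X S) (c - chain_boundary (Suc p) e))"

lemma rel_filling:
  assumes "singular_relboundary p X S c"
  shows "singular_chain (Suc p) X (rel_filling X S p c)"
    and "singular_chain p (subtopology X S) (c - chain_boundary (Suc p) (rel_filling X S p c))"
proof -
  have "\<exists>e. singular_chain (Suc p) X e \<and> singular_chain p (subtopology X S) (c - chain_boundary (Suc p) e)"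
    using assms by (force simp: singular_relboundary)
  from someI_ex[OF this] show "singular_chain (Suc p) X (rel_filling X S p c)"
    and "singular_chain p (subtopology X S) (c - chain_boundary (Suc p) (rel_filling X S p c))"
    unfolding rel_filling_def by auto
qed

text \<open>The value 0 on simplices of S makes the retraction the identity on chains of S. Any
  other simplex is first corrected by the operator applied to its boundary, which turns it into a
  relative cycle that can be filled.\<close>

primrec contraction_gen :: "'a topology \<Rightarrow> 'a set \<Rightarrow> nat \<Rightarrow> ((nat \<Rightarrow> real) \<Rightarrow> 'a) \<Rightarrow> 'a chain" where
  "contraction_gen X S 0 \<sigma> =
     (if singular_simplex 0 (subtopology X S) \<sigma> then 0 else rel_filling X S 0 (frag_of \<sigma>))"
| "contraction_gen X S (Suc p) \<sigma> =
     (if singular_simplex (Suc p) (subtopology X S) \<sigma> then 0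
      else rel_filling X S (Suc p)
             (frag_of \<sigma> - frag_extend (contraction_gen X S p) (chain_boundary (Suc p) (frag_of \<sigma>))))"

definition contraction :: "'a topology \<Rightarrow> 'a set \<Rightarrow> nat \<Rightarrow> 'a chain \<Rightarrow> 'a chain" where
  "contraction X S p = frag_extend (contraction_gen X S p)"

text \<open>In degree 0 the truncated index \<open>p - Suc 0\<close> is harmless because
  \<open>chain_boundary 0\<close> is zero.\<close>

definition retract_chain :: "'a topology \<Rightarrow> 'a set \<Rightarrow> nat \<Rightarrow> 'a chain \<Rightarrow> 'a chain" where
  "retract_chain X S p c =
     c - chain_boundary (Suc p) (contraction X S p c) - contraction X S (p - Suc 0) (chain_boundary p c)"

lemma contraction_0 [simp]: "contraction X S p 0 = 0"
  by (simp add: contraction_def)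

lemma contraction_add: "contraction X S p (a + b) = contraction X S p a + contraction X S p b"
  by (simp add: contraction_def frag_extend_add)

lemma contraction_diff: "contraction X S p (a - b) = contraction X S p a - contraction X S p b"
  by (simp add: contraction_def frag_extend_diff)

lemma retract_chain_0 [simp]: "retract_chain X S p 0 = 0"
  by (simp add: retract_chain_def)

lemma retract_chain_add:
  "retract_chain X S p (a + b) = retract_chain X S p a + retract_chain X S p b"
  by (simp add: retract_chain_def contraction_add chain_boundary_add)

lemma retract_chain_diff:
  "retract_chain X S p (a - b) = retract_chain X S p a - retract_chain X S p b"
  by (simp add: retract_chain_def contraction_diff chain_boundary_diff)

lemma contraction_subtopology:
  assumes "singular_chain p (subtopology X S) c"
  shows "contraction X S p c = 0"
  unfolding contraction_def
proof (rule frag_extend_eq_0)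
  fix \<sigma> assume "\<sigma> \<in> Poly_Mapping.keys c"
  then have "singular_simplex p (subtopology X S) \<sigma>"
    using assms by (auto simp: singular_chain_def)
  then show "contraction_gen X S p \<sigma> = 0"
    by (cases p) auto
qed

lemma retract_chain_subtopology:
  assumes "singular_chain p (subtopology X S) c"
  shows "retract_chain X S p c = c"
  using contraction_subtopology[OF assms] contraction_subtopology[OF singular_chain_boundary[OF assms]]
  by (simp add: retract_chain_def)

lemma singular_chain_subtopology_imp:
  "singular_chain p (subtopology X S) c \<Longrightarrow> singular_chain p X c"
  by (simp add: singular_chain_subtopology)

locale acyclic_pair =
  fixes X :: "'a topology" and S :: "'a set"
  assumes acyclic: "\<And>p c. singular_relcycle p X S c \<Longrightarrow> singular_relboundary p X S c"
begin

text \<open>Both conclusions go through one induction: the chain to be filled in degree p + 1 is a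
  relative cycle only because the retraction of its boundary is already known to lie in S.\<close>

lemma contraction_gen:
  assumes "singular_simplex p X \<sigma>"
  shows "singular_chain (Suc p) X (contraction_gen X S p \<sigma>)
       \<and> singular_chain p (subtopology X S) (retract_chain X S p (frag_of \<sigma>))"
  using assms
proof (induction p arbitrary: \<sigma>)
  case 0
  show ?case
  proof (cases "singular_simplex 0 (subtopology X S) \<sigma>")
    case True
    then show ?thesis
      by (simp add: retract_chain_subtopology singular_chain_of)
  next
    case False
    have "singular_relcycle 0 X S (frag_of \<sigma>)"
      using 0 by (simp add: singular_relcycle singular_chain_of chain_boundary_def)
    from rel_filling[OF acyclic[OF this]] show ?thesis
      using False by (simp add: retract_chain_def contraction_def chain_boundary_of)
  qed
next
  case (Suc p)
  have chain: "singular_chain (Suc (Suc p)) X (contraction_gen X S (Suc p) \<sigma>)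
       \<and> singular_chain (Suc p) (subtopology X S) (retract_chain X S (Suc p) (frag_of \<sigma>))"
    if nS: "\<not> singular_simplex (Suc p) (subtopology X S) \<sigma>"
  proof -
    define b where "b = chain_boundary (Suc p) (frag_of \<sigma>)"
    have b: "singular_chain p X b"
      using Suc.prems singular_chain_boundary_alt[of p X "frag_of \<sigma>"]
      by (simp add: b_def singular_chain_of)
    have Db: "singular_chain (Suc p) X (contraction X S p b)"
      unfolding contraction_def using b Suc.IH
      by (intro singular_chain_extend) (auto simp: singular_chain_def)
    have rb: "singular_chain p (subtopology X S) (retract_chain X S p b)"
      using b unfolding singular_chain_def[of p X]
    proof (induction b rule: frag_induction)
      case (one x)
      then show ?case using Suc.IH by simp
    qed (auto simp: retract_chain_diff singular_chain_diff)
    have bb: "chain_boundary p b = 0"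
      using chain_boundary_boundary_alt[of p X "frag_of \<sigma>"] Suc.prems
      by (simp add: b_def singular_chain_of)
    define x where "x = frag_of \<sigma> - contraction X S p b"
    \<comment> \<open>The last term of \<open>retract_chain\<close> drops out since b is itself a
      boundary.\<close>
    have "chain_boundary (Suc p) x = retract_chain X S p b"
      by (simp add: x_def chain_boundary_diff retract_chain_def bb flip: b_def)
    then have "singular_relcycle (Suc p) X S x"
      using rb Db Suc.prems
      by (simp add: singular_relcycle x_def singular_chain_diff singular_chain_of)
    from rel_filling[OF acyclic[OF this]] show ?thesis
      using nS by (simp add: retract_chain_def contraction_def x_def b_def algebra_simps)
  qed
  show ?case
  proof (cases "singular_simplex (Suc p) (subtopology X S) \<sigma>")
    case True
    then show ?thesis
      by (simp add: retract_chain_subtopology singular_chain_of)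
  qed (use chain in blast)
qed

lemma singular_chain_contraction:
  "singular_chain p X c \<Longrightarrow> singular_chain (Suc p) X (contraction X S p c)"
  unfolding contraction_def using contraction_gen
  by (intro singular_chain_extend) (auto simp: singular_chain_def)

lemma singular_chain_retract_chain:
  "singular_chain p X c \<Longrightarrow> singular_chain p (subtopology X S) (retract_chain X S p c)"
  unfolding singular_chain_def[of p X]
proof (induction c rule: frag_induction)
  case (one x)
  then show ?case using contraction_gen by simp
qed (auto simp: retract_chain_diff singular_chain_diff)

lemma chain_boundary_retract_chain:
  assumes "singular_chain p X c"
  shows "chain_boundary p (retract_chain X S p c) = retract_chain X S (p - Suc 0) (chain_boundary p c)"
proof (cases p)
  case 0
  then show ?thesis by (simp add: chain_boundary_def)
next
  case (Suc q)
  have "chain_boundary p (chain_boundary (Suc p) (contraction X S p c)) = 0"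
    using chain_boundary_boundary_alt singular_chain_contraction[OF assms] by blast
  moreover have "chain_boundary q (chain_boundary (Suc q) c) = 0"
    using chain_boundary_boundary_alt assms Suc by blast
  ultimately show ?thesis
    by (simp add: retract_chain_def chain_boundary_diff Suc)
qed

end

section \<open>Integral cochains and induced maps in cohomology\<close>

lemma carrier_cochain_group:
  "carrier (cochain_group p X) =
     {\<phi> \<in> extensional (singular_chain_set p X).
        \<forall>a b. singular_chain p X a \<longrightarrow> singular_chain p X b \<longrightarrow> \<phi> (a + b) = \<phi> a + \<phi> b}"
  by (auto simp: cochain_group_def hom_def integer_group_def)

lemma mult_cochain_group:
  "\<phi> \<otimes>\<^bsub>cochain_group p X\<^esub> \<psi> = restrict (\<lambda>c. \<phi> c + \<psi> c) (singular_chain_set p X)"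
  by (simp add: cochain_group_def)

lemma one_cochain_group:
  "\<one>\<^bsub>cochain_group p X\<^esub> = restrict (\<lambda>c. 0) (singular_chain_set p X)"
  by (simp add: cochain_group_def)

lemma cochain_add:
  "\<lbrakk>\<phi> \<in> carrier (cochain_group p X); singular_chain p X a; singular_chain p X b\<rbrakk>
     \<Longrightarrow> \<phi> (a + b) = \<phi> a + \<phi> b"
  by (simp add: carrier_cochain_group)

lemma cochain_zero: "\<phi> \<in> carrier (cochain_group p X) \<Longrightarrow> \<phi> 0 = 0"
  using cochain_add[of \<phi> p X 0 0] by simp

lemma cochain_restrict:
  assumes "\<And>a b. \<lbrakk>singular_chain p X a; singular_chain p X b\<rbrakk> \<Longrightarrow> f (a + b) = f a + f b"
  shows "restrict f (singular_chain_set p X) \<in> carrier (cochain_group p X)"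
  using assms by (auto simp: carrier_cochain_group singular_chain_add)

lemma comm_group_cochain_group: "comm_group (cochain_group p X)"
proof (rule comm_groupI)
  fix \<phi> \<psi> \<chi> assume phi: "\<phi> \<in> carrier (cochain_group p X)"
  have ext: "\<phi> c = undefined" if "\<not> singular_chain p X c" for c
    using phi that by (auto simp: carrier_cochain_group extensional_def)
  show "\<exists>\<psi>\<in>carrier (cochain_group p X). \<psi> \<otimes>\<^bsub>cochain_group p X\<^esub> \<phi> = \<one>\<^bsub>cochain_group p X\<^esub>"
    using phi
    by (intro bexI[of _ "restrict (\<lambda>c. - \<phi> c) (singular_chain_set p X)"])
       (auto simp: cochain_restrict cochain_add mult_cochain_group one_cochain_group)
  show "\<one>\<^bsub>cochain_group p X\<^esub> \<otimes>\<^bsub>cochain_group p X\<^esub> \<phi> = \<phi>"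
    using ext by (auto simp: mult_cochain_group one_cochain_group)
qed (auto simp: mult_cochain_group one_cochain_group cochain_restrict cochain_add
        algebra_simps singular_chain_add)

lemma coboundary_in_carrier:
  "\<phi> \<in> carrier (cochain_group p X) \<Longrightarrow> coboundary p X \<phi> \<in> carrier (cochain_group (Suc p) X)"
  by (simp add: coboundary_def cochain_restrict chain_boundary_add cochain_add singular_chain_boundary_alt)

lemma coboundary_hom: "coboundary p X \<in> hom (cochain_group p X) (cochain_group (Suc p) X)"
  by (auto simp: hom_def coboundary_in_carrier)
     (auto simp: coboundary_def mult_cochain_group singular_chain_boundary_alt)

lemma singular_cocycle_set_eq:
  "singular_cocycle_set p X =
     {\<phi> \<in> carrier (cochain_group p X).
        \<forall>c. singular_chain (Suc p) X c \<longrightarrow> \<phi> (chain_boundary (Suc p) c) = 0}"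
  by (auto simp: singular_cocycle_set_def coboundary_def one_cochain_group fun_eq_iff restrict_def)

lemma subgroup_singular_cocycle_set: "subgroup (singular_cocycle_set p X) (cochain_group p X)"
proof -
  interpret group_hom "cochain_group p X" "cochain_group (Suc p) X" "coboundary p X"
    using comm_group_cochain_group coboundary_hom
    by (auto simp: group_hom_def group_hom_axioms_def comm_group_def)
  show ?thesis
    using subgroup_kernel by (simp add: kernel_def singular_cocycle_set_def)
qed

lemma subgroup_singular_coboundary_set: "subgroup (singular_coboundary_set p X) (cochain_group p X)"
proof (cases p)
  case 0
  then show ?thesis
    using comm_group_cochain_group[of 0 X]
    by (simp add: singular_coboundary_set_def comm_group_def group.triv_subgroup)
next
  case (Suc q)
  interpret group_hom "cochain_group q X" "cochain_group p X" "coboundary q X"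
    using comm_group_cochain_group coboundary_hom Suc
    by (auto simp: group_hom_def group_hom_axioms_def comm_group_def)
  show ?thesis
    using img_is_subgroup by (simp add: singular_coboundary_set_def Suc)
qed

lemma cochain_map_hom:
  assumes "continuous_map X Y f"
  shows "cochain_map p X f \<in> hom (cochain_group p Y) (cochain_group p X)"
proof (rule homI)
  fix \<phi> assume "\<phi> \<in> carrier (cochain_group p Y)"
  then show "cochain_map p X f \<phi> \<in> carrier (cochain_group p X)"
    unfolding cochain_map_def carrier_chain_group using singular_chain_chain_map[OF _ assms]
    by (intro cochain_restrict) (simp add: chain_map_add cochain_add)
qed (use singular_chain_chain_map[OF _ assms] in
      \<open>auto simp: cochain_map_def mult_cochain_group restrict_def fun_eq_iff\<close>)

lemma cochain_map_cocycle:
  assumes "continuous_map X Y f" "\<phi> \<in> singular_cocycle_set p Y"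
  shows "cochain_map p X f \<phi> \<in> singular_cocycle_set p X"
proof -
  have "cochain_map p X f \<phi> \<in> carrier (cochain_group p X)"
    using hom_in_carrier[OF cochain_map_hom[OF assms(1)]] assms(2)
    by (simp add: singular_cocycle_set_eq)
  moreover have "cochain_map p X f \<phi> (chain_boundary (Suc p) c) = 0"
    if "singular_chain (Suc p) X c" for c
  proof -
    have "\<phi> (chain_boundary (Suc p) (chain_map (Suc p) f c)) = 0"
      using assms(2) singular_chain_chain_map[OF that assms(1)] by (simp add: singular_cocycle_set_eq)
    then show ?thesis
      using that chain_boundary_chain_map[OF that, of f]
      by (simp add: cochain_map_def singular_chain_boundary_alt)
  qed
  ultimately show ?thesis by (simp add: singular_cocycle_set_eq)
qed

lemma cochain_map_coboundary:
  assumes "continuous_map X Y f" "\<phi> \<in> singular_coboundary_set p Y"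
  shows "cochain_map p X f \<phi> \<in> singular_coboundary_set p X"
proof (cases p)
  case 0
  then show ?thesis
    using assms(2) singular_chain_chain_map[OF _ assms(1)]
    by (auto simp: singular_coboundary_set_def cochain_map_def one_cochain_group restrict_def fun_eq_iff)
next
  case (Suc q)
  then obtain \<psi> where psi: "\<psi> \<in> carrier (cochain_group q Y)" "\<phi> = coboundary q Y \<psi>"
    using assms(2) by (auto simp: singular_coboundary_set_def)
  have "cochain_map p X f \<phi> = coboundary q X (cochain_map q X f \<psi>)"
    using chain_boundary_chain_map[of "Suc q" X _ f] singular_chain_chain_map[OF _ assms(1)]
    by (auto simp: psi Suc cochain_map_def coboundary_def singular_chain_boundary_alt restrict_def fun_eq_iff)
  then show ?thesis
    using hom_in_carrier[OF cochain_map_hom[OF assms(1)] psi(1)]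
    by (auto simp: singular_coboundary_set_def Suc)
qed

text \<open>The cocycles inherit their multiplication from the cochain group, so the cosets that
  form the quotient can be computed in the whole cochain group.\<close>

lemma carrier_cohomology_group:
  "carrier (cohomology_group p X) =
     (\<lambda>\<phi>. singular_coboundary_set p X #>\<^bsub>cochain_group p X\<^esub> \<phi>) ` singular_cocycle_set p X"
proof -
  interpret subgroup "singular_cocycle_set p X" "cochain_group p X"
    by (rule subgroup_singular_cocycle_set)
  have "carrier (subgroup_generated (cochain_group p X) (singular_cocycle_set p X)) = singular_cocycle_set p X"
    using carrier_subgroup_generated_subgroup comm_group_cochain_group comm_group.axioms(2) by blast
  then show ?thesis
    by (simp add: cohomology_group_def carrier_FactGroup r_coset_def)
qed

lemma mult_cohomology_group:
  "K \<otimes>\<^bsub>cohomology_group p X\<^esub> L = K <#>\<^bsub>cochain_group p X\<^esub> L"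
  by (simp add: cohomology_group_def set_mult_def)

text \<open>The pullback of a coset is a translate of the pulled back coboundaries of Y. These lie
  among the coboundaries of X and contain the identity, so the product in
  \<open>cohomology_induced\<close> absorbs them and leaves a single coset.\<close>

lemma cohomology_induced_coset:
  assumes "continuous_map X Y f" "\<phi> \<in> singular_cocycle_set p Y"
  shows "cohomology_induced p X f (singular_coboundary_set p Y #>\<^bsub>cochain_group p Y\<^esub> \<phi>) =
         singular_coboundary_set p X #>\<^bsub>cochain_group p X\<^esub> cochain_map p X f \<phi>"
proof -
  interpret G: comm_group "cochain_group p X" by (rule comm_group_cochain_group)
  let ?B = "singular_coboundary_set p X" and ?B' = "singular_coboundary_set p Y"
  let ?f = "cochain_map p X f"
  have B: "subgroup ?B (cochain_group p X)" by (rule subgroup_singular_coboundary_set)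
  have B': "subgroup ?B' (cochain_group p Y)" by (rule subgroup_singular_coboundary_set)
  have phi: "\<phi> \<in> carrier (cochain_group p Y)" using assms(2) by (simp add: singular_cocycle_set_eq)
  have h: "?f \<in> hom (cochain_group p Y) (cochain_group p X)" by (rule cochain_map_hom[OF assms(1)])
  have im: "?f ` (?B' #>\<^bsub>cochain_group p Y\<^esub> \<phi>) = (?f ` ?B') #>\<^bsub>cochain_group p X\<^esub> ?f \<phi>"
    using hom_mult[OF h _ phi] subgroup.mem_carrier[OF B']
    by (simp add: r_coset_def image_UN cong: SUP_cong_simp)
  have "?f ` ?B' \<subseteq> ?B" using cochain_map_coboundary[OF assms(1)] by blast
  moreover have "\<one>\<^bsub>cochain_group p X\<^esub> \<in> ?f ` ?B'"
  proof
    show "\<one>\<^bsub>cochain_group p Y\<^esub> \<in> ?B'" by (rule subgroup.one_closed[OF B'])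
    show "\<one>\<^bsub>cochain_group p X\<^esub> = ?f \<one>\<^bsub>cochain_group p Y\<^esub>"
      using h comm_group_cochain_group[of p X] comm_group_cochain_group[of p Y] 
      by (metis comm_group.axioms(2) hom_one)
  qed
  ultimately have BB: "?B <#>\<^bsub>cochain_group p X\<^esub> (?f ` ?B') = ?B"
  proof (intro equalityI subsetI)
    fix x assume sub: "?f ` ?B' \<subseteq> ?B" and "x \<in> ?B <#>\<^bsub>cochain_group p X\<^esub> (?f ` ?B')"
    then show "x \<in> ?B"
      using subgroup.m_closed[OF B] by (auto simp: set_mult_def)
  next
    fix x assume one: "\<one>\<^bsub>cochain_group p X\<^esub> \<in> ?f ` ?B'" and x: "x \<in> ?B"
    then have "x = x \<otimes>\<^bsub>cochain_group p X\<^esub> \<one>\<^bsub>cochain_group p X\<^esub>"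
      using subgroup.mem_carrier[OF B x] by simp
    then show "x \<in> ?B <#>\<^bsub>cochain_group p X\<^esub> (?f ` ?B')"
      unfolding set_mult_def using one x by blast
  qed
  have "?f ` ?B' \<subseteq> carrier (cochain_group p X)"
    using hom_in_carrier[OF h] subgroup.mem_carrier[OF B'] by blast
  then have "?B <#>\<^bsub>cochain_group p X\<^esub> ((?f ` ?B') #>\<^bsub>cochain_group p X\<^esub> ?f \<phi>)
     = (?B <#>\<^bsub>cochain_group p X\<^esub> (?f ` ?B')) #>\<^bsub>cochain_group p X\<^esub> ?f \<phi>"
    using subgroup.subset[OF B] hom_in_carrier[OF h phi] by (simp add: G.setmult_rcos_assoc)
  then show ?thesis
    by (simp add: cohomology_induced_def im BB)
qed

text \<open>Dual form of 1 = r + \<partial>D + D\<partial>, with r the retraction of chains.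
  Composition with r extends cocycles from S to X; for injectivity the identity yields an explicit
  primitive.\<close>

proposition acyclic_pair_imp_cohomology_iso:
  assumes "acyclic_pair X S"
  shows "cohomology_induced p (subtopology X S) id
           \<in> iso (cohomology_group p X) (cohomology_group p (subtopology X S))"
proof -
  interpret acyclic_pair X S by (rule assms)
  let ?Y = "subtopology X S"
  let ?f = "cochain_map p ?Y id" and ?F = "cohomology_induced p ?Y id"
  let ?G = "cochain_group p X" and ?H = "cochain_group p ?Y"
  let ?BG = "singular_coboundary_set p X" and ?BH = "singular_coboundary_set p ?Y"
  interpret G: comm_group ?G by (rule comm_group_cochain_group)
  interpret H: comm_group ?H by (rule comm_group_cochain_group)
  interpret BG: subgroup ?BG ?G by (rule subgroup_singular_coboundary_set)
  interpret BH: subgroup ?BH ?H by (rule subgroup_singular_coboundary_set)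
  interpret BG: normal ?BG ?G 
    by (simp add: BG.subgroup_axioms G.normal_iff_subgroup)
  interpret BH: normal ?BH ?H
    by (simp add: BH.subgroup_axioms H.normal_iff_subgroup)
  have cont: "continuous_map ?Y X id" by (rule continuous_map_id_subt)
  have f_eval: "?f \<phi> c = \<phi> c" if "singular_chain p ?Y c" for \<phi> c
    using that by (simp add: cochain_map_def chain_map_ident)
  have h: "?f \<in> hom ?G ?H" by (rule cochain_map_hom[OF cont])
  have cyc: "\<phi> \<in> carrier ?G" if "\<phi> \<in> singular_cocycle_set p X" for \<phi>
    using that by (simp add: singular_cocycle_set_eq)
  have "?F \<in> hom (cohomology_group p X) (cohomology_group p ?Y)"
  proof (rule homI)
    fix K assume "K \<in> carrier (cohomology_group p X)"
    then show "?F K \<in> carrier (cohomology_group p ?Y)"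
      using cochain_map_cocycle[OF cont] 
      by (auto simp: carrier_cohomology_group cohomology_induced_coset[OF cont])
  next
    fix K L assume "K \<in> carrier (cohomology_group p X)" "L \<in> carrier (cohomology_group p X)"
    then obtain \<phi> \<psi> where phi: "\<phi> \<in> singular_cocycle_set p X" "K = ?BG #>\<^bsub>?G\<^esub> \<phi>"
      and psi: "\<psi> \<in> singular_cocycle_set p X" "L = ?BG #>\<^bsub>?G\<^esub> \<psi>"
      by (auto simp: carrier_cohomology_group)
    have "\<phi> \<otimes>\<^bsub>?G\<^esub> \<psi> \<in> singular_cocycle_set p X"
      using phi psi subgroup.m_closed[OF subgroup_singular_cocycle_set] by blast
    then show "?F (K \<otimes>\<^bsub>cohomology_group p X\<^esub> L) = ?F K \<otimes>\<^bsub>cohomology_group p ?Y\<^esub> ?F L"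
      using phi(1) psi(1) cyc hom_in_carrier[OF h]
      by (simp add: mult_cohomology_group phi(2) psi(2) BG.rcos_sum BH.rcos_sum
          cohomology_induced_coset[OF cont] hom_mult[OF h])
  qed
  moreover have "inj_on ?F (carrier (cohomology_group p X))"
  proof (rule inj_onI)
    fix K L assume "K \<in> carrier (cohomology_group p X)" "L \<in> carrier (cohomology_group p X)"
      and eq: "?F K = ?F L"
    then obtain \<phi> \<psi> where phi: "\<phi> \<in> singular_cocycle_set p X" "K = ?BG #>\<^bsub>?G\<^esub> \<phi>"
      and psi: "\<psi> \<in> singular_cocycle_set p X" "L = ?BG #>\<^bsub>?G\<^esub> \<psi>"
      by (auto simp: carrier_cohomology_group)
    have "?BH #>\<^bsub>?H\<^esub> ?f \<phi> = ?BH #>\<^bsub>?H\<^esub> ?f \<psi>"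
      using eq phi psi by (simp add: cohomology_induced_coset[OF cont])
    then have "?f \<phi> \<in> ?BH #>\<^bsub>?H\<^esub> ?f \<psi>"
      using H.rcos_self[OF hom_in_carrier[OF h cyc[OF phi(1)]] BH.subgroup_axioms] by simp
    then obtain \<beta> where beta: "\<beta> \<in> ?BH" "?f \<phi> = \<beta> \<otimes>\<^bsub>?H\<^esub> ?f \<psi>"
      by (auto simp: r_coset_def)
    define \<delta> where "\<delta> = restrict (\<lambda>c. \<phi> c - \<psi> c) (singular_chain_set p X)"
    have dG: "\<delta> \<in> carrier ?G"
      unfolding \<delta>_def using cyc[OF phi(1)] cyc[OF psi(1)]
      by (intro cochain_restrict) (simp add: cochain_add)
    have dphi: "\<phi> = \<delta> \<otimes>\<^bsub>?G\<^esub> \<psi>"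
      using cyc[OF phi(1)] by (auto simp: \<delta>_def mult_cochain_group carrier_cochain_group extensional_def fun_eq_iff)
    have dbeta: "\<delta> c = \<beta> c" if "singular_chain p ?Y c" for c
    proof -
      have "\<phi> c = \<beta> c + \<psi> c"
        using fun_cong[OF beta(2), of c] that by (simp add: f_eval mult_cochain_group)
      then show ?thesis
        using singular_chain_subtopology_imp[OF that] by (simp add: \<delta>_def)
    qed
    have dbd: "\<delta> (chain_boundary (Suc p) c) = 0" if "singular_chain (Suc p) X c" for c
      using that phi(1) psi(1) by (simp add: \<delta>_def singular_cocycle_set_eq singular_chain_boundary_alt)
    \<comment> \<open>Evaluate \<delta> on c = r c + \<partial>D c + D\<partial> c: it agrees with
      \<beta> on r c and, being a cocycle, vanishes on \<partial>D c.\<close>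
    have split: "\<delta> c = \<beta> (retract_chain X S p c) + \<delta> (contraction X S (p - Suc 0) (chain_boundary p c))"
      if c: "singular_chain p X c" for c
    proof -
      let ?D = "chain_boundary (Suc p) (contraction X S p c)"
      let ?E = "contraction X S (p - Suc 0) (chain_boundary p c)"
      have 1: "singular_chain p X ?D"
        using c singular_chain_contraction singular_chain_boundary_alt by blast
      have 2: "singular_chain p X ?E"
      proof (cases p)
        case 0 then show ?thesis by (simp add: chain_boundary_def)
      next
        case (Suc q)
        then show ?thesis
          using c singular_chain_contraction[OF singular_chain_boundary_alt] by simp
      qed
      have "\<delta> c = \<delta> (retract_chain X S p c + ?D + ?E)"
        by (simp add: retract_chain_def)
      also have "\<dots> = \<delta> (retract_chain X S p c) + \<delta> ?D + \<delta> ?E"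
        using dG 1 2 singular_chain_subtopology_imp[OF singular_chain_retract_chain[OF c]]
        by (simp add: cochain_add singular_chain_add)
      finally show ?thesis
        using dbeta singular_chain_retract_chain[OF c] dbd singular_chain_contraction[OF c] by simp
    qed
    have "\<delta> \<in> ?BG"
    proof (cases p)
      case 0
      \<comment> \<open>In degree 0 the only coboundary is zero, so both terms of
        \<open>split\<close> vanish.\<close>
      have "\<delta> c = 0" if "singular_chain p X c" for c
        using split[OF that] beta(1) singular_chain_retract_chain[OF that] cochain_zero[OF dG]
        by (simp add: 0 singular_coboundary_set_def one_cochain_group chain_boundary_def)
      then show ?thesis
        using dG by (auto simp: 0 singular_coboundary_set_def one_cochain_group carrier_cochain_group
            extensional_def fun_eq_iff)
    next
      case (Suc q)
      obtain \<eta> where eta: "\<eta> \<in> carrier (cochain_group q ?Y)" "\<beta> = coboundary q ?Y \<eta>"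
        using beta(1) by (auto simp: singular_coboundary_set_def Suc)
      \<comment> \<open>Since r is a chain map and \<beta> is \<eta> after the boundary,
        \<open>split\<close> reads: \<delta> is this cochain after the boundary.\<close>
      define \<theta> where "\<theta> = restrict (\<lambda>c. \<eta> (retract_chain X S q c) + \<delta> (contraction X S q c)) (singular_chain_set q X)"
      have "\<theta> \<in> carrier (cochain_group q X)"
        unfolding \<theta>_def using eta(1) dG singular_chain_retract_chain singular_chain_contraction
        by (intro cochain_restrict) (simp add: retract_chain_add contraction_add cochain_add Suc)
      moreover have "\<delta> = coboundary q X \<theta>"
      proof
        fix c
        show "\<delta> c = coboundary q X \<theta> c"
        proof (cases "singular_chain p X c")
          case True
          then show ?thesis
            using split[OF True] singular_chain_retract_chain[OF True] chain_boundary_retract_chain[OF True]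
            by (simp add: eta(2) coboundary_def Suc \<theta>_def singular_chain_boundary_alt)
        next
          case False
          then show ?thesis using dG by (auto simp: coboundary_def Suc carrier_cochain_group extensional_def)
        qed
      qed
      ultimately show ?thesis by (auto simp: singular_coboundary_set_def Suc)
    qed
    then have "\<phi> \<in> ?BG #>\<^bsub>?G\<^esub> \<psi>"
      using dphi by (auto simp: r_coset_def)
    then show "K = L"
      using G.repr_independence[OF _ cyc[OF psi(1)] BG.subgroup_axioms] phi psi by metis
  qed
  moreover have "carrier (cohomology_group p ?Y) \<subseteq> ?F ` carrier (cohomology_group p X)"
  proof
    fix L assume "L \<in> carrier (cohomology_group p ?Y)"
    then obtain \<psi> where psi: "\<psi> \<in> singular_cocycle_set p ?Y" "L = ?BH #>\<^bsub>?H\<^esub> \<psi>"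
      by (auto simp: carrier_cohomology_group)
    then have psiH: "\<psi> \<in> carrier ?H" by (simp add: singular_cocycle_set_eq)
    define \<phi> where "\<phi> = restrict (\<lambda>c. \<psi> (retract_chain X S p c)) (singular_chain_set p X)"
    have "\<phi> \<in> carrier ?G"
      unfolding \<phi>_def using psiH singular_chain_retract_chain
      by (intro cochain_restrict) (simp add: retract_chain_add cochain_add)
    moreover have "\<phi> (chain_boundary (Suc p) c) = 0" if "singular_chain (Suc p) X c" for c
    proof -
      have "\<psi> (chain_boundary (Suc p) (retract_chain X S (Suc p) c)) = 0"
        using psi(1) singular_chain_retract_chain[OF that] by (simp add: singular_cocycle_set_eq)
      then show ?thesis
        using that chain_boundary_retract_chain[OF that]
        by (simp add: \<phi>_def singular_chain_boundary_alt)
    qed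
    ultimately have phi: "\<phi> \<in> singular_cocycle_set p X" by (simp add: singular_cocycle_set_eq)
    moreover have "?f \<phi> = \<psi>"
    proof
      fix c
      show "?f \<phi> c = \<psi> c"
        using psiH
        by (cases "singular_chain p ?Y c")
           (auto simp: f_eval \<phi>_def singular_chain_subtopology_imp retract_chain_subtopology,
            auto simp: cochain_map_def carrier_cochain_group extensional_def)
    qed
    ultimately show "L \<in> ?F ` carrier (cohomology_group p X)"
      using cohomology_induced_coset[OF cont phi] by (auto simp: carrier_cohomology_group psi(2))
  qed
  ultimately show ?thesis
    by (auto simp: iso_iff hom_def)
qed

text \<open>As a map of pairs the identity is homotopic to r, and r sends every chain into S. So
  each relative cycle is homologous to a chain of S, which is a relative boundary.\<close>

corollary deformation_retract_imp_cohomology_iso: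
  assumes "homotopic_with (\<lambda>h. h \<in> S \<rightarrow> S) X X id r" "r ` topspace X \<subseteq> S"
  shows "cohomology_induced p (subtopology X S) id
           \<in> iso (cohomology_group p X) (cohomology_group p (subtopology X S))"
proof (rule acyclic_pair_imp_cohomology_iso, unfold_locales)
  fix p c assume c: "singular_relcycle p X S c"
  have "homologous_rel p X S (chain_map p id c) (chain_map p r c)"
    by (rule homotopic_imp_homologous_rel_chain_maps[OF assms(1) c])
  moreover have ch: "singular_chain p X c" using c by (simp add: singular_relcycle)
  moreover have "continuous_map X (subtopology X S) r"
    using homotopic_with_imp_continuous_maps[OF assms(1)] assms(2)
    by (auto simp: continuous_map_in_subtopology)
  then have "singular_relboundary p X S (chain_map p r c)"
    using singular_chain_chain_map[OF ch] singular_chain_imp_relboundary by blast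
  ultimately show "singular_relboundary p X S c"
    using singular_relboundary_add[of p X S "c - chain_map p r c" "chain_map p r c"]
    by (simp add: homologous_rel_def chain_map_ident)
qed

section \<open>The polyhedron \<open>P\<^sub>\<theta>\<close> and its lattice points\<close>

definition vsupp :: "'a::zero^'n \<Rightarrow> 'n set" where
  "vsupp x = {j. x $ j \<noteq> 0}"

text \<open>The degree r part of the graded semigroup whose semigroup algebra is R.\<close>

definition lattice_points :: "int^'n^'d \<Rightarrow> int^'d \<Rightarrow> nat \<Rightarrow> (nat^'n) set" where
  "lattice_points A \<theta> r = {u. monom_degree A u = int r *s \<theta>}"

lemma mem_degree_polyhedron:
  "p \<in> degree_polyhedron A \<theta> \<longleftrightarrow>
     (\<forall>i. (\<Sum>j\<in>UNIV. real_of_int (A $ i $ j) * p $ j) = real_of_int (\<theta> $ i)) \<and> (\<forall>j. 0 \<le> p $ j)"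
  by (simp add: degree_polyhedron_def vec_eq_iff matrix_vector_mult_def real_mat_def real_vec_def)

lemma mem_lattice_points:
  "u \<in> lattice_points A \<theta> r \<longleftrightarrow> (\<forall>i. (\<Sum>j\<in>UNIV. A $ i $ j * int (u $ j)) = int r * \<theta> $ i)"
  by (simp add: lattice_points_def monom_degree_def vec_eq_iff matrix_vector_mult_def)

lemma zero_lattice_points: "0 \<in> lattice_points A \<theta> 0"
  by (simp add: mem_lattice_points)

lemma add_lattice_points:
  "\<lbrakk>u \<in> lattice_points A \<theta> r; v \<in> lattice_points A \<theta> s\<rbrakk> \<Longrightarrow> u + v \<in> lattice_points A \<theta> (r + s)"
  by (simp add: mem_lattice_points algebra_simps sum.distrib)

lemma smult_lattice_points:
  assumes "u \<in> lattice_points A \<theta> r" shows "k *s u \<in> lattice_points A \<theta> (k * r)"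
proof -
  have "(\<Sum>j\<in>UNIV. A $ i $ j * int ((k *s u) $ j)) = int k * (\<Sum>j\<in>UNIV. A $ i $ j * int (u $ j))" for i
    by (simp add: sum_distrib_left algebra_simps)
  then show ?thesis using assms by (simp add: mem_lattice_points)
qed

lemma diff_lattice_points:
  assumes "u \<in> lattice_points A \<theta> r" "v \<in> lattice_points A \<theta> s" "s \<le> r" "\<And>j. v $ j \<le> u $ j"
  shows "(\<chi> j. u $ j - v $ j) \<in> lattice_points A \<theta> (r - s)"
  using assms by (simp add: mem_lattice_points of_nat_diff algebra_simps sum_subtractf)

lemma convex_degree_polyhedron: "convex (degree_polyhedron A \<theta>)"
  unfolding convex_def
  by (auto simp: mem_degree_polyhedron algebra_simps sum.distrib simp flip: sum_distrib_left)
     (auto simp flip: distrib_right)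

lemma closed_degree_polyhedron: "closed (degree_polyhedron A \<theta>)"
proof -
  have "degree_polyhedron A \<theta> =
     (\<Inter>i. {p. (\<Sum>j\<in>UNIV. real_of_int (A $ i $ j) * p $ j) = real_of_int (\<theta> $ i)}) \<inter> (\<Inter>j. {p. 0 \<le> p $ j})"
    by (auto simp: mem_degree_polyhedron)
  also have "closed \<dots>"
    by (intro closed_Int closed_INT ballI closed_Collect_eq closed_Collect_le continuous_intros)
  finally show ?thesis .
qed

lemma nonneg_degree_polyhedron: "p \<in> degree_polyhedron A \<theta> \<Longrightarrow> 0 \<le> p $ j"
  by (simp add: mem_degree_polyhedron)

text \<open>Simultaneous Dirichlet approximation produces integral vectors so close to \<open>q p\<close> that their
  degree, being integral, has to be \<open>q \<theta>\<close> on the nose.\<close>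

lemma lattice_approximation:
  fixes p :: "real^'n"
  assumes p: "p \<in> degree_polyhedron A \<theta>" and "\<epsilon> > 0"
  obtains q m where "q > 0" "m \<in> lattice_points A \<theta> q" "vsupp m = vsupp p"
    "\<And>j. \<bar>real (m $ j) - real q * p $ j\<bar> < \<epsilon>"
proof -
  define K where "K = 1 + (\<Sum>i\<in>UNIV. \<Sum>j\<in>UNIV. \<bar>real_of_int (A $ i $ j)\<bar>)"
  have K: "K \<ge> 1" by (simp add: K_def sum_nonneg)
  \<comment> \<open>Staying within \<open>p $ j\<close> keeps positive coordinates positive after
    rounding; staying within \<open>1/K\<close> makes the error in each coordinate of the degree
    less than 1.\<close>
  define S where "S = insert \<epsilon> (insert (1/K) ((\<lambda>j. p $ j) ` vsupp p))"
  have S: "finite S" "S \<noteq> {}" "\<And>x. x \<in> S \<Longrightarrow> x > 0"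
    using assms(2) K nonneg_degree_polyhedron[OF p] by (auto simp: S_def vsupp_def less_le)
  define \<delta> where "\<delta> = Min S"
  have d: "\<delta> > 0" "\<delta> \<le> \<epsilon>" "\<delta> \<le> 1/K" "\<And>j. j \<in> vsupp p \<Longrightarrow> \<delta> \<le> p $ j"
    using S(3)[OF Min_in[OF S(1,2)]] Min_le[OF S(1)] by (auto simp: \<delta>_def S_def)
  obtain N where N: "N > 0" "1 / real N < \<delta>"
    using d(1) by (metis nat_approx_posE of_nat_0_less_iff zero_less_Suc)
  obtain f :: "nat \<Rightarrow> 'n" where f: "bij_betw f {..<CARD('n)} UNIV"
    using ex_bij_betw_nat_finite[of "UNIV :: 'n set"] by (auto simp: atLeast0LessThan)
  obtain q x where q: "0 < q" and x: "\<And>i. i < CARD('n) \<Longrightarrow> \<bar>of_int q * p $ (f i) - of_int (x i)\<bar> < 1/N"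
    using Dirichlet_approx_simult[OF N(1), where \<theta>="\<lambda>i. p $ (f i)" and n="CARD('n)"] by metis
  define g where "g = inv_into {..<CARD('n)} f"
  have g: "g j < CARD('n)" "f (g j) = j" for j
    using f bij_betw_inv_into_right[OF f, of j] bij_betw_imp_surj_on[OF f]
    by (auto simp: g_def) (metis UNIV_I inv_into_into lessThan_iff)
  have x': "\<bar>of_int q * p $ j - of_int (x (g j))\<bar> < \<delta>" for j
    using x[OF g(1)[of j]] N(2) g(2)[of j] by simp
  have d1: "\<delta> \<le> 1" using d(3) K by (smt (verit) divide_le_eq_1)
  have q1: "real_of_int q \<ge> 1" using q by simp
  have xz: "x (g j) = 0" if "j \<notin> vsupp p" for j
    using x'[of j] that d1 by (simp add: vsupp_def)
  have xp: "x (g j) > 0" if "j \<in> vsupp p" for j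
  proof -
    have "p $ j \<le> of_int q * p $ j"
      using q1 nonneg_degree_polyhedron[OF p, of j] by (simp add: mult_le_cancel_right1)
    then have "real_of_int (x (g j)) > 0" using x'[of j] d(4)[OF that] by linarith
    then show ?thesis by simp
  qed
  have x0: "x (g j) \<ge> 0" for j using xz[of j] xp[of j] by force
  define m :: "nat^'n" where "m = (\<chi> j. nat (x (g j)))"
  have m: "int (m $ j) = x (g j)" for j using x0 by (simp add: m_def)
  have m': "\<bar>real (m $ j) - real (nat q) * p $ j\<bar> < \<delta>" for j
    using x'[of j] m[of j] q by (metis abs_minus_commute of_int_of_nat_eq int_nat_eq less_imp_le)
  show ?thesis
  proof
    show "nat q > 0" using q by simp
    show "vsupp m = vsupp p"
    proof (rule Set.set_eqI)
      fix j show "j \<in> vsupp m \<longleftrightarrow> j \<in> vsupp p"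
        using xz[of j] xp[of j] m[of j] by (fastforce simp: vsupp_def)
    qed
    show "\<bar>real (m $ j) - real (nat q) * p $ j\<bar> < \<epsilon>" for j using m'[of j] d(2) by simp
    show "m \<in> lattice_points A \<theta> (nat q)"
      unfolding mem_lattice_points
    proof
      fix i
      let ?a = "\<lambda>j. real_of_int (A $ i $ j)"
      have "\<bar>(\<Sum>j\<in>UNIV. ?a j * real (m $ j)) - real (nat q) * \<theta> $ i\<bar>
          = \<bar>\<Sum>j\<in>UNIV. ?a j * (real (m $ j) - real (nat q) * p $ j)\<bar>"
      proof -
        have "real (nat q) * \<theta> $ i = (\<Sum>j\<in>UNIV. ?a j * (real (nat q) * p $ j))"
          using p by (simp add: mem_degree_polyhedron mult.left_commute flip: sum_distrib_left)
        then show ?thesis by (simp add: right_diff_distrib sum_subtractf)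
      qed
      also have "\<dots> \<le> (\<Sum>j\<in>UNIV. \<bar>?a j\<bar> * \<delta>)"
        by (intro order_trans[OF sum_abs] sum_mono) (simp add: abs_mult mult_left_mono less_imp_le m')
      also have "\<dots> = (\<Sum>j\<in>UNIV. \<bar>?a j\<bar>) * \<delta>" by (simp add: sum_distrib_right)
      also have "\<dots> < K * \<delta>"
      proof (rule mult_strict_right_mono[OF _ d(1)])
        have "(\<Sum>j\<in>UNIV. \<bar>?a j\<bar>) \<le> (\<Sum>i\<in>UNIV. \<Sum>j\<in>UNIV. \<bar>real_of_int (A $ i $ j)\<bar>)"
          by (rule member_le_sum) (auto simp: sum_nonneg)
        then show "(\<Sum>j\<in>UNIV. \<bar>?a j\<bar>) < K" by (simp add: K_def)
      qed
      also have "\<dots> \<le> 1" using d(3) K by (simp add: field_simps)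
      finally have "\<bar>real_of_int ((\<Sum>j\<in>UNIV. A $ i $ j * int (m $ j)) - int (nat q) * \<theta> $ i)\<bar> < 1"
        using q by simp
      then show "(\<Sum>j\<in>UNIV. A $ i $ j * int (m $ j)) = int (nat q) * \<theta> $ i"
        by linarith
    qed
  qed
qed

text \<open>Linear inequalities at p may be tested on lattice points that have exactly the support
  of p. Keeping the support is what allows the coefficients to be logarithms of coordinates of
  p.\<close>

lemma linear_bound_from_lattice:
  fixes a :: "'n::finite \<Rightarrow> real"
  assumes p: "p \<in> degree_polyhedron A \<theta>"
    and le: "\<And>q m. \<lbrakk>q > 0; m \<in> lattice_points A \<theta> q; vsupp m = vsupp p\<rbrakk>
               \<Longrightarrow> (\<Sum>j\<in>UNIV. real (m $ j) * a j) \<le> real q * b"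
  shows "(\<Sum>j\<in>UNIV. p $ j * a j) \<le> b"
proof (rule field_le_epsilon)
  fix e :: real assume e: "e > 0"
  \<comment> \<open>A coordinate error of \<open>e / L\<close> changes the sum by at most e, which
    \<open>real q * e\<close> absorbs because q is at least 1.\<close>
  define L where "L = 1 + (\<Sum>j\<in>UNIV. \<bar>a j\<bar>)"
  have L: "L \<ge> 1" by (simp add: L_def sum_nonneg)
  obtain q m where qm: "q > 0" "m \<in> lattice_points A \<theta> q" "vsupp m = vsupp p"
    and close: "\<And>j. \<bar>real (m $ j) - real q * p $ j\<bar> < e / L"
    using lattice_approximation[OF p, of "e / L"] e L by auto
  have "real q * (\<Sum>j\<in>UNIV. p $ j * a j)
      = (\<Sum>j\<in>UNIV. real (m $ j) * a j) + (\<Sum>j\<in>UNIV. (real q * p $ j - real (m $ j)) * a j)"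
    by (simp add: algebra_simps sum_subtractf sum_distrib_left)
  also have "\<dots> \<le> real q * b + (\<Sum>j\<in>UNIV. e / L * \<bar>a j\<bar>)"
  proof (intro add_mono le[OF qm] sum_mono)
    fix j
    have "(real q * p $ j - real (m $ j)) * a j \<le> \<bar>real q * p $ j - real (m $ j)\<bar> * \<bar>a j\<bar>"
      by (metis abs_ge_self abs_mult)
    also have "\<dots> \<le> e / L * \<bar>a j\<bar>"
      using close[of j] by (intro mult_right_mono) (auto simp: abs_minus_commute)
    finally show "(real q * p $ j - real (m $ j)) * a j \<le> e / L * \<bar>a j\<bar>" .
  qed
  also have "(\<Sum>j\<in>UNIV. e / L * \<bar>a j\<bar>) = e / L * (L - 1)"
    by (simp add: L_def sum_distrib_left)
  also have "\<dots> \<le> real q * e"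
  proof -
    have "e / L * (L - 1) \<le> e" using e L by (simp add: field_simps)
    also have "\<dots> \<le> real q * e" using e qm(1) by simp
    finally show ?thesis .
  qed
  finally have "real q * (\<Sum>j\<in>UNIV. p $ j * a j) \<le> real q * (b + e)" by (simp add: algebra_simps)
  then show "(\<Sum>j\<in>UNIV. p $ j * a j) \<le> b + e" using qm(1) by simp
qed

text \<open>A vertex of the face of \<open>P\<^sub>\<theta>\<close> cut out by the support of \<open>p\<close>, found on the compact subset where
  the coordinate sum is minimal.\<close>

lemma integral_vertex_exists:
  fixes A :: "int^'n^'d"
  assumes int: "integral_degree A \<theta>" and p: "p \<in> degree_polyhedron A \<theta>"
  obtains v where "v \<in> lattice_points A \<theta> 1" "vsupp v \<subseteq> vsupp p"
proof -
  let ?P = "degree_polyhedron A \<theta>"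
  \<comment> \<open>On nonnegative vectors the coordinate sum dominates the norm, so its sublevel
    sets in a closed part of P are compact.\<close>
  define s :: "real^'n \<Rightarrow> real" where "s = (\<lambda>x. \<Sum>j\<in>UNIV. x $ j)"
  define F where "F = {x \<in> ?P. vsupp x \<subseteq> vsupp p}"
  have cs: "continuous_on S s" for S unfolding s_def by (intro continuous_intros)
  have Feq: "F = ?P \<inter> (\<Inter>j\<in>- vsupp p. {x. x $ j = 0})"
    by (auto simp: F_def vsupp_def)
  have clF: "closed F"
    unfolding Feq by (intro closed_Int closed_degree_polyhedron closed_INT ballI closed_Collect_eq continuous_intros)
  have cvF: "convex F"
    unfolding Feq by (intro convex_Int convex_degree_polyhedron convex_INT) (auto simp: convex_def)
  have pF: "p \<in> F" using p by (simp add: F_def)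
  have sub: "{x \<in> F. s x \<le> c} \<subseteq> cball 0 c" for c
  proof
    fix x assume x: "x \<in> {x \<in> F. s x \<le> c}"
    have "norm x \<le> (\<Sum>j\<in>UNIV. \<bar>x $ j\<bar>)" by (rule norm_le_l1_cart)
    also have "\<dots> = s x" using x by (simp add: s_def F_def mem_degree_polyhedron)
    finally show "x \<in> cball 0 c" using x by simp
  qed
  have comp: "compact {x \<in> F. s x \<le> c}" for c
  proof -
    have "{x \<in> F. s x \<le> c} = F \<inter> {x. s x \<le> c}" by blast
    then have "closed {x \<in> F. s x \<le> c}"
      using clF cs by (auto intro!: closed_Int closed_Collect_le)
    then show ?thesis using sub[of c] bounded_subset[OF bounded_cball] by (simp add: compact_eq_bounded_closed)
  qed
  obtain x0 where x0: "x0 \<in> {x \<in> F. s x \<le> s p}" "\<And>y. y \<in> {x \<in> F. s x \<le> s p} \<Longrightarrow> s x0 \<le> s y"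
    using continuous_attains_inf[OF comp[of "s p"] _ cs] pF by blast
  have x0min: "s x0 \<le> s y" if "y \<in> F" for y
    using x0 that by (cases "s y \<le> s p") auto
  define Q where "Q = {x \<in> F. s x \<le> s x0}"
  have "convex Q"
  proof -
    have "s ((1-t) *\<^sub>R x + t *\<^sub>R y) \<le> s x0" if "s x \<le> s x0" "s y \<le> s x0" "0 \<le> t" "t \<le> 1" for x y t
    proof -
      have "s ((1-t) *\<^sub>R x + t *\<^sub>R y) = (1-t) * s x + t * s y"
        by (simp add: s_def sum.distrib sum_distrib_left)
      also have "\<dots> \<le> (1-t) * s x0 + t * s x0" using that by (intro add_mono mult_left_mono) auto
      finally show ?thesis by (simp add: algebra_simps)
    qed
    then show ?thesis using cvF by (auto simp: Q_def convex_alt)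
  qed
  moreover have "Q \<noteq> {}" using x0(1) by (auto simp: Q_def)
  moreover have "compact Q" unfolding Q_def by (rule comp)
  ultimately obtain v where v: "v extreme_point_of Q"
    using extreme_point_exists_convex by blast
  have vQ: "v \<in> Q" using v by (simp add: extreme_point_of_def)
  \<comment> \<open>Q is a face of a face: the ends of a segment through v vanish wherever p
    vanishes, and then both must minimise s.\<close>
  have "v extreme_point_of ?P"
    unfolding extreme_point_of_def
  proof (intro conjI ballI notI)
    show "v \<in> ?P" using vQ by (simp add: Q_def F_def)
    fix a b assume ab: "a \<in> ?P" "b \<in> ?P" "v \<in> open_segment a b"
    then obtain t where t: "0 < t" "t < 1" "v = (1-t) *\<^sub>R a + t *\<^sub>R b" by (auto simp: in_segment)
    have z: "a $ j = 0 \<and> b $ j = 0" if "j \<notin> vsupp p" for j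
    proof -
      have "(1-t) * a $ j + t * b $ j = 0"
        using vQ that t(3) by (auto simp: Q_def F_def vsupp_def)
      moreover have "(1-t) * a $ j \<ge> 0" "t * b $ j \<ge> 0"
        using t(1,2) nonneg_degree_polyhedron[OF ab(1), of j] nonneg_degree_polyhedron[OF ab(2), of j] by auto
      ultimately have "(1-t) * a $ j = 0" "t * b $ j = 0" by linarith+
      then show ?thesis using t by auto
    qed
    have aF: "a \<in> F" and bF: "b \<in> F" using ab z by (auto simp: F_def vsupp_def)
    have sv: "s v = (1-t) * s a + t * s b"
      by (simp add: t(3) s_def sum.distrib sum_distrib_left)
    have "s v \<le> s x0" using vQ by (simp add: Q_def)
    moreover have "(1-t) * s a \<ge> (1-t) * s x0" "t * s b \<ge> t * s x0"
      using x0min[OF aF] x0min[OF bF] t by auto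
    moreover have "s x0 = (1-t) * s x0 + t * s x0" by (simp add: algebra_simps)
    ultimately have "(1-t) * s a = (1-t) * s x0" "t * s b = t * s x0"
      using sv by linarith+
    then have "a \<in> Q" "b \<in> Q" using aF bF t by (auto simp: Q_def)
    then show False using v ab(3) by (auto simp: extreme_point_of_def)
  qed
  then have vint: "\<forall>j. v $ j \<in> \<int>" using int by (auto simp: integral_degree_def)
  have vP: "v \<in> ?P" using vQ by (simp add: Q_def F_def)
  define m :: "nat^'n" where "m = (\<chi> j. nat \<lfloor>v $ j\<rfloor>)"
  have m: "real (m $ j) = v $ j" for j
    using vint nonneg_degree_polyhedron[OF vP, of j] by (auto simp: m_def elim!: allE[of _ j] Ints_cases)
  have "m \<in> lattice_points A \<theta> 1"
    unfolding mem_lattice_points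
  proof
    fix i
    have "real_of_int (\<Sum>j\<in>UNIV. A $ i $ j * int (m $ j)) = real_of_int (\<theta> $ i)"
      using vP by (simp add: mem_degree_polyhedron m)
    then show "(\<Sum>j\<in>UNIV. A $ i $ j * int (m $ j)) = int 1 * \<theta> $ i" by linarith
  qed
  moreover have "vsupp m \<subseteq> vsupp p"
  proof
    fix j assume "j \<in> vsupp m"
    then have "j \<in> vsupp v" using m[of j] by (simp add: vsupp_def)
    then show "j \<in> vsupp p" using vQ by (auto simp: Q_def F_def)
  qed
  ultimately show ?thesis by (rule that)
qed

section \<open>The retraction of the polyhedron onto its minimal points\<close>

definition lower_box :: "int^'n^'d \<Rightarrow> int^'d \<Rightarrow> real^'n \<Rightarrow> (real^'n) set" where
  "lower_box A \<theta> p = {u \<in> degree_polyhedron A \<theta>. \<forall>j. u $ j \<le> p $ j}"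

text \<open>The recession cone of \<open>P\<^sub>\<theta>\<close> consists of nonnegative vectors, and the bounded faces of
  \<open>P\<^sub>\<theta>\<close> are made of the points that are minimal for the coordinatewise order.\<close>

definition minimal_points :: "int^'n^'d \<Rightarrow> int^'d \<Rightarrow> (real^'n) set" where
  "minimal_points A \<theta> = {p \<in> degree_polyhedron A \<theta>. lower_box A \<theta> p = {p}}"

definition retract_point :: "int^'n^'d \<Rightarrow> int^'d \<Rightarrow> real^'n \<Rightarrow> real^'n" where
  "retract_point A \<theta> p = closest_point (lower_box A \<theta> p) 0"

lemma closed_lower_box: "closed (lower_box A \<theta> p)"
proof -
  have "lower_box A \<theta> p = degree_polyhedron A \<theta> \<inter> (\<Inter>j. {u. u $ j \<le> p $ j})"
    by (auto simp: lower_box_def)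
  also have "closed \<dots>"
    by (intro closed_Int closed_degree_polyhedron closed_INT ballI closed_Collect_le continuous_intros)
  finally show ?thesis .
qed

lemma convex_lower_box: "convex (lower_box A \<theta> p)"
proof -
  have "lower_box A \<theta> p = degree_polyhedron A \<theta> \<inter> (\<Inter>j. {u. u $ j \<le> p $ j})"
    by (auto simp: lower_box_def)
  also have "convex \<dots>"
  proof (intro convex_Int convex_degree_polyhedron convex_INT)
    fix j
    have "{u. u $ j \<le> p $ j} = {u. axis j 1 \<bullet> u \<le> p $ j}" by (simp add: inner_axis' )
    then show "convex {u. u $ j \<le> p $ j}" by (simp add: convex_halfspace_le)
  qed
  finally show ?thesis .
qed

lemma retract_point_in_box: "p \<in> degree_polyhedron A \<theta> \<Longrightarrow> retract_point A \<theta> p \<in> lower_box A \<theta> p"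
  unfolding retract_point_def
  by (rule closest_point_in_set[OF closed_lower_box]) (auto simp: lower_box_def)

lemma norm_retract_point_le: "u \<in> lower_box A \<theta> p \<Longrightarrow> norm (retract_point A \<theta> p) \<le> norm u"
  unfolding retract_point_def using closest_point_le[OF closed_lower_box, of u A \<theta> p 0] by simp

lemma retract_point_unique:
  assumes "u \<in> lower_box A \<theta> p" "\<And>v. v \<in> lower_box A \<theta> p \<Longrightarrow> norm u \<le> norm v"
  shows "u = retract_point A \<theta> p"
  unfolding retract_point_def
  by (rule closest_point_unique[OF convex_lower_box closed_lower_box assms(1)]) (simp add: assms(2))

text \<open>Among nonnegative vectors a coordinatewise smaller one is not longer. A point of the box
  below r(p) is therefore also a shortest point of the box below p, and uniqueness applies.\<close>

lemma retract_point_minimal: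
  assumes p: "p \<in> degree_polyhedron A \<theta>"
  shows "retract_point A \<theta> p \<in> minimal_points A \<theta>"
proof -
  let ?r = "retract_point A \<theta> p"
  have r: "?r \<in> degree_polyhedron A \<theta>" "\<And>j. ?r $ j \<le> p $ j"
    using retract_point_in_box[OF p] by (auto simp: lower_box_def)
  have "u = ?r" if "u \<in> lower_box A \<theta> ?r" for u
  proof (rule retract_point_unique)
    show "u \<in> lower_box A \<theta> p"
      using that r(2) by (auto simp: lower_box_def intro: order_trans)
    fix v assume v: "v \<in> lower_box A \<theta> p"
    have "norm u \<le> norm ?r"
      using that
      by (intro norm_le_componentwise_cart)
         (auto simp: lower_box_def mem_degree_polyhedron intro: order_trans[OF _ abs_ge_self])
    then show "norm u \<le> norm v" using norm_retract_point_le[OF v] by simp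
  qed
  then show ?thesis using r(1) by (auto simp: minimal_points_def lower_box_def)
qed

lemma retract_point_fixes:
  "p \<in> minimal_points A \<theta> \<Longrightarrow> retract_point A \<theta> p = p"
  using retract_point_in_box[of p A \<theta>] by (auto simp: minimal_points_def)

text \<open>A subsequence of r(x_n) converges to some l in the box below a, and l has to be shortest
  there. A competitor v below a need not lie below x_n, so it is replaced by x_n - t (a - v) with t
  < 1, and t tends to 1 at the end.\<close>

lemma continuous_on_retract_point: "continuous_on (degree_polyhedron A \<theta>) (retract_point A \<theta>)"
proof (rule ccontr)
  let ?P = "degree_polyhedron A \<theta>" and ?r = "retract_point A \<theta>"
  assume "\<not> continuous_on ?P ?r"
  then obtain a e where a: "a \<in> ?P" and e: "e > 0"
    and far: "\<And>d. d > 0 \<Longrightarrow> \<exists>x\<in>?P. dist x a < d \<and> dist (?r x) (?r a) \<ge> e"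
    unfolding continuous_on_iff by (meson not_le)
  have "\<exists>x\<in>?P. dist x a < inverse (real (Suc n)) \<and> dist (?r x) (?r a) \<ge> e" for n
    by (rule far) simp
  then obtain x where x: "\<And>n. x n \<in> ?P" "\<And>n. dist (x n) a < inverse (real (Suc n))"
    "\<And>n. dist (?r (x n)) (?r a) \<ge> e" by metis
  have xa: "x \<longlonglongrightarrow> a"
    by (rule tendstoI, rule eventually_mono[OF order_tendstoD(2)[OF LIMSEQ_inverse_real_of_nat]])
       (use x(2) in \<open>auto intro: less_trans\<close>)
  have rx: "?r (x n) \<in> lower_box A \<theta> (x n)" for n by (rule retract_point_in_box[OF x(1)])
  have "bounded (range x)" by (rule convergent_imp_bounded[OF xa])
  then obtain B where B: "\<And>n. norm (x n) \<le> B" by (auto simp: bounded_iff)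
  have "norm (?r (x n)) \<le> B" for n
    using norm_retract_point_le[of "x n" A \<theta> "x n"] x(1) B by (force simp: lower_box_def intro: order_trans)
  then have "bounded (range (\<lambda>n. ?r (x n)))" by (auto simp: bounded_iff)
  then obtain l \<sigma> where \<sigma>: "strict_mono \<sigma>" and l: "((\<lambda>n. ?r (x n)) \<circ> \<sigma>) \<longlonglongrightarrow> l"
    using bounded_imp_convergent_subsequence by blast
  have l': "(\<lambda>n. ?r (x (\<sigma> n))) \<longlonglongrightarrow> l" using l by (simp add: o_def)
  have xs: "(\<lambda>n. x (\<sigma> n)) \<longlonglongrightarrow> a" using LIMSEQ_subseq_LIMSEQ[OF xa \<sigma>] by (simp add: o_def)
  have "l \<in> lower_box A \<theta> a"
  proof -
    have "l \<in> ?P"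
      using closed_sequentially[OF closed_degree_polyhedron _ l'] rx by (auto simp: lower_box_def)
    moreover have "l $ j \<le> a $ j" for j
      by (rule LIMSEQ_le[OF tendsto_vec_nth[OF l'] tendsto_vec_nth[OF xs]])
         (use rx in \<open>auto simp: lower_box_def\<close>)
    ultimately show ?thesis by (simp add: lower_box_def)
  qed
  moreover have "norm l \<le> norm v" if v: "v \<in> lower_box A \<theta> a" for v
  proof -
    have vP: "v \<in> ?P" and va: "\<And>j. v $ j \<le> a $ j" using v by (auto simp: lower_box_def)
    have *: "norm l \<le> norm (a - t *\<^sub>R (a - v))" if t: "0 \<le> t" "t < 1" for t
    proof (rule LIMSEQ_le)
      show "(\<lambda>n. norm (?r (x (\<sigma> n)))) \<longlonglongrightarrow> norm l" by (intro tendsto_intros l')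
      show "(\<lambda>n. norm (x (\<sigma> n) - t *\<^sub>R (a - v))) \<longlonglongrightarrow> norm (a - t *\<^sub>R (a - v))"
        by (intro tendsto_intros xs)
      \<comment> \<open>Where v and a agree nothing is subtracted from x_n; elsewhere t < 1 makes
        the limiting coordinate strictly positive.\<close>
      have "\<forall>\<^sub>F n in sequentially. 0 \<le> (x (\<sigma> n) - t *\<^sub>R (a - v)) $ j" for j
      proof (cases "a $ j = v $ j")
        case True
        then show ?thesis using x(1) by (simp add: mem_degree_polyhedron)
      next
        case False
        then have vj: "v $ j < a $ j" "0 \<le> v $ j"
          using va[of j] nonneg_degree_polyhedron[OF vP, of j] by auto
        have "t * (a $ j - v $ j) < a $ j - v $ j" using t vj by simp
        then have "0 < a $ j - t * (a $ j - v $ j)" using vj by linarith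
        moreover have "(\<lambda>n. x (\<sigma> n) $ j - t * (a $ j - v $ j)) \<longlonglongrightarrow> a $ j - t * (a $ j - v $ j)"
          by (intro tendsto_intros xs)
        ultimately show ?thesis
          using order_tendstoD(1) by (fastforce elim: eventually_mono)
      qed
      then have "\<forall>\<^sub>F n in sequentially. \<forall>j. 0 \<le> (x (\<sigma> n) - t *\<^sub>R (a - v)) $ j"
        by (simp add: eventually_all_finite)
      then have "\<forall>\<^sub>F n in sequentially. norm (?r (x (\<sigma> n))) \<le> norm (x (\<sigma> n) - t *\<^sub>R (a - v))"
      proof (rule eventually_mono)
        fix n assume n: "\<forall>j. 0 \<le> (x (\<sigma> n) - t *\<^sub>R (a - v)) $ j"
        show "norm (?r (x (\<sigma> n))) \<le> norm (x (\<sigma> n) - t *\<^sub>R (a - v))"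
        proof (rule norm_retract_point_le)
          have "(\<Sum>j\<in>UNIV. real_of_int (A $ i $ j) * (x (\<sigma> n) - t *\<^sub>R (a - v)) $ j)
              = (\<Sum>j\<in>UNIV. real_of_int (A $ i $ j) * x (\<sigma> n) $ j)
                - t * ((\<Sum>j\<in>UNIV. real_of_int (A $ i $ j) * a $ j) - (\<Sum>j\<in>UNIV. real_of_int (A $ i $ j) * v $ j))" for i
            by (simp add: algebra_simps sum_subtractf sum.distrib sum_distrib_left)
          then have "x (\<sigma> n) - t *\<^sub>R (a - v) \<in> ?P"
            using n x(1) a vP by (simp add: mem_degree_polyhedron)
          then show "x (\<sigma> n) - t *\<^sub>R (a - v) \<in> lower_box A \<theta> (x (\<sigma> n))"
            using t va by (simp add: lower_box_def)
        qed
      qed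
      then show "\<exists>N. \<forall>n\<ge>N. norm (?r (x (\<sigma> n))) \<le> norm (x (\<sigma> n) - t *\<^sub>R (a - v))"
        by (simp add: eventually_sequentially)
    qed
    have "((\<lambda>t. norm (a - t *\<^sub>R (a - v))) \<longlongrightarrow> norm (a - 1 *\<^sub>R (a - v))) (at_left 1)"
      by (intro tendsto_intros)
    moreover have "\<forall>\<^sub>F t in at_left (1::real). norm l \<le> norm (a - t *\<^sub>R (a - v))"
      using eventually_at_left_real[of 0 "1::real"] by (auto elim!: eventually_mono intro!: *)
    ultimately have "norm l \<le> norm (a - 1 *\<^sub>R (a - v))"
      by (rule tendsto_lowerbound) simp
    then show ?thesis by simp
  qed
  ultimately have "l = ?r a" by (rule retract_point_unique)
  moreover have "dist l (?r a) \<ge> e"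
    by (rule Lim_bounded2[OF tendsto_dist[OF l' tendsto_const]]) (use x(3) in auto)
  ultimately show False using e by simp
qed

section \<open>Monomials and the moment map\<close>

definition mono_eval :: "'a::comm_semiring_1^'n \<Rightarrow> nat^'n \<Rightarrow> 'a" where
  "mono_eval z u = (\<Prod>j\<in>UNIV. (z $ j) ^ (u $ j))"

definition vnorm :: "complex^'n \<Rightarrow> real^'n" where
  "vnorm z = (\<chi> j. norm (z $ j))"

lemma vnorm_nth [simp]: "vnorm z $ j = norm (z $ j)"
  by (simp add: vnorm_def)

lemma vsupp_vnorm [simp]: "vsupp (vnorm z) = vsupp z"
  by (simp add: vsupp_def)

lemma mono_eval_zero [simp]: "mono_eval z 0 = 1"
  by (simp add: mono_eval_def)

lemma mono_eval_add: "mono_eval z (u + v) = mono_eval z u * mono_eval z v"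
  by (simp add: mono_eval_def power_add prod.distrib)

lemma mono_eval_smult: "mono_eval z (k *s u) = mono_eval z u ^ k"
proof -
  have "z $ j ^ (k * u $ j) = (z $ j ^ (u $ j)) ^ k" for j
    by (metis mult.commute power_mult)
  then show ?thesis by (simp add: mono_eval_def prod_power_distrib)
qed

lemma mono_eval_eq_0_iff:
  fixes z :: "'a::semidom^'n"
  shows "mono_eval z u = 0 \<longleftrightarrow> \<not> vsupp u \<subseteq> vsupp z"
  by (auto simp: mono_eval_def vsupp_def)

lemma norm_mono_eval: "norm (mono_eval z u) = mono_eval (vnorm z) u"
  by (simp add: mono_eval_def prod_norm[symmetric] norm_power)

lemma mono_eval_nonneg: "(\<And>j. 0 \<le> (p :: real^'n) $ j) \<Longrightarrow> 0 \<le> mono_eval p u"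
  by (simp add: mono_eval_def prod_nonneg)

lemma ln_mono_eval:
  fixes p :: "real^'n"
  assumes "vsupp u \<subseteq> vsupp p"
  shows "ln (mono_eval p u) = (\<Sum>j\<in>UNIV. real (u $ j) * ln (p $ j))"
proof -
  have "p $ j ^ (u $ j) \<noteq> 0" for j using assms by (auto simp: vsupp_def)
  then show ?thesis by (simp add: mono_eval_def ln_prod ln_realpow)
qed

lemma continuous_on_mono_eval [continuous_intros]:
  fixes f :: "'b::topological_space \<Rightarrow> complex^'n"
  shows "continuous_on S f \<Longrightarrow> continuous_on S (\<lambda>x. mono_eval (f x) u)"
  unfolding mono_eval_def by (intro continuous_intros)

text \<open>Uniqueness in the Kempf--Ness correspondence: along \<open>P\<^sub>\<theta>\<close>, monotonicity of the logarithm
  makes \<open>(p' - p) \<bullet> (ln p' - ln p)\<close> a sum of nonnegative terms, and it vanishes if \<open>p\<close> and \<open>p'\<close>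
  give proportional values to the monomials.\<close>

lemma moment_unique:
  assumes p: "p \<in> degree_polyhedron A \<theta>" and p': "p' \<in> degree_polyhedron A \<theta>"
    and eq: "\<And>r u. u \<in> lattice_points A \<theta> r \<Longrightarrow> mono_eval p' u = c ^ r * mono_eval p u"
    and c: "c > 0"
  shows "p = p'"
proof -
  have supp: "vsupp p = vsupp p'"
  proof
    \<comment> \<open>The monomial with exponent m is nonzero at p, hence at p', and this forces the
      inclusion of supports.\<close>
    obtain q m where "m \<in> lattice_points A \<theta> q" "vsupp m = vsupp p"
      using lattice_approximation[OF p zero_less_one] by metis
    then show "vsupp p \<subseteq> vsupp p'"
      using eq[of m q] c mono_eval_eq_0_iff[of p m] mono_eval_eq_0_iff[of p' m] by auto
    obtain q m where "m \<in> lattice_points A \<theta> q" "vsupp m = vsupp p'"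
      using lattice_approximation[OF p' zero_less_one] by metis
    then show "vsupp p' \<subseteq> vsupp p"
      using eq[of m q] c mono_eval_eq_0_iff[of p m] mono_eval_eq_0_iff[of p' m] by auto
  qed
  define a where "a j = ln (p' $ j) - ln (p $ j)" for j
  have lin: "(\<Sum>j\<in>UNIV. real (m $ j) * a j) = real q * ln c"
    if m: "m \<in> lattice_points A \<theta> q" "vsupp m = vsupp p" for q m
  proof -
    have pos: "mono_eval p m \<noteq> 0" using m(2) by (simp add: mono_eval_eq_0_iff)
    have "(\<Sum>j\<in>UNIV. real (m $ j) * a j) = ln (mono_eval p' m) - ln (mono_eval p m)"
      using m(2) supp by (simp add: ln_mono_eval a_def right_diff_distrib sum_subtractf)
    also have "\<dots> = real q * ln c"
      using pos c by (simp add: eq[OF m(1)] ln_mult ln_realpow)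
    finally show ?thesis .
  qed
  have "(\<Sum>j\<in>UNIV. p $ j * a j) = ln c \<and> (\<Sum>j\<in>UNIV. p' $ j * a j) = ln c"
  proof -
    have "(\<Sum>j\<in>UNIV. x $ j * a j) = ln c" if "x \<in> degree_polyhedron A \<theta>" "vsupp x = vsupp p" for x
    proof (rule antisym)
      show "(\<Sum>j\<in>UNIV. x $ j * a j) \<le> ln c"
        by (rule linear_bound_from_lattice[OF that(1)]) (use lin that in simp)
      have "(\<Sum>j\<in>UNIV. x $ j * - a j) \<le> - ln c"
        by (rule linear_bound_from_lattice[OF that(1)]) (use lin that in \<open>simp add: sum_negf\<close>)
      then show "ln c \<le> (\<Sum>j\<in>UNIV. x $ j * a j)" by (simp add: sum_negf)
    qed
    then show ?thesis using p p' supp by simp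
  qed
  then have sum0: "(\<Sum>j\<in>UNIV. (p' $ j - p $ j) * a j) = 0"
    by (simp add: left_diff_distrib sum_subtractf)
  have sg: "(p' $ j - p $ j) * a j \<ge> 0 \<and> ((p' $ j - p $ j) * a j = 0 \<longrightarrow> p' $ j = p $ j)" for j
  proof (cases "j \<in> vsupp p")
    case True
    then have pos: "p $ j > 0" "p' $ j > 0"
      using supp nonneg_degree_polyhedron[OF p, of j] nonneg_degree_polyhedron[OF p', of j]
      by (auto simp: vsupp_def less_le)
    show ?thesis
    proof (cases "p $ j \<le> p' $ j")
      case True
      then have "a j \<ge> 0" using pos by (simp add: a_def)
      moreover have "a j = 0 \<longrightarrow> p' $ j = p $ j" using pos by (simp add: a_def)
      ultimately show ?thesis using True by auto
    next
      case False
      then have "a j < 0" using pos by (simp add: a_def)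
      then show ?thesis using False by (auto simp: mult_nonpos_nonpos)
    qed
  next
    case False
    moreover have "j \<notin> vsupp p'" using False supp by simp
    ultimately show ?thesis by (simp add: vsupp_def)
  qed
  have "\<forall>j\<in>UNIV. (p' $ j - p $ j) * a j = 0"
    using sum0 sg sum_nonneg_eq_0_iff[of UNIV "\<lambda>j. (p' $ j - p $ j) * a j"] by auto
  then show ?thesis using sg by (simp add: vec_eq_iff)
qed

text \<open>The right hand side is the minimum of the left, attained at x = exp (b - 1). Rescaling
  by that point reduces the claim to y - 1 \<le> y ln y.\<close>

lemma x_ln_x_ge:
  fixes x b :: real
  assumes "x > 0"
  shows "x * ln x - b * x \<ge> - exp (b - 1)"
proof -
  define y where "y = x * exp (1 - b)"
  have y: "y > 0" using assms by (simp add: y_def)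
  have "ln (1 / y) \<le> 1 / y - 1" using y by (intro ln_le_minus_one) simp
  then have "y - 1 \<le> y * ln y" using y by (simp add: ln_div field_simps)
  also have "ln y = ln x + 1 - b" using assms by (simp add: y_def ln_mult)
  finally have "exp (b - 1) * (y - 1) \<le> exp (b - 1) * (y * (ln x + 1 - b))" by simp
  moreover have "exp (b - 1) * y = x" by (simp add: y_def flip: exp_add)
  ultimately have "x - exp (b - 1) \<le> x * (ln x + 1 - b)"
    by (simp add: right_diff_distrib mult.assoc[symmetric])
  then show ?thesis by (simp add: algebra_simps)
qed

text \<open>Superlinear growth of the entropy \<open>\<Sum> p ln p\<close> against the at most linear growth of
  \<open>ln |x\<^sup>u|\<close> in the exponent.\<close>

lemma moment_bounded:
  fixes A :: "int^'n^'d" and v :: "nat^'n"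
  assumes "L \<ge> 0"
  obtains R where "\<And>p. \<lbrakk>p \<in> degree_polyhedron A \<theta>; vsupp v \<subseteq> vsupp p;
      \<And>q m. m \<in> lattice_points A \<theta> q \<Longrightarrow>
        mono_eval p m \<le> exp (L * (real (\<Sum>j\<in>UNIV. m $ j) + real q)) * mono_eval p v ^ q\<rbrakk>
    \<Longrightarrow> norm p \<le> R"
proof
  \<comment> \<open>The constant of \<open>x_ln_x_ge\<close> for slope L + 1 + v_j: slope L is
    needed to beat the hypothesis, 1 is left over to bound p, and v_j pays for the term v_j ln
    p_j.\<close>
  define K where "K = (\<lambda>j. exp (L + real (v $ j)))"
  fix p assume p: "p \<in> degree_polyhedron A \<theta>" and v: "vsupp v \<subseteq> vsupp p"
    and le: "\<And>q m. m \<in> lattice_points A \<theta> q \<Longrightarrow>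
        mono_eval p m \<le> exp (L * (real (\<Sum>j\<in>UNIV. m $ j) + real q)) * mono_eval p v ^ q"
  have pos: "mono_eval p m > 0" if "vsupp m \<subseteq> vsupp p" for m
    using that mono_eval_nonneg[of p m] nonneg_degree_polyhedron[OF p] mono_eval_eq_0_iff[of p m] by force
  have "(\<Sum>j\<in>UNIV. p $ j * (ln (p $ j) - L)) \<le> L + (\<Sum>j\<in>UNIV. real (v $ j) * ln (p $ j))"
  proof (rule linear_bound_from_lattice[OF p])
    fix q m assume m: "m \<in> lattice_points A \<theta> q" "vsupp m = vsupp p"
    have "ln (mono_eval p m) \<le> ln (exp (L * (real (\<Sum>j\<in>UNIV. m $ j) + real q)) * mono_eval p v ^ q)"
      using le[OF m(1)] pos[of m] m(2) by (intro ln_mono) auto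
    also have "\<dots> = L * (real (\<Sum>j\<in>UNIV. m $ j) + real q) + real q * ln (mono_eval p v)"
      using pos[OF v] by (simp add: ln_mult ln_realpow)
    finally show "(\<Sum>j\<in>UNIV. real (m $ j) * (ln (p $ j) - L))
        \<le> real q * (L + (\<Sum>j\<in>UNIV. real (v $ j) * ln (p $ j)))"
      using m(2) v by (simp add: ln_mono_eval algebra_simps sum_subtractf sum_distrib_left sum.distrib)
  qed
  then have "(\<Sum>j\<in>UNIV. (p $ j - real (v $ j)) * ln (p $ j)) \<le> L + L * (\<Sum>j\<in>UNIV. p $ j)"
    by (simp add: algebra_simps sum_subtractf sum_distrib_left)
  moreover have "(\<Sum>j\<in>UNIV. (L + 1) * p $ j - K j) \<le> (\<Sum>j\<in>UNIV. (p $ j - real (v $ j)) * ln (p $ j))"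
  proof (rule sum_mono)
    fix j
    show "(L + 1) * p $ j - K j \<le> (p $ j - real (v $ j)) * ln (p $ j)"
    proof (cases "p $ j = 0")
      \<comment> \<open>Here the convention \<open>ln 0 = 0\<close> makes the right hand side
        vanish.\<close>
      case True
      then show ?thesis by (simp add: K_def)
    next
      case False
      then have pj: "p $ j > 0" using nonneg_degree_polyhedron[OF p, of j] by simp
      have "real (v $ j) * ln (p $ j) \<le> real (v $ j) * p $ j"
        using ln_bound[OF pj] by (intro mult_left_mono) auto
      then show ?thesis
        using x_ln_x_ge[OF pj, of "L + 1 + real (v $ j)"] by (simp add: K_def algebra_simps)
    qed
  qed
  ultimately have "(\<Sum>j\<in>UNIV. p $ j) \<le> L + (\<Sum>j\<in>UNIV. K j)"
    by (simp add: algebra_simps sum_subtractf sum.distrib sum_distrib_left)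
  moreover have "norm p \<le> (\<Sum>j\<in>UNIV. \<bar>p $ j\<bar>)" by (rule norm_le_l1_cart)
  moreover have "(\<Sum>j\<in>UNIV. \<bar>p $ j\<bar>) = (\<Sum>j\<in>UNIV. p $ j)"
    using nonneg_degree_polyhedron[OF p] by simp
  ultimately show "norm p \<le> L + (\<Sum>j\<in>UNIV. K j)" by simp
qed

text \<open>For t \<ge> 0 compare exp with its tangent of slope 2w, whose point of contact is ln
  (2w); for t < 0 the linear term alone is w|t|.\<close>

lemma exp_minus_linear_coercive:
  fixes y w :: real
  assumes "w > 0"
  obtains K where "\<And>t. exp (y + t) - w * t \<ge> w * \<bar>t\<bar> - K"
proof
  define a where "a = ln (2 * w)"
  fix t
  define C where "C = 2 * w * (1 + y - a)"
  have "1 + (y + t - a) \<le> exp (y + t - a)" by (rule exp_ge_add_one_self)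
  then have "2 * w * (1 + (y + t - a)) \<le> 2 * w * exp (y + t - a)" using assms by simp
  also have "\<dots> = exp (y + t)" using assms by (simp add: a_def exp_diff)
  finally have 1: "C + 2 * (w * t) \<le> exp (y + t)" by (simp add: C_def algebra_simps)
  have 2: "0 < exp (y + t)" by simp
  have "exp (y + t) - w * t \<ge> w * \<bar>t\<bar> - \<bar>C\<bar>"
  proof (cases "t \<ge> 0")
    case True
    then have "w * \<bar>t\<bar> = w * t" by simp
    then show ?thesis using 1 by linarith
  next
    case False
    then have "w * \<bar>t\<bar> = - (w * t)" by simp
    then show ?thesis using 2 by linarith
  qed
  then show "exp (y + t) - w * t \<ge> w * \<bar>t\<bar> - \<bar>2 * w * (1 + y - a)\<bar>"
    by (simp only: C_def)
qed

text \<open>Existence in the Kempf--Ness correspondence: minimise the convex function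
  \<open>\<Sum> (exp (y\<^sub>j + t\<^sub>j) - w\<^sub>j t\<^sub>j)\<close> over the row space, where \<open>y\<^sub>j = ln |z\<^sub>j|\<close> and \<open>w \<in> P\<^sub>\<theta>\<close>; the
  critical point equation says that \<open>exp (y + t)\<close> has the same image under \<open>A\<close> as \<open>w\<close>.\<close>

lemma moment_exists:
  fixes A :: "int^'n^'d" and z :: "complex^'n"
  assumes u: "u \<in> lattice_points A \<theta> r" "r > 0" and supp: "vsupp z = vsupp u"
  shows "\<exists>z' c. vnorm z' \<in> degree_polyhedron A \<theta> \<and> vsupp z' = vsupp z \<and> c > (0::real) \<and>
    (\<forall>s. \<forall>m\<in>lattice_points A \<theta> s. mono_eval z' m = of_real (c ^ s) * mono_eval z m)"
proof -
  define J where "J = vsupp z"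
  define w where "w j = real (u $ j) / real r" for j
  define y where "y j = ln (norm (z $ j))" for j
  have Ju: "J = vsupp u" unfolding J_def by (rule supp)
  have w: "w j > 0" if "j \<in> J" for j
    using that u(2) unfolding Ju w_def vsupp_def by simp
  have w0: "w j = 0" if "j \<notin> J" for j
    using that unfolding Ju w_def vsupp_def by simp
  have Aw: "(\<Sum>j\<in>J. real_of_int (A $ i $ j) * w j) = real_of_int (\<theta> $ i)" for i
  proof -
    have "(\<Sum>j\<in>J. real_of_int (A $ i $ j) * w j) = (\<Sum>j\<in>UNIV. real_of_int (A $ i $ j) * w j)"
      by (rule sum.mono_neutral_left) (use w0 in auto)
    also have "\<dots> = real_of_int (\<Sum>j\<in>UNIV. A $ i $ j * int (u $ j)) / real r"
      by (simp add: w_def sum_divide_distrib)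
    also have "(\<Sum>j\<in>UNIV. A $ i $ j * int (u $ j)) = int r * \<theta> $ i"
      using u(1) by (simp add: mem_lattice_points)
    finally show ?thesis using u(2) by simp
  qed
  \<comment> \<open>Logarithms of the scalings that multiply z_j by exp of the pairing of \<xi> with
    column j. Restricting to J, where all w_j are positive, makes G coercive on the range.\<close>
  define T :: "real^'d \<Rightarrow> real^'n" where
    "T = (\<lambda>\<xi>. \<chi> j. if j \<in> J then \<Sum>i\<in>UNIV. \<xi> $ i * real_of_int (A $ i $ j) else 0)"
  have "linear T"
    by (rule linearI) (auto simp: T_def vec_eq_iff algebra_simps sum.distrib sum_distrib_left)
  then have subV: "subspace (range T)" by (simp add: linear_subspace_image)
  define G where "G t = (\<Sum>j\<in>J. exp (y j + t $ j) - w j * t $ j)" for t :: "real^'n"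
  have contG: "continuous_on S G" for S unfolding G_def by (intro continuous_intros)
  have "\<exists>K. \<forall>t. exp (y j + t) - w j * t \<ge> w j * \<bar>t\<bar> - K" if "j \<in> J" for j
    using exp_minus_linear_coercive[OF w[OF that]] by blast
  then obtain K where K: "\<And>j t. j \<in> J \<Longrightarrow> exp (y j + t) - w j * t \<ge> w j * \<bar>t\<bar> - K j"
    by metis
  define \<mu> where "\<mu> = Min (insert 1 (w ` J))"
  have mu: "\<mu> > 0" "\<And>j. j \<in> J \<Longrightarrow> \<mu> \<le> w j"
    using w by (auto simp: \<mu>_def)
  have coercive: "norm t \<le> (G 0 + (\<Sum>j\<in>J. K j)) / \<mu>" if t: "t \<in> range T" "G t \<le> G 0" for t
  proof -
    have "\<mu> * norm t \<le> \<mu> * (\<Sum>j\<in>UNIV. \<bar>t $ j\<bar>)"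
      using mu(1) norm_le_l1_cart[of t] by simp
    also have "(\<Sum>j\<in>UNIV. \<bar>t $ j\<bar>) = (\<Sum>j\<in>J. \<bar>t $ j\<bar>)"
      by (rule sum.mono_neutral_right) (use t(1) in \<open>auto simp: T_def\<close>)
    also have "\<mu> * \<dots> \<le> (\<Sum>j\<in>J. w j * \<bar>t $ j\<bar>)"
      unfolding sum_distrib_left using mu by (intro sum_mono mult_right_mono) auto
    also have "\<dots> \<le> (\<Sum>j\<in>J. (exp (y j + t $ j) - w j * t $ j) + K j)"
    proof (rule sum_mono)
      fix j assume "j \<in> J"
      then show "w j * \<bar>t $ j\<bar> \<le> (exp (y j + t $ j) - w j * t $ j) + K j"
        using K[of j "t $ j"] by linarith
    qed
    also have "\<dots> \<le> G 0 + (\<Sum>j\<in>J. K j)" using t(2) unfolding G_def[of t] by (simp add: sum.distrib)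
    finally show ?thesis using mu(1) by (simp add: field_simps)
  qed
  let ?C = "{t \<in> range T. G t \<le> G 0}"
  have "?C = range T \<inter> {t. G t \<le> G 0}" by blast
  then have "closed ?C"
    using closed_subspace[OF subV] contG by (auto intro!: closed_Int closed_Collect_le)
  moreover have "bounded ?C" using coercive by (auto simp: bounded_iff)
  ultimately have "compact ?C" by (simp add: compact_eq_bounded_closed)
  moreover have zC: "0 \<in> ?C" using subspace_0[OF subV] by simp
  ultimately obtain t where t: "t \<in> ?C" and tmin: "\<And>x. x \<in> ?C \<Longrightarrow> G t \<le> G x"
    using continuous_attains_inf[of ?C G] contG by blast
  \<comment> \<open>Off the compact sublevel set G exceeds G 0, so the minimum is global on the
    range of T.\<close>
  have tmin': "G t \<le> G x" if "x \<in> range T" for x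
    using tmin[of x] t that by (cases "G x \<le> G 0") auto
  obtain \<xi> where \<xi>: "t = T \<xi>" using t by blast
  have crit: "(\<Sum>j\<in>J. exp (y j + t $ j) * k $ j - w j * k $ j) = 0" if k: "k \<in> range T" for k
  proof (rule DERIV_local_min)
    show "((\<lambda>s. G (t + s *\<^sub>R k)) has_real_derivative (\<Sum>j\<in>J. exp (y j + t $ j) * k $ j - w j * k $ j)) (at 0)"
      unfolding G_def by (auto intro!: derivative_eq_intros sum.cong)
    show "\<forall>x. \<bar>0 - x\<bar> < 1 \<longrightarrow> G (t + 0 *\<^sub>R k) \<le> G (t + x *\<^sub>R k)"
      using tmin' t k subV by (auto intro!: tmin' subspace_add subspace_scale)
  qed auto
  define z' :: "complex^'n" where "z' = (\<chi> j. z $ j * of_real (exp (t $ j)))"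
  have nz': "norm (z' $ j) = exp (y j + t $ j)" if "j \<in> J" for j
    using that by (simp add: z'_def y_def norm_mult exp_add J_def vsupp_def)
  have supp': "vsupp z' = vsupp z" by (auto simp: vsupp_def z'_def)
  \<comment> \<open>Scaling by T \<xi> multiplies a monomial of degree s \<theta> by exp of s times
    the pairing of \<xi> with \<theta>, that is, by c^s.\<close>
  define c where "c = exp (\<Sum>i\<in>UNIV. \<xi> $ i * real_of_int (\<theta> $ i))"
  show ?thesis
  proof (intro exI[of _ z'] exI[of _ c] conjI allI ballI)
    show "c > 0" by (simp add: c_def)
    show "vsupp z' = vsupp z" by fact
    show "vnorm z' \<in> degree_polyhedron A \<theta>"
      unfolding mem_degree_polyhedron
    proof (intro conjI allI)
      fix i
      have "(\<Sum>j\<in>UNIV. real_of_int (A $ i $ j) * vnorm z' $ j)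
          = (\<Sum>j\<in>J. real_of_int (A $ i $ j) * exp (y j + t $ j))"
        by (rule sum.mono_neutral_cong_right) (use supp' in \<open>auto simp: nz' J_def vsupp_def\<close>)
      \<comment> \<open>In this direction T gives row i of A on J, so criticality is the i-th
        coordinate of the moment equation.\<close>
      moreover have "(\<Sum>j\<in>J. exp (y j + t $ j) * T (axis i 1) $ j - w j * T (axis i 1) $ j) = 0"
        by (rule crit) simp
      moreover have "T (axis i 1) $ j = real_of_int (A $ i $ j)" if "j \<in> J" for j
        using that by (simp add: T_def axis_def if_distrib[of "\<lambda>x. x * _"] cong: if_cong)
      ultimately show "(\<Sum>j\<in>UNIV. real_of_int (A $ i $ j) * vnorm z' $ j) = real_of_int (\<theta> $ i)"
        using Aw[of i] by (simp add: sum_subtractf mult.commute)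
    qed simp
    fix s m assume m: "m \<in> lattice_points A \<theta> s"
    show "mono_eval z' m = of_real (c ^ s) * mono_eval z m"
    proof (cases "vsupp m \<subseteq> J")
      case False
      then show ?thesis using supp' mono_eval_eq_0_iff[of z m] mono_eval_eq_0_iff[of z' m] by (simp add: J_def)
    next
      case True
      have "(\<Prod>j\<in>UNIV. exp (t $ j) ^ (m $ j)) = exp (\<Sum>j\<in>UNIV. real (m $ j) * t $ j)"
        by (simp add: exp_sum exp_of_nat_mult)
      also have "(\<Sum>j\<in>UNIV. real (m $ j) * t $ j)
          = (\<Sum>j\<in>UNIV. \<Sum>i\<in>UNIV. \<xi> $ i * (real_of_int (A $ i $ j) * real (m $ j)))"
      proof (rule sum.cong)
        fix j
        show "real (m $ j) * t $ j = (\<Sum>i\<in>UNIV. \<xi> $ i * (real_of_int (A $ i $ j) * real (m $ j)))"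
        proof (cases "j \<in> J")
          case False
          then have "m $ j = 0" using True by (auto simp: vsupp_def)
          then show ?thesis by simp
        qed (simp add: \<xi> T_def sum_distrib_left mult_ac)
      qed simp
      also have "\<dots> = (\<Sum>i\<in>UNIV. \<xi> $ i * real_of_int (\<Sum>j\<in>UNIV. A $ i $ j * int (m $ j)))"
        by (subst sum.swap) (simp add: sum_distrib_left)
      also have "\<dots> = real s * (\<Sum>i\<in>UNIV. \<xi> $ i * real_of_int (\<theta> $ i))"
        using m by (simp add: mem_lattice_points sum_distrib_left mult_ac)
      also have "exp \<dots> = c ^ s" by (simp add: c_def exp_of_nat_mult)
      finally have "(\<Prod>j\<in>UNIV. exp (t $ j) ^ (m $ j)) = c ^ s" .
      then have "of_real (\<Prod>j\<in>UNIV. exp (t $ j) ^ (m $ j)) = (of_real (c ^ s) :: complex)"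
        by (rule arg_cong)
      then show ?thesis
        by (simp add: mono_eval_def z'_def power_mult_distrib prod.distrib mult.commute)
    qed
  qed
qed

section \<open>Dickson's lemma and finite generation of the semigroup\<close>

lemma common_incseq_subsequence:
  fixes c :: "'i \<Rightarrow> 'a \<Rightarrow> nat"
  assumes "finite I"
  shows "\<exists>\<sigma>::nat \<Rightarrow> nat. strict_mono \<sigma> \<and> (\<forall>i\<in>I. incseq (\<lambda>n. c i (f (\<sigma> n))))"
  using assms
proof (induction I)
  case empty
  show ?case using strict_mono_id by blast
next
  case (insert i I)
  then obtain \<sigma> :: "nat \<Rightarrow> nat"
    where \<sigma>: "strict_mono \<sigma>" "\<And>i. i \<in> I \<Longrightarrow> incseq (\<lambda>n. c i (f (\<sigma> n)))"
    by blast
  have sub: "incseq (\<lambda>n. g (\<tau> n))" if "incseq g" "strict_mono \<tau>" for g :: "nat \<Rightarrow> nat" and \<tau> :: "nat \<Rightarrow> nat"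
    using that strict_mono_mono[OF that(2)] by (simp add: mono_def)
  obtain \<tau> :: "nat \<Rightarrow> nat" where \<tau>: "strict_mono \<tau>" "monoseq (\<lambda>n. c i (f (\<sigma> (\<tau> n))))"
    using seq_monosub[of "\<lambda>n. c i (f (\<sigma> n))"] by blast
  have "\<exists>\<rho>. strict_mono \<rho> \<and> incseq (\<lambda>n. c i (f (\<sigma> (\<rho> n))))"
  proof (cases "incseq (\<lambda>n. c i (f (\<sigma> (\<tau> n))))")
    case True
    then show ?thesis using \<tau>(1) by blast
  next
    case False
    let ?g = "\<lambda>n. c i (f (\<sigma> (\<tau> n)))"
    have dec: "decseq ?g" using \<tau>(2) False by (simp add: monoseq_iff)
    \<comment> \<open>A decreasing sequence of natural numbers is constant, hence increasing, from
      an index where it attains its minimum.\<close>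
    define N where "N = (ARG_MIN ?g n. True)"
    have N: "?g N \<le> ?g n" for n unfolding N_def by (rule arg_min_nat_le) simp
    have "?g (n + N) = ?g N" for n
      using N[of "n + N"] decseqD[OF dec, of N "n + N"] by simp
    then have "incseq (\<lambda>n. ?g (n + N))" by (simp add: mono_def)
    moreover have "strict_mono (\<lambda>n. \<tau> (n + N))"
      using \<tau>(1) by (simp add: strict_mono_def)
    ultimately show ?thesis by blast
  qed
  then obtain \<rho> where \<rho>: "strict_mono \<rho>" "incseq (\<lambda>n. c i (f (\<sigma> (\<rho> n))))" by blast
  have "strict_mono (\<lambda>n. \<sigma> (\<rho> n))" using \<sigma>(1) \<rho>(1) by (simp add: strict_mono_def)
  then show ?case using sub[OF \<sigma>(2) \<rho>(1)] \<rho>(2) by (intro exI[of _ "\<lambda>n. \<sigma> (\<rho> n)"]) auto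
qed

text \<open>B consists of the minimal elements. They form an antichain, while an infinite set would
  contain a comparable pair by passing to a subsequence that increases in all coordinates.\<close>

lemma dickson:
  fixes S :: "(nat \<times> (nat^'n)) set"
  obtains B where "finite B" "B \<subseteq> S"
    "\<And>r u. (r, u) \<in> S \<Longrightarrow> \<exists>(s, v)\<in>B. s \<le> r \<and> (\<forall>j. v $ j \<le> u $ j)"
proof
  define le where "le = (\<lambda>x y :: nat \<times> (nat^'n). fst x \<le> fst y \<and> (\<forall>j. snd x $ j \<le> snd y $ j))"
  define B where "B = {x \<in> S. \<forall>y\<in>S. le y x \<longrightarrow> y = x}"
  show "B \<subseteq> S" by (auto simp: B_def)
  show "finite B"
  proof (rule ccontr)
    assume "infinite B"
    then obtain f :: "nat \<Rightarrow> _" where f: "inj f" "range f \<subseteq> B" using infinite_countable_subset by blast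
    \<comment> \<open>The degree is treated as one extra coordinate, indexed by
      \<open>None\<close>.\<close>
    define c where "c i x = (case i of None \<Rightarrow> fst x | Some j \<Rightarrow> snd x $ j)" for i and x :: "nat \<times> (nat^'n)"
    obtain \<sigma> :: "nat \<Rightarrow> nat" where \<sigma>: "strict_mono \<sigma>" "\<And>i. incseq (\<lambda>n. c i (f (\<sigma> n)))"
      using common_incseq_subsequence[of UNIV c f] by auto
    have "le (f (\<sigma> 0)) (f (\<sigma> 1))"
      using incseqD[OF \<sigma>(2)[of None], of 0 1] incseqD[OF \<sigma>(2)[of "Some _"], of 0 1]
      by (simp add: le_def c_def)
    moreover have "f (\<sigma> 0) \<in> B" "f (\<sigma> 1) \<in> B" using f(2) by auto
    ultimately have "f (\<sigma> 0) = f (\<sigma> 1)" unfolding B_def by blast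
    then show False using f(1) strict_monoD[OF \<sigma>(1), of 0 1] by (simp add: inj_eq)
  qed
  fix r u assume "(r, u) \<in> S"
  \<comment> \<open>Strictly smaller elements have strictly smaller total size, so descent ends at a
    minimal element.\<close>
  define sz where "sz x = fst x + (\<Sum>j\<in>UNIV. snd x $ j)" for x :: "nat \<times> (nat^'n)"
  have "\<exists>y\<in>B. le y x" if "x \<in> S" for x
    using that
  proof (induction "sz x" arbitrary: x rule: less_induct)
    case less
    show ?case
    proof (cases "x \<in> B")
      case True
      then show ?thesis by (auto simp: le_def)
    next
      case False
      then obtain y where y: "y \<in> S" "le y x" "y \<noteq> x" using less.prems by (auto simp: B_def)
      have "sz y < sz x"
      proof (rule ccontr)
        assume n: "\<not> sz y < sz x"
        have 1: "(\<Sum>j\<in>UNIV. snd y $ j) \<le> (\<Sum>j\<in>UNIV. snd x $ j)"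
          using y(2) by (intro sum_mono) (auto simp: le_def)
        have f: "fst y = fst x" and s: "(\<Sum>j\<in>UNIV. snd y $ j) = (\<Sum>j\<in>UNIV. snd x $ j)"
          using n 1 y(2) by (auto simp: sz_def le_def)
        have "snd y $ j = snd x $ j" for j
        proof (rule ccontr)
          assume "snd y $ j \<noteq> snd x $ j"
          then have "snd y $ j < snd x $ j" using y(2) by (simp add: le_def order_less_le)
          then have "(\<Sum>j\<in>UNIV. snd y $ j) < (\<Sum>j\<in>UNIV. snd x $ j)"
            using y(2) by (intro sum_strict_mono_ex1) (auto simp: le_def)
          then show False using s by simp
        qed
        then show False using y(3) f by (simp add: prod_eq_iff vec_eq_iff)
      qed
      then obtain b where "b \<in> B" "le b y" using less.hyps y(1) by blast
      then show ?thesis using y(2) by (auto simp: le_def intro: order_trans)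
    qed
  qed
  from this[OF \<open>(r, u) \<in> S\<close>] obtain y where "y \<in> B" "le y (r, u)" by blast
  then show "\<exists>(s, v)\<in>B. s \<le> r \<and> (\<forall>j. v $ j \<le> u $ j)"
    by (intro bexI[of _ y]) (auto simp: le_def split: prod.split)
qed

text \<open>Barring (0, 0) as a generator makes every step contribute at least 1 to degree plus
  total exponent. An estimate that loses a fixed factor per generator then becomes exponential in
  that sum.\<close>

inductive generated_by :: "(nat \<times> (nat^'n)) set \<Rightarrow> nat \<Rightarrow> nat^'n \<Rightarrow> bool" for B where
  zero: "generated_by B 0 0"
| add: "\<lbrakk>(s, v) \<in> B; (s, v) \<noteq> (0, 0); generated_by B t w\<rbrakk> \<Longrightarrow> generated_by B (s + t) (v + w)"

text \<open>Gordan's lemma. The semigroup is cut out by equations and nonnegativity, so a generator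
  lying below an element can be subtracted without leaving it, and the size drops.\<close>

lemma lattice_points_finitely_generated:
  fixes A :: "int^'n^'d"
  obtains B where "finite B" "\<And>r u. (r, u) \<in> B \<Longrightarrow> u \<in> lattice_points A \<theta> r"
    "\<And>r u. u \<in> lattice_points A \<theta> r \<Longrightarrow> generated_by B r u"
proof -
  obtain B where B: "finite B" "B \<subseteq> {(r, u). u \<in> lattice_points A \<theta> r \<and> (r, u) \<noteq> (0, 0)}"
    "\<And>r u. (r, u) \<in> {(r, u). u \<in> lattice_points A \<theta> r \<and> (r, u) \<noteq> (0, 0)}
       \<Longrightarrow> \<exists>(s, v)\<in>B. s \<le> r \<and> (\<forall>j. v $ j \<le> u $ j)"
    using dickson by blast
  show ?thesis
  proof (rule that[OF B(1)])
    show "u \<in> lattice_points A \<theta> r" if "(r, u) \<in> B" for r u using B(2) that by auto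
    fix r u
    assume "u \<in> lattice_points A \<theta> r"
    then show "generated_by B r u"
    proof (induction "r + (\<Sum>j\<in>UNIV. u $ j)" arbitrary: r u rule: less_induct)
      case less
      show ?case
      proof (cases "(r, u) = (0, 0)")
        case True
        then show ?thesis using generated_by.zero by simp
      next
        case False
        then obtain s v where sv: "(s, v) \<in> B" "s \<le> r" "\<And>j. v $ j \<le> u $ j"
          using B(3) less.prems by blast
        have v: "v \<in> lattice_points A \<theta> s" "(s, v) \<noteq> (0, 0)" using sv(1) B(2) by auto
        let ?w = "\<chi> j. u $ j - v $ j"
        have w: "?w \<in> lattice_points A \<theta> (r - s)"
          by (rule diff_lattice_points[OF less.prems v(1) sv(2,3)])
        have u: "u = v + ?w" using sv(3) by (simp add: vec_eq_iff)
        have "s + (\<Sum>j\<in>UNIV. v $ j) > 0"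
        proof (rule ccontr)
          assume "\<not> s + (\<Sum>j\<in>UNIV. v $ j) > 0"
          then have "s = 0" "v = 0" by (auto simp: vec_eq_iff)
          then show False using v(2) by simp
        qed
        moreover have "(\<Sum>j\<in>UNIV. u $ j) = (\<Sum>j\<in>UNIV. v $ j) + (\<Sum>j\<in>UNIV. ?w $ j)"
          by (subst u) (simp add: sum.distrib)
        ultimately have "(r - s) + (\<Sum>j\<in>UNIV. ?w $ j) < r + (\<Sum>j\<in>UNIV. u $ j)"
          using sv(2) by linarith
        then have "generated_by B (r - s) ?w" using less.hyps w by blast
        then have "generated_by B (s + (r - s)) (v + ?w)" by (rule generated_by.add[OF sv(1) v(2)])
        then show ?thesis using u sv(2) by simp
      qed
    qed
  qed
qed

section \<open>Characters of subgroups of the integer lattice\<close>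

definition laurent_eval :: "'a::field^'n \<Rightarrow> int^'n \<Rightarrow> 'a" where
  "laurent_eval t a = (\<Prod>j\<in>UNIV. (t $ j) powi (a $ j))"

lemma laurent_eval_diff:
  "(\<And>j. t $ j \<noteq> 0) \<Longrightarrow> laurent_eval t (a - b) = laurent_eval t a / laurent_eval t b"
  by (simp add: laurent_eval_def power_int_diff prod_dividef)

lemma laurent_eval_smult: "laurent_eval t (k *s a) = laurent_eval t a powi k"
proof -
  have "(\<Prod>j\<in>S. (t $ j) powi (k * a $ j)) = (\<Prod>j\<in>S. (t $ j) powi (a $ j)) powi k" if "finite S" for S
    using that
  proof (induction S)
    case (insert x F)
    have "(t $ x) powi (k * a $ x) = ((t $ x) powi (a $ x)) powi k"
      by (subst mult.commute) (rule power_int_mult)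
    then show ?case using insert by (simp add: power_int_mult_distrib)
  qed simp
  then show ?thesis by (simp add: laurent_eval_def)
qed

text \<open>\<open>R\<close> is the graph of a character of a subgroup of \<open>\<int>\<^sup>n\<close>. It extends to \<open>\<int>\<^sup>n\<close>, one coordinate at a
  time, because \<open>\<complex>\<^sup>*\<close> is divisible.\<close>

lemma character_extension:
  fixes R :: "((int^'n) \<times> complex) set"
  assumes zero: "(0, 1) \<in> R"
    and diff: "\<And>a b x y. \<lbrakk>(a, x) \<in> R; (b, y) \<in> R\<rbrakk> \<Longrightarrow> (a - b, x / y) \<in> R"
    and nz: "\<And>a x. (a, x) \<in> R \<Longrightarrow> x \<noteq> 0"
    and single: "\<And>x. (0, x) \<in> R \<Longrightarrow> x = 1"
  obtains t where "\<And>j. t $ j \<noteq> 0" "\<And>a x. (a, x) \<in> R \<Longrightarrow> x = laurent_eval t a"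
proof -
  \<comment> \<open>The graph stays variable in the induction over S, because the step applies the
    hypothesis to the smaller group of vectors with vanishing j-th coordinate.\<close>
  have "\<exists>t. (\<forall>j. t $ j \<noteq> 0) \<and> (\<forall>(a, x)\<in>R. x = laurent_eval t a)"
    if "finite S" "(0, 1) \<in> R" "\<And>a b x y. \<lbrakk>(a, x) \<in> R; (b, y) \<in> R\<rbrakk> \<Longrightarrow> (a - b, x / y) \<in> R"
      "\<And>a x. (a, x) \<in> R \<Longrightarrow> x \<noteq> 0" "\<And>x. (0, x) \<in> R \<Longrightarrow> x = 1" "\<And>a x. (a, x) \<in> R \<Longrightarrow> vsupp a \<subseteq> S"
    for S :: "'n set" and R :: "((int^'n) \<times> complex) set"
    using that
  proof (induction S arbitrary: R)
    case empty
    have "x = 1" if ax: "(a, x) \<in> R" for a x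
    proof -
      have "a = 0" using empty.prems(5)[OF ax] by (simp add: vsupp_def vec_eq_iff)
      then show ?thesis using empty.prems(4) ax by simp
    qed
    then show ?case by (intro exI[of _ "\<chi> j. 1"]) (auto simp: laurent_eval_def)
  next
    case (insert j S)
    note zero = insert.prems(1) and diff = insert.prems(2) and nz = insert.prems(3)
      and single = insert.prems(4) and supp = insert.prems(5)
    have add: "(a + b, x * y) \<in> R" if "(a, x) \<in> R" "(b, y) \<in> R" for a b x y
      using diff[OF that(1) diff[OF zero that(2)]] by simp
    have natmult: "(int k *s a, x ^ k) \<in> R" if "(a, x) \<in> R" for a x k
    proof (induction k)
      case 0
      have "int 0 *s a = 0" by (simp add: vec_eq_iff)
      then show ?case using zero by simp
    next
      case (Suc k)
      have "int (Suc k) *s a = a + int k *s a" by (simp add: vec_eq_iff algebra_simps)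
      then show ?case using add[OF that Suc] by simp
    qed
    have intmult: "(k *s a, x powi k) \<in> R" if "(a, x) \<in> R" for a x k
    proof (cases "k \<ge> 0")
      case True
      then show ?thesis using natmult[OF that, of "nat k"] by (simp add: power_int_nonneg_exp)
    next
      case False
      have "(0 - int (nat (- k)) *s a, 1 / x ^ nat (- k)) \<in> R" by (rule diff[OF zero natmult[OF that]])
      moreover have "0 - int (nat (- k)) *s a = k *s a" using False by (simp add: vec_eq_iff)
      ultimately show ?thesis using False by (simp add: power_int_def field_simps)
    qed
    define R' where "R' = {(a, x). (a, x) \<in> R \<and> a $ j = 0}"
    have "\<exists>t. (\<forall>j. t $ j \<noteq> 0) \<and> (\<forall>(a, x)\<in>R'. x = laurent_eval t a)"
    proof (rule insert.IH)
      show "vsupp a \<subseteq> S" if "(a, x) \<in> R'" for a x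
        using supp[of a x] that by (auto simp: R'_def vsupp_def)
      show "(0, 1) \<in> R'" using zero by (simp add: R'_def)
      show "(a - b, x / y) \<in> R'" if "(a, x) \<in> R'" "(b, y) \<in> R'" for a b x y
        using diff[of a x b y] that by (simp add: R'_def)
      show "x \<noteq> 0" if "(a, x) \<in> R'" for a x using nz[of a x] that by (simp add: R'_def)
      show "x = 1" if "(0, x) \<in> R'" for x using single[of x] that by (simp add: R'_def)
    qed
    then obtain t where t: "\<And>j. t $ j \<noteq> 0" "\<And>a x. (a, x) \<in> R' \<Longrightarrow> x = laurent_eval t a"
      by blast
    show ?case
    proof (cases "\<exists>a x. (a, x) \<in> R \<and> a $ j \<noteq> 0")
      case False
      then have "R' = R" by (auto simp: R'_def)
      then show ?thesis using t by blast
    next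
      case True
      \<comment> \<open>The least such m generates the ideal of all j-th coordinates that
        occur.\<close>
      define Q where "Q m \<longleftrightarrow> m > 0 \<and> (\<exists>a x. (a, x) \<in> R \<and> a $ j = int m)" for m
      have "\<exists>m. Q m"
      proof -
        obtain a x where ax: "(a, x) \<in> R" "a $ j \<noteq> 0" using True by blast
        show ?thesis
        proof (cases "a $ j > 0")
          case True
          then show ?thesis using ax by (intro exI[of _ "nat (a $ j)"]) (auto simp: Q_def)
        next
          case False
          have "(0 - a, 1 / x) \<in> R" by (rule diff[OF zero ax(1)])
          then show ?thesis using ax False
            by (intro exI[of _ "nat (- a $ j)"]) (force simp: Q_def)
        qed
      qed
      define m where "m = (LEAST m. Q m)"
      have Qm: "Q m" unfolding m_def by (rule LeastI_ex) fact
      have mmin: "m \<le> k" if "Q k" for k unfolding m_def by (rule Least_le) (rule that)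
      obtain a0 x0 where a0: "(a0, x0) \<in> R" "a0 $ j = int m" and m0: "m > 0"
        using Qm by (auto simp: Q_def)
      define w where "w = (\<Prod>i\<in>UNIV - {j}. (t $ i) powi (a0 $ i))"
      have w: "w \<noteq> 0" using t(1) by (simp add: w_def)
      \<comment> \<open>An m-th root, chosen so that the extended character takes the prescribed
        value x0 at a0.\<close>
      define \<tau> where "\<tau> = exp (Ln (x0 / w) / of_nat m)"
      have \<tau>: "\<tau> ^ m = x0 / w" using m0 w nz[OF a0(1)] by (simp add: \<tau>_def exp_divide_power_eq)
      define t' where "t' = (\<chi> i. if i = j then \<tau> else t $ i)"
      have t': "t' $ i \<noteq> 0" for i using t(1) by (simp add: t'_def \<tau>_def)
      have split: "laurent_eval t' a = \<tau> powi (a $ j) * (\<Prod>i\<in>UNIV - {j}. (t $ i) powi (a $ i))" for a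
        unfolding laurent_eval_def by (subst prod.remove[of _ j]) (auto simp: t'_def)
      have e0: "laurent_eval t' a0 = x0"
        unfolding split a0(2) using \<tau> w by (simp add: w_def)
      have same: "laurent_eval t' a = laurent_eval t a" if "a $ j = 0" for a
        unfolding laurent_eval_def by (rule prod.cong) (auto simp: t'_def that)
      have "x = laurent_eval t' a" if ax: "(a, x) \<in> R" for a x
      proof -
        \<comment> \<open>Subtracting k times a0 leaves the remainder modulo m as j-th coordinate,
          which is 0 by minimality of m.\<close>
        define k where "k = a $ j div int m"
        have b: "(a - k *s a0, x / x0 powi k) \<in> R" by (rule diff[OF ax intmult[OF a0(1)]])
        have bj: "(a - k *s a0) $ j = a $ j mod int m"
          by (simp add: a0(2) k_def minus_div_mult_eq_mod)
        have "a $ j mod int m = 0"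
        proof (rule ccontr)
          assume n: "a $ j mod int m \<noteq> 0"
          have r: "0 \<le> a $ j mod int m" "a $ j mod int m < int m" using m0 by auto
          then have "Q (nat (a $ j mod int m))"
            using b bj n by (auto simp: Q_def intro!: exI[of _ "a - k *s a0"] exI[of _ "x / x0 powi k"])
          then show False using mmin r n by fastforce
        qed
        then have "(a - k *s a0, x / x0 powi k) \<in> R'" using b bj by (auto simp: R'_def)
        then have "x / x0 powi k = laurent_eval t' (a - k *s a0)"
          using t(2) same by (auto simp: R'_def)
        also have "\<dots> = laurent_eval t' a / x0 powi k"
          using t' by (simp add: laurent_eval_diff laurent_eval_smult e0)
        finally show ?thesis using nz[OF a0(1)] by simp
      qed
      then show ?thesis using t' by blast
    qed
  qed
  note ext = this
  have "\<exists>t. (\<forall>j. t $ j \<noteq> 0) \<and> (\<forall>(a, x)\<in>R. x = laurent_eval t a)"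
  proof (rule ext[where S = UNIV])
    show "(a - b, x / y) \<in> R" if "(a, x) \<in> R" "(b, y) \<in> R" for a b x y by (rule diff[OF that])
    show "x \<noteq> 0" if "(a, x) \<in> R" for a x by (rule nz[OF that])
    show "x = 1" if "(0, x) \<in> R" for x by (rule single[OF that])
  qed (use zero in simp_all)
  then obtain t where "\<forall>j. t $ j \<noteq> 0" "\<forall>(a, x)\<in>R. x = laurent_eval t a" by blast
  then show ?thesis by (intro that[of t]) auto
qed

section \<open>Points of \<open>Proj R\<close>\<close>

text \<open>Every cone spanned by d - 1 columns contains 0. Such a set of columns exists because
  there are at least d columns.\<close>

lemma generic_degree_nonzero:
  fixes A :: "int^'n^'d"
  assumes "coprime_maximal_minors A" "generic_degree A \<theta>"
  shows "\<theta> \<noteq> 0"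
proof -
  have "\<exists>s :: 'd \<Rightarrow> 'n. inj s"
  proof (rule ccontr)
    assume "\<nexists>s :: 'd \<Rightarrow> 'n. inj s"
    \<comment> \<open>The Gcd of the empty set is 0, so coprime minors force an injective choice of
      columns to exist.\<close>
    then have "{det (\<chi> i j. A $ i $ s j) | s :: 'd \<Rightarrow> 'n. inj s} = {}" by auto
    then show False using assms(1) by (simp add: coprime_maximal_minors_def)
  qed
  then obtain s :: "'d \<Rightarrow> 'n" where "inj s" by blast
  then have "CARD('d) \<le> CARD('n)" using card_inj_on_le[of s UNIV UNIV] by simp
  then have "CARD('d) - 1 \<le> card (UNIV :: 'n set)" by simp
  then obtain I :: "'n set" where "card I = CARD('d) - 1"
    by (rule obtain_subset_with_card_n)
  then have "real_vec \<theta> \<notin> pos_columns A I" using assms(2) by (simp add: generic_degree_def)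
  moreover have "0 \<in> pos_columns A I"
    unfolding pos_columns_def by (auto intro!: exI[of _ "\<lambda>_. 0"])
  moreover have "real_vec \<theta> = 0" if "\<theta> = 0" using that by (simp add: real_vec_def vec_eq_iff)
  ultimately show ?thesis by metis
qed

text \<open>Nonvanishing of \<theta> makes the degree r of an exponent unique; integrality supplies
  exponents of degree \<theta> at the vertices.\<close>

locale toric_data =
  fixes A :: "int^'n^'d" and \<theta> :: "int^'d"
  assumes theta_nonzero: "\<theta> \<noteq> 0" and integral: "integral_degree A \<theta>"
begin

abbreviation "M \<equiv> lattice_points A \<theta>"
abbreviation "P \<equiv> degree_polyhedron A \<theta>"
abbreviation "R \<equiv> veronese_ring A \<theta>"
abbreviation "piece \<equiv> veronese_piece A \<theta>"

lemma lattice_points_degree_unique: "\<lbrakk>u \<in> M r; u \<in> M s\<rbrakk> \<Longrightarrow> r = s"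
  using theta_nonzero by (auto simp: mem_lattice_points vec_eq_iff)

lemma mem_piece: "f \<in> piece r \<longleftrightarrow> Poly_Mapping.keys f \<subseteq> M r"
  by (auto simp: veronese_piece_def graded_piece_def lattice_points_def)

lemma piece_single: "u \<in> M r \<Longrightarrow> Poly_Mapping.single u c \<in> piece r"
  by (simp add: mem_piece)

lemma piece_add: "\<lbrakk>f \<in> piece r; g \<in> piece r\<rbrakk> \<Longrightarrow> f + g \<in> piece r"
  using keys_add[of f g] by (auto simp: mem_piece)

lemma piece_minus: "f \<in> piece r \<Longrightarrow> - f \<in> piece r"
  by (auto simp: mem_piece in_keys_iff)

lemma piece_diff: "\<lbrakk>f \<in> piece r; g \<in> piece r\<rbrakk> \<Longrightarrow> f - g \<in> piece r"
  using piece_add[OF _ piece_minus, of f r g] by simp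

lemma piece_mult: "\<lbrakk>f \<in> piece r; g \<in> piece s\<rbrakk> \<Longrightarrow> f * g \<in> piece (r + s)"
proof -
  assume fg: "f \<in> piece r" "g \<in> piece s"
  have "w \<in> M (r + s)" if "w \<in> Poly_Mapping.keys (f * g)" for w
  proof -
    obtain a b where "w = a + b" "a \<in> Poly_Mapping.keys f" "b \<in> Poly_Mapping.keys g"
      using \<open>w \<in> _\<close> keys_mult[of f g] by auto
    then show ?thesis using fg add_lattice_points[of a A \<theta> r b s] by (auto simp: mem_piece)
  qed
  then show ?thesis by (auto simp: mem_piece)
qed

lemma piece_const: "const_poly c \<in> piece 0"
  by (simp add: mem_piece zero_lattice_points)

lemma piece_smult: "f \<in> piece r \<Longrightarrow> const_poly c * f \<in> piece r"
  using piece_mult[OF piece_const, of f r c] by simp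

definition restrict_keys :: "(nat^'n) set \<Rightarrow> 'n cpoly \<Rightarrow> 'n cpoly" where
  "restrict_keys S f = (\<Sum>u\<in>Poly_Mapping.keys f \<inter> S. Poly_Mapping.single u (Poly_Mapping.lookup f u))"

lemma lookup_restrict_keys:
  "Poly_Mapping.lookup (restrict_keys S f) u = (if u \<in> S then Poly_Mapping.lookup f u else 0)"
proof -
  have "Poly_Mapping.lookup (restrict_keys S f) u =
      (\<Sum>v\<in>Poly_Mapping.keys f \<inter> S. if v = u then Poly_Mapping.lookup f v else 0)"
    by (simp add: restrict_keys_def lookup_sum lookup_single when_def)
  also have "\<dots> = (if u \<in> Poly_Mapping.keys f \<inter> S then Poly_Mapping.lookup f u else 0)"
    by (subst sum.delta) auto
  finally show ?thesis by (auto simp: in_keys_iff)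
qed

lemma expansion:
  "(\<Sum>u\<in>Poly_Mapping.keys f. Poly_Mapping.single u (Poly_Mapping.lookup f u)) = (f :: 'n cpoly)"
  using lookup_restrict_keys[of UNIV f] by (intro poly_mapping_eqI) (simp add: restrict_keys_def)

lemma restrict_keys_piece: "restrict_keys (M r) f \<in> piece r"
  by (auto simp: mem_piece in_keys_iff lookup_restrict_keys split: if_splits)

lemma carrier_veronese_ring: "carrier R = {f. Poly_Mapping.keys f \<subseteq> (\<Union>r. M r)}"
proof (intro equalityI subsetI)
  fix f :: "'n cpoly" assume "f \<in> carrier R"
  then obtain N g where g: "f = (\<Sum>r<N. g r)" "\<And>r. g r \<in> piece r"
    by (auto simp: veronese_ring_def)
  have "Poly_Mapping.keys f \<subseteq> (\<Union>r<N. Poly_Mapping.keys (g r))"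
    unfolding g(1) by (rule keys_sum)
  also have "\<dots> \<subseteq> (\<Union>r. M r)" using g(2) unfolding mem_piece by blast
  finally show "f \<in> {f. Poly_Mapping.keys f \<subseteq> (\<Union>r. M r)}" by simp
next
  fix f :: "'n cpoly" assume "f \<in> {f. Poly_Mapping.keys f \<subseteq> (\<Union>r. M r)}"
  then have "\<forall>u\<in>Poly_Mapping.keys f. \<exists>r. u \<in> M r" by auto
  then obtain dg where dg: "\<And>u. u \<in> Poly_Mapping.keys f \<Longrightarrow> u \<in> M (dg u)" by metis
  define N where "N = Suc (Max (insert 0 (dg ` Poly_Mapping.keys f)))"
  have N: "dg u < N" if "u \<in> Poly_Mapping.keys f" for u
    using that by (simp add: N_def less_Suc_eq_le)
  have "f = (\<Sum>r<N. restrict_keys (M r) f)"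
  proof (rule poly_mapping_eqI)
    fix u
    have "(\<Sum>r<N. if u \<in> M r then Poly_Mapping.lookup f u else 0) = Poly_Mapping.lookup f u"
    proof (cases "u \<in> Poly_Mapping.keys f")
      case True
      then have "u \<in> M r \<longleftrightarrow> r = dg u" for r using dg lattice_points_degree_unique by blast
      then show ?thesis using N[OF True] by simp
    next
      case False
      then have z: "Poly_Mapping.lookup f u = 0" by (simp add: in_keys_iff)
      have "(\<Sum>r<N. if u \<in> M r then Poly_Mapping.lookup f u else 0) = 0"
        by (rule sum.neutral) (simp add: z)
      then show ?thesis by (simp only: z)
    qed
    then show "Poly_Mapping.lookup f u = Poly_Mapping.lookup (\<Sum>r<N. restrict_keys (M r) f) u"
      by (simp add: lookup_sum lookup_restrict_keys)
  qed
  then show "f \<in> carrier R"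
    using restrict_keys_piece by (auto simp: veronese_ring_def)
qed

lemma homogeneous_expansion:
  assumes "f \<in> carrier R"
  obtains N where "f = (\<Sum>r<N. restrict_keys (M r) f)"
proof -
  obtain N g where g: "f = (\<Sum>r<N. g r)" "\<And>r. g r \<in> piece r"
    using assms by (auto simp: veronese_ring_def)
  have "restrict_keys (M r) f = g r" if "r < N" for r
  proof (rule poly_mapping_eqI)
    fix u
    have z: "Poly_Mapping.lookup (g s) u = 0" if "u \<notin> M s" for s
      using g(2)[of s] that by (auto simp: mem_piece in_keys_iff)
    show "Poly_Mapping.lookup (restrict_keys (M r) f) u = Poly_Mapping.lookup (g r) u"
    proof (cases "u \<in> M r")
      case True
      then have "Poly_Mapping.lookup (g s) u = 0" if "s \<noteq> r" for s
        using z lattice_points_degree_unique that by blast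
      then have "(\<Sum>s<N. Poly_Mapping.lookup (g s) u) = (\<Sum>s<N. if s = r then Poly_Mapping.lookup (g r) u else 0)"
        by (intro sum.cong) auto
      then show ?thesis using True \<open>r < N\<close> by (simp add: lookup_restrict_keys g(1) lookup_sum)
    qed (simp add: lookup_restrict_keys z)
  qed
  then have "(\<Sum>r<N. restrict_keys (M r) f) = (\<Sum>r<N. g r)" by (intro sum.cong) auto
  then show ?thesis by (intro that[of N]) (metis g(1))
qed

lemma piece_subset_carrier: "piece r \<subseteq> carrier R"
  unfolding carrier_veronese_ring using mem_piece by blast

lemma veronese_ring_simps [simp]:
  "x \<otimes>\<^bsub>R\<^esub> y = x * y" "x \<oplus>\<^bsub>R\<^esub> y = x + y" "\<one>\<^bsub>R\<^esub> = 1" "\<zero>\<^bsub>R\<^esub> = 0"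
  by (simp_all add: veronese_ring_def)

lemma carrier_add: "\<lbrakk>f \<in> carrier R; g \<in> carrier R\<rbrakk> \<Longrightarrow> f + g \<in> carrier R"
  unfolding carrier_veronese_ring using keys_add[of f g] by blast

lemma carrier_uminus: "f \<in> carrier R \<Longrightarrow> - f \<in> carrier R"
proof -
  have "Poly_Mapping.keys (- f) = Poly_Mapping.keys f" by (auto simp: in_keys_iff)
  then show "f \<in> carrier R \<Longrightarrow> - f \<in> carrier R" unfolding carrier_veronese_ring by simp
qed

lemma carrier_mult: "\<lbrakk>f \<in> carrier R; g \<in> carrier R\<rbrakk> \<Longrightarrow> f * g \<in> carrier R"
proof -
  assume "f \<in> carrier R" "g \<in> carrier R"
  then have fg: "\<exists>r. a \<in> M r" "\<exists>s. b \<in> M s"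
    if "a \<in> Poly_Mapping.keys f" "b \<in> Poly_Mapping.keys g" for a b
    using that by (auto simp: carrier_veronese_ring)
  have "\<exists>r. w \<in> M r" if "w \<in> Poly_Mapping.keys (f * g)" for w
  proof -
    obtain a b where "w = a + b" "a \<in> Poly_Mapping.keys f" "b \<in> Poly_Mapping.keys g"
      using \<open>w \<in> _\<close> keys_mult[of f g] by auto
    then show ?thesis using fg[of a b] add_lattice_points by metis
  qed
  then show ?thesis by (auto simp: carrier_veronese_ring)
qed

lemma carrier_one: "1 \<in> carrier R" and carrier_zero: "0 \<in> carrier R"
  using zero_lattice_points unfolding carrier_veronese_ring by (simp_all, blast)

lemma cring_veronese_ring: "cring R"
proof (rule cringI)
  show "abelian_group R"
  proof (rule abelian_groupI)
    fix x assume "x \<in> carrier R"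
    then show "\<exists>y\<in>carrier R. y \<oplus>\<^bsub>R\<^esub> x = \<zero>\<^bsub>R\<^esub>"
      using carrier_uminus by (intro bexI[of _ "- x"]) auto
  qed (auto simp: carrier_add carrier_zero algebra_simps)
  show "comm_monoid R"
    by (rule comm_monoidI) (auto simp: carrier_mult carrier_one algebra_simps)
qed (simp add: algebra_simps)

lemma a_inv_veronese_ring:
  assumes "x \<in> carrier R" shows "\<ominus>\<^bsub>R\<^esub> x = - x"
proof -
  interpret cring R by (rule cring_veronese_ring)
  show ?thesis by (rule minus_equality) (use assms carrier_uminus in auto)
qed

lemma primeideal_veronese_iff:
  "primeideal \<pp> R \<longleftrightarrow> \<pp> \<subseteq> carrier R \<and> 0 \<in> \<pp> \<and> (\<forall>a\<in>\<pp>. \<forall>b\<in>\<pp>. a + b \<in> \<pp>)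
     \<and> (\<forall>a\<in>\<pp>. \<forall>x\<in>carrier R. x * a \<in> \<pp>) \<and> 1 \<notin> \<pp>
     \<and> (\<forall>a\<in>carrier R. \<forall>b\<in>carrier R. a * b \<in> \<pp> \<longrightarrow> a \<in> \<pp> \<or> b \<in> \<pp>)" (is "?L \<longleftrightarrow> ?Q")
proof
  assume ?L
  then interpret primeideal \<pp> R .
  have "1 \<notin> \<pp>"
  proof
    assume "1 \<in> \<pp>"
    then have "x \<in> \<pp>" if "x \<in> carrier R" for x using I_l_closed[of 1 x] that by simp
    then show False using I_notcarr a_subset by blast
  qed
  then show ?Q
    using a_subset additive_subgroup.zero_closed[OF additive_subgroup_axioms]
      additive_subgroup.a_closed[OF additive_subgroup_axioms] I_l_closed I_prime
    by simp
next
  assume Q: ?Q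
  show ?L
  proof (rule primeidealI[OF idealI cring_veronese_ring])
    show "ring R" using cring_veronese_ring by (rule cring.axioms)
    show "subgroup \<pp> (add_monoid R)"
    proof
      fix x assume x: "x \<in> \<pp>"
      then have "(- 1) * x \<in> \<pp>" using Q carrier_uminus[OF carrier_one] by blast
      then show "inv\<^bsub>add_monoid R\<^esub> x \<in> \<pp>"
        using a_inv_veronese_ring[of x] Q x by (auto simp: a_inv_def)
    qed (use Q in auto)
    show "carrier R \<noteq> \<pp>" using Q carrier_one by blast
  qed (use Q in \<open>auto simp: mult.commute\<close>)
qed

text \<open>Specified only for exponents of monomials in R, so statements that depend on degrees are
  restricted to \<open>carrier R\<close>.\<close>

definition degree_of :: "nat^'n \<Rightarrow> nat" where
  "degree_of u = (THE r. u \<in> M r)"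

lemma degree_of_eq: "u \<in> M r \<Longrightarrow> degree_of u = r"
  unfolding degree_of_def by (rule the_equality) (auto intro: lattice_points_degree_unique)

section \<open>Evaluation and the homogeneous prime ideal of a vector\<close>

definition poly_eval :: "complex^'n \<Rightarrow> 'n cpoly \<Rightarrow> complex" where
  "poly_eval z f = (\<Sum>u\<in>Poly_Mapping.keys f. Poly_Mapping.lookup f u * mono_eval z u)"

text \<open>The graded homomorphism \<open>R \<rightarrow> \<complex>[w]\<close>, \<open>x\<^sup>u \<mapsto> z\<^sup>u w\<^sup>r\<close> for \<open>u\<close> of degree \<open>r \<theta>\<close>.\<close>

definition graded_eval :: "complex^'n \<Rightarrow> 'n cpoly \<Rightarrow> complex poly" where
  "graded_eval z f =
     (\<Sum>u\<in>Poly_Mapping.keys f. Polynomial.monom (Poly_Mapping.lookup f u * mono_eval z u) (degree_of u))"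

text \<open>Being the kernel of a homomorphism into a domain makes it prime. The exponent of the
  polynomial variable separates degrees, so membership means that every homogeneous component
  vanishes at z.\<close>

definition point :: "complex^'n \<Rightarrow> 'n cpoly set" where
  "point z = {f \<in> carrier R. graded_eval z f = 0}"

lemma poly_eval_zero [simp]: "poly_eval z 0 = 0" by (simp add: poly_eval_def)
lemma graded_eval_zero [simp]: "graded_eval z 0 = 0" by (simp add: graded_eval_def)

lemma poly_eval_add: "poly_eval z (f + g) = poly_eval z f + poly_eval z g"
  unfolding poly_eval_def
  by (rule setsum_keys_plus_distrib[where f = "\<lambda>u c. c * mono_eval z u"]) (auto simp: algebra_simps)

lemma graded_eval_add: "graded_eval z (f + g) = graded_eval z f + graded_eval z g"
  unfolding graded_eval_def
  by (rule setsum_keys_plus_distrib[where f = "\<lambda>u c. Polynomial.monom (c * mono_eval z u) (degree_of u)"])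
     (auto simp: algebra_simps add_monom)

lemma poly_eval_diff: "poly_eval z (f - g) = poly_eval z f - poly_eval z g"
  using poly_eval_add[of z "f - g" g] by simp

lemma graded_eval_sum: "graded_eval z (sum f I) = (\<Sum>i\<in>I. graded_eval z (f i))"
  by (induction I rule: infinite_finite_induct) (simp_all add: graded_eval_add)

lemma poly_eval_sum: "poly_eval z (sum f I) = (\<Sum>i\<in>I. poly_eval z (f i))"
  by (induction I rule: infinite_finite_induct) (simp_all add: poly_eval_add)

lemma poly_eval_single: "poly_eval z (Poly_Mapping.single u c) = c * mono_eval z u"
  by (cases "c = 0") (simp_all add: poly_eval_def)

lemma graded_eval_single:
  "graded_eval z (Poly_Mapping.single u c) = Polynomial.monom (c * mono_eval z u) (degree_of u)"
  by (cases "c = 0") (simp_all add: graded_eval_def)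

lemma poly_eval_smult: "poly_eval z (const_poly c * f) = c * poly_eval z f"
proof -
  have "const_poly c * f = (\<Sum>u\<in>Poly_Mapping.keys f. Poly_Mapping.single u (c * Poly_Mapping.lookup f u))"
    by (subst expansion[of f, symmetric]) (simp add: sum_distrib_left mult_single)
  then show ?thesis
    by (simp add: poly_eval_sum poly_eval_single) (simp add: poly_eval_def sum_distrib_left mult.assoc)
qed

lemma graded_eval_piece:
  assumes "f \<in> piece r" shows "graded_eval z f = Polynomial.monom (poly_eval z f) r"
proof -
  have "graded_eval z f = (\<Sum>u\<in>Poly_Mapping.keys f. Polynomial.monom (Poly_Mapping.lookup f u * mono_eval z u) r)"
    unfolding graded_eval_def
  proof (intro sum.cong refl)
    fix u assume "u \<in> Poly_Mapping.keys f"
    then have "u \<in> M r" using assms by (auto simp: mem_piece)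
    then show "Polynomial.monom (Poly_Mapping.lookup f u * mono_eval z u) (degree_of u)
        = Polynomial.monom (Poly_Mapping.lookup f u * mono_eval z u) r"
      by (simp only: degree_of_eq)
  qed
  also have "\<dots> = Polynomial.monom (poly_eval z f) r"
    by (simp add: poly_eval_def monom_sum)
  finally show ?thesis .
qed

lemma coeff_graded_eval:
  assumes "f \<in> carrier R"
  shows "Polynomial.coeff (graded_eval z f) r
    = (\<Sum>u\<in>{u \<in> Poly_Mapping.keys f. u \<in> M r}. Poly_Mapping.lookup f u * mono_eval z u)"
proof -
  have "Polynomial.coeff (graded_eval z f) r
    = (\<Sum>u\<in>Poly_Mapping.keys f. if u \<in> M r then Poly_Mapping.lookup f u * mono_eval z u else 0)"
    unfolding graded_eval_def coeff_sum
  proof (rule sum.cong)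
    fix u assume "u \<in> Poly_Mapping.keys f"
    then obtain s where s: "u \<in> M s" using assms by (auto simp: carrier_veronese_ring)
    then have "u \<in> M r \<longleftrightarrow> r = s" using lattice_points_degree_unique by metis
    then show "Polynomial.coeff (Polynomial.monom (Poly_Mapping.lookup f u * mono_eval z u) (degree_of u)) r
        = (if u \<in> M r then Poly_Mapping.lookup f u * mono_eval z u else 0)"
      by (simp add: degree_of_eq[OF s])
  qed simp
  also have "\<dots> = (\<Sum>u\<in>{u \<in> Poly_Mapping.keys f. u \<in> M r}. Poly_Mapping.lookup f u * mono_eval z u)"
    by (rule sum.inter_filter[symmetric]) simp
  finally show ?thesis .
qed

lemma graded_eval_mult:
  assumes "f \<in> carrier R" "g \<in> carrier R"
  shows "graded_eval z (f * g) = graded_eval z f * graded_eval z g"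
proof -
  let ?m = "\<lambda>f u. Polynomial.monom (Poly_Mapping.lookup f u * mono_eval z u) (degree_of u)"
  have "f * g = (\<Sum>u\<in>Poly_Mapping.keys f. \<Sum>v\<in>Poly_Mapping.keys g.
      Poly_Mapping.single (u + v) (Poly_Mapping.lookup f u * Poly_Mapping.lookup g v))"
    by (subst expansion[of f, symmetric], subst expansion[of g, symmetric])
       (simp add: sum_product mult_single)
  then have "graded_eval z (f * g) = (\<Sum>u\<in>Poly_Mapping.keys f. \<Sum>v\<in>Poly_Mapping.keys g.
      graded_eval z (Poly_Mapping.single (u + v) (Poly_Mapping.lookup f u * Poly_Mapping.lookup g v)))"
    by (simp add: graded_eval_sum)
  also have "\<dots> = (\<Sum>u\<in>Poly_Mapping.keys f. \<Sum>v\<in>Poly_Mapping.keys g. ?m f u * ?m g v)"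
  proof (intro sum.cong refl)
    fix u v assume "u \<in> Poly_Mapping.keys f" "v \<in> Poly_Mapping.keys g"
    then obtain r s where rs: "u \<in> M r" "v \<in> M s"
      using assms unfolding carrier_veronese_ring by blast
    note deg = degree_of_eq[OF rs(1)] degree_of_eq[OF rs(2)] degree_of_eq[OF add_lattice_points[OF rs]]
    show "graded_eval z (Poly_Mapping.single (u + v) (Poly_Mapping.lookup f u * Poly_Mapping.lookup g v))
        = ?m f u * ?m g v"
      unfolding graded_eval_single mult_monom mono_eval_add deg by (simp add: mult_ac)
  qed
  also have "\<dots> = graded_eval z f * graded_eval z g" by (simp add: graded_eval_def sum_product)
  finally show ?thesis .
qed

lemma mem_point_piece: "f \<in> piece r \<Longrightarrow> f \<in> point z \<longleftrightarrow> poly_eval z f = 0"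
  using piece_subset_carrier by (auto simp: point_def graded_eval_piece monom_eq_0_iff)

text \<open>A nonvanishing section of degree 1 is demanded, as in geometric invariant theory but
  without passing to multiples of \<theta>; integral vertices provide one on the moment
  fibre.\<close>

definition semistable :: "(complex^'n) set" where
  "semistable = {z. \<exists>v\<in>M 1. mono_eval z v \<noteq> 0}"

lemma point_in_proj_points:
  assumes "z \<in> semistable" shows "point z \<in> proj_points A \<theta>"
proof -
  obtain v where v: "v \<in> M 1" "mono_eval z v \<noteq> 0" using assms by (auto simp: semistable_def)
  have g1: "graded_eval z 1 = 1"
    using graded_eval_single[of z 0 1] degree_of_eq[OF zero_lattice_points]
    by (simp add: monom_0 flip: one_pCons)
  have prime: "primeideal (point z) R"
    unfolding primeideal_veronese_iff
    by (auto simp: point_def carrier_zero carrier_add carrier_mult graded_eval_add graded_eval_mult g1)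
  moreover have "homogeneous_ideal A \<theta> (point z)"
    unfolding homogeneous_ideal_def
  proof (intro conjI allI impI)
    show "ideal (point z) R" using prime by (rule primeideal.axioms)
    fix N r and f :: "nat \<Rightarrow> 'n cpoly"
    assume f: "\<forall>r. f r \<in> piece r" and sum: "(\<Sum>r<N. f r) \<in> point z" and r: "r < N"
    have "graded_eval z (f s) = Polynomial.monom (poly_eval z (f s)) s" for s
      by (rule graded_eval_piece) (use f in simp)
    then have "(\<Sum>s<N. Polynomial.monom (poly_eval z (f s)) s) = 0"
      using sum by (simp add: point_def graded_eval_sum)
    then have "Polynomial.coeff (\<Sum>s<N. Polynomial.monom (poly_eval z (f s)) s) r = 0" by simp
    then have "poly_eval z (f r) = 0" using r by (simp add: coeff_sum)
    then show "f r \<in> point z" using f mem_point_piece by blast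
  qed
  moreover have "\<exists>r>0. \<not> piece r \<subseteq> point z"
  proof (intro exI conjI)
    have "Poly_Mapping.single v 1 \<in> piece 1" by (rule piece_single[OF v(1)])
    then show "\<not> piece 1 \<subseteq> point z" using v(2) mem_point_piece by (auto simp: poly_eval_single)
  qed simp
  moreover have "\<exists>c. g - const_poly c * f \<in> point z"
    if f: "f \<in> piece r - point z" and g: "g \<in> piece r" for r f g
  proof (intro exI)
    have "poly_eval z f \<noteq> 0" using f mem_point_piece by blast
    then have "poly_eval z (g - const_poly (poly_eval z g / poly_eval z f) * f) = 0"
      by (simp add: poly_eval_diff poly_eval_smult)
    then show "g - const_poly (poly_eval z g / poly_eval z f) * f \<in> point z"
      using f g mem_point_piece piece_diff piece_smult by blast
  qed
  ultimately show ?thesis unfolding proj_points_def by blast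
qed

lemma point_in_basic_open_iff:
  assumes z: "z \<in> semistable" and f: "f \<in> piece r" and g: "g \<in> piece r"
  shows "point z \<in> {\<pp> \<in> proj_points A \<theta>. f \<notin> \<pp> \<and> (\<exists>c\<in>U. g - const_poly c * f \<in> \<pp>)}
    \<longleftrightarrow> poly_eval z f \<noteq> 0 \<and> poly_eval z g / poly_eval z f \<in> U"
proof -
  have "g - const_poly c * f \<in> point z \<longleftrightarrow> poly_eval z g = c * poly_eval z f" for c
    using f g mem_point_piece[OF piece_diff[OF g piece_smult[OF f]]]
    by (simp add: poly_eval_diff poly_eval_smult)
  moreover have "(\<exists>c\<in>U. poly_eval z g = c * poly_eval z f) \<longleftrightarrow> poly_eval z g / poly_eval z f \<in> U"
    if "poly_eval z f \<noteq> 0"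
    using that by (metis nonzero_eq_divide_eq)
  ultimately show ?thesis
    using point_in_proj_points[OF z] mem_point_piece[OF f, of z] by auto
qed

text \<open>The two graded evaluations differ by the substitution of c times the polynomial
  variable, which has the same kernel since c is nonzero.\<close>

lemma point_eqI:
  assumes "c \<noteq> 0" and eq: "\<And>r u. u \<in> M r \<Longrightarrow> mono_eval z' u = c ^ r * mono_eval z u"
  shows "point z' = point z"
proof -
  have "Polynomial.coeff (graded_eval z' f) r = c ^ r * Polynomial.coeff (graded_eval z f) r"
    if "f \<in> carrier R" for f r
    unfolding coeff_graded_eval[OF that] sum_distrib_left
    by (intro sum.cong) (simp_all add: eq[of _ r])
  then have "graded_eval z' f = 0 \<longleftrightarrow> graded_eval z f = 0" if "f \<in> carrier R" for f
    using that assms(1) by (simp add: poly_eq_iff)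
  then show ?thesis by (auto simp: point_def)
qed

text \<open>Pick v of degree 1 that is nonzero at z. The binomial in x^u and x^(rv) that vanishes at
  z lies in the ideal, so it vanishes at z' too; this is the relation with c = z'^v / z^v.\<close>

lemma point_eqD:
  assumes "z \<in> semistable" "point z = point z'"
  shows "\<exists>c. c \<noteq> 0 \<and> (\<forall>r. \<forall>u\<in>M r. mono_eval z' u = c ^ r * mono_eval z u)"
proof -
  obtain v where v: "v \<in> M 1" "mono_eval z v \<noteq> 0" using assms by (auto simp: semistable_def)
  have "Poly_Mapping.single v 1 \<notin> point z"
    using mem_point_piece[OF piece_single[OF v(1)]] v(2) by (simp add: poly_eval_single)
  then have v': "mono_eval z' v \<noteq> 0"
    using mem_point_piece[OF piece_single[OF v(1)], of 1 z'] assms(2) by (simp add: poly_eval_single)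
  show ?thesis
  proof (intro exI[of _ "mono_eval z' v / mono_eval z v"] conjI allI ballI)
    show "mono_eval z' v / mono_eval z v \<noteq> 0" using v v' by simp
    fix r u assume u: "u \<in> M r"
    have rv: "r *s v \<in> M r" using smult_lattice_points[OF v(1), of r] by simp
    define f where "f = Poly_Mapping.single u (mono_eval z v ^ r) - Poly_Mapping.single (r *s v) (mono_eval z u)"
    have f: "f \<in> piece r" unfolding f_def by (intro piece_diff piece_single u rv)
    have "poly_eval z f = 0" by (simp add: f_def poly_eval_diff poly_eval_single mono_eval_smult)
    then have "f \<in> point z'" using mem_point_piece[OF f, of z] assms(2) by simp
    then have "poly_eval z' f = 0" using mem_point_piece[OF f, of z'] by simp
    then show "mono_eval z' u = (mono_eval z' v / mono_eval z v) ^ r * mono_eval z u"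
      using v(2) by (simp add: f_def poly_eval_diff poly_eval_single mono_eval_smult field_simps power_divide)
  qed
qed

end

section \<open>Every complex point of Proj R is the ideal of a vector\<close>

lemma lattice_point_scaled:
  assumes "u \<in> lattice_points A \<theta> r" "r > 0"
  shows "(\<chi> j. real (u $ j) / real r) \<in> degree_polyhedron A \<theta>"
proof -
  have "(\<Sum>j\<in>UNIV. real_of_int (A $ i $ j) * (real (u $ j) / real r)) = real_of_int (\<theta> $ i)" for i
  proof -
    have "(\<Sum>j\<in>UNIV. real_of_int (A $ i $ j) * (real (u $ j) / real r))
        = real_of_int (\<Sum>j\<in>UNIV. A $ i $ j * int (u $ j)) / real r"
      by (simp add: sum_divide_distrib)
    also have "(\<Sum>j\<in>UNIV. A $ i $ j * int (u $ j)) = int r * \<theta> $ i"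
      using assms(1) by (simp add: mem_lattice_points)
    finally show ?thesis using assms(2) by simp
  qed
  then show ?thesis by (simp add: mem_degree_polyhedron)
qed

lemma vsupp_add: "vsupp ((u :: nat^'n) + v) = vsupp u \<union> vsupp v"
  by (auto simp: vsupp_def)

context toric_data begin

lemma homogeneous_ideal_eqI:
  assumes I: "homogeneous_ideal A \<theta> I" "primeideal I R"
    and J: "homogeneous_ideal A \<theta> J" "primeideal J R"
    and eq: "\<And>r f. f \<in> piece r \<Longrightarrow> f \<in> I \<longleftrightarrow> f \<in> J"
  shows "I = J"
proof -
  have sub: "I \<subseteq> J" if I: "homogeneous_ideal A \<theta> I" "primeideal I R" and J: "primeideal J R"
    and eq: "\<And>r f. f \<in> piece r \<Longrightarrow> f \<in> I \<Longrightarrow> f \<in> J" for I J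
  proof
    fix f assume f: "f \<in> I"
    then have "f \<in> carrier R" using I(2) unfolding primeideal_veronese_iff by blast
    then obtain N where N: "f = (\<Sum>r<N. restrict_keys (M r) f)" by (rule homogeneous_expansion)
    have fI: "(\<Sum>r<N. restrict_keys (M r) f) \<in> I" using f N by simp
    have "g r \<in> I" if "\<forall>r. g r \<in> piece r" "sum g {..<N} \<in> I" "r < N" for g r
      using I(1) that unfolding homogeneous_ideal_def by blast
    note * = this
    have "restrict_keys (M r) f \<in> I" if r: "r < N" for r
      by (rule *[of "\<lambda>r. restrict_keys (M r) f", OF _ fI r]) (simp add: restrict_keys_piece)
    then have inJ: "restrict_keys (M r) f \<in> J" if "r < N" for r
      using eq[OF restrict_keys_piece] that by blast
    have sumJ: "sum g S \<in> J" if "finite S" "\<And>i. i \<in> S \<Longrightarrow> g i \<in> J" for g :: "nat \<Rightarrow> 'n cpoly" and S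
      using that J unfolding primeideal_veronese_iff by (induction S) auto
    have "(\<Sum>r<N. restrict_keys (M r) f) \<in> J" by (rule sumJ) (simp_all add: inJ)
    then show "f \<in> J" using N by simp
  qed
  show ?thesis
    by (intro equalityI sub[OF I J(2)] sub[OF J I(2)]) (use eq in blast)+
qed

text \<open>The residue field condition turns \<open>\<pp>\<close> into a character \<open>\<phi>\<close> of the face of the semigroup on
  which the monomials do not lie in \<open>\<pp>\<close>; \<open>\<phi>\<close> is normalised at an integral vertex \<open>v\<close>.\<close>

lemma proj_point_eq_point:
  assumes "\<pp> \<in> proj_points A \<theta>"
  obtains z r u where "u \<in> M r" "r > 0" "vsupp z = vsupp u" "\<pp> = point z"
proof -
  have pr: "primeideal \<pp> R" and hom: "homogeneous_ideal A \<theta> \<pp>"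
    and irr: "\<exists>r>0. \<not> piece r \<subseteq> \<pp>"
    and res: "\<And>r f g. \<lbrakk>f \<in> piece r; f \<notin> \<pp>; g \<in> piece r\<rbrakk> \<Longrightarrow> \<exists>c. g - const_poly c * f \<in> \<pp>"
    using assms unfolding proj_points_def by blast+
  have p0: "0 \<in> \<pp>" and padd: "\<And>a b. \<lbrakk>a \<in> \<pp>; b \<in> \<pp>\<rbrakk> \<Longrightarrow> a + b \<in> \<pp>"
    and pmul: "\<And>a x. \<lbrakk>a \<in> \<pp>; x \<in> carrier R\<rbrakk> \<Longrightarrow> x * a \<in> \<pp>" and p1: "1 \<notin> \<pp>"
    and prime: "\<And>a b. \<lbrakk>a \<in> carrier R; b \<in> carrier R; a * b \<in> \<pp>\<rbrakk> \<Longrightarrow> a \<in> \<pp> \<or> b \<in> \<pp>"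
    using pr unfolding primeideal_veronese_iff by blast+
  have constc: "const_poly c \<in> carrier R" for c using piece_const piece_subset_carrier by blast
  have pconst: "const_poly c * a \<in> \<pp>" if "a \<in> \<pp>" for a c using pmul[OF that constc] .
  have psub: "a - b \<in> \<pp>" if "a \<in> \<pp>" "b \<in> \<pp>" for a b
    using padd[OF that(1) pconst[OF that(2), of "- 1"]] by (simp add: single_uminus)
  have psum: "sum g S \<in> \<pp>" if "\<And>i. i \<in> S \<Longrightarrow> g i \<in> \<pp>" for g and S :: "(nat^'n) set"
    using that by (induction S rule: infinite_finite_induct) (auto simp: p0 padd)
  define X where "X u = Poly_Mapping.single u (1::complex)" for u :: "nat^'n"
  have Xadd: "X (u + v) = X u * X v" for u v by (simp add: X_def mult_single)
  have X0: "X 0 = 1" by (simp add: X_def)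
  have Xs: "Poly_Mapping.single u c = const_poly c * X u" for u c by (simp add: X_def mult_single)
  have Xp: "X u \<in> piece r" if "u \<in> M r" for u r unfolding X_def using piece_single[OF that] .
  have Xc: "X u \<in> carrier R" if "u \<in> M r" for u r using Xp[OF that] piece_subset_carrier by blast
  \<comment> \<open>T is a face of the semigroup: primality closes it under sums, and the ideal
    property closes it under summands.\<close>
  define T where "T = {u. (\<exists>r. u \<in> M r) \<and> X u \<notin> \<pp>}"
  have Tadd: "u + v \<in> T" if uv: "u \<in> T" "v \<in> T" for u v
  proof -
    obtain r s where rs: "u \<in> M r" "v \<in> M s" "X u \<notin> \<pp>" "X v \<notin> \<pp>" using uv by (auto simp: T_def)
    then have "X u * X v \<notin> \<pp>" using prime[OF Xc[OF rs(1)] Xc[OF rs(2)]] by blast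
    then show ?thesis using add_lattice_points[OF rs(1,2)] by (auto simp: T_def Xadd)
  qed
  have Tsub: "u \<in> T" if "u + v \<in> T" "u \<in> M r" "v \<in> M s" for u v r s
  proof -
    have "X v * X u \<notin> \<pp>" using that(1) by (simp add: T_def Xadd mult.commute)
    then have "X u \<notin> \<pp>" using pmul[OF _ Xc[OF that(3)]] by blast
    then show ?thesis using that(2) by (auto simp: T_def)
  qed
  have T0: "0 \<in> T" using zero_lattice_points p1 by (auto simp: T_def X0)
  have Tmul: "k *s u \<in> T" if "u \<in> T" for k u
  proof (induction k)
    case 0
    have "0 *s u = 0" by (simp add: vec_eq_iff)
    then show ?case using T0 by simp
  next
    case (Suc k)
    have "Suc k *s u = u + k *s u" by (simp add: vec_eq_iff)
    then show ?case using Tadd[OF that Suc] by simp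
  qed
  \<comment> \<open>A member u0 of positive degree with the largest support determines T: it
    consists of all exponents supported in \<open>vsupp u0\<close>.\<close>
  define Q where "Q u \<longleftrightarrow> u \<in> T \<and> (\<exists>r>0. u \<in> M r)" for u
  have "\<exists>u. Q u"
  proof -
    obtain r f where f: "r > 0" "f \<in> piece r" "f \<notin> \<pp>" using irr by blast
    have "\<exists>u\<in>Poly_Mapping.keys f. X u \<notin> \<pp>"
    proof (rule ccontr)
      assume "\<not> (\<exists>u\<in>Poly_Mapping.keys f. X u \<notin> \<pp>)"
      then have "(\<Sum>u\<in>Poly_Mapping.keys f. Poly_Mapping.single u (Poly_Mapping.lookup f u)) \<in> \<pp>"
        by (intro psum) (subst Xs, rule pconst, blast)
      then show False using f(3) by (simp add: expansion)
    qed
    then obtain u where u: "u \<in> Poly_Mapping.keys f" "X u \<notin> \<pp>" by blast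
    then have "u \<in> M r" using f(2) unfolding mem_piece by blast
    then show ?thesis using f(1) u(2) unfolding Q_def T_def by blast
  qed
  then obtain u1 where u1: "Q u1" by blast
  have "\<forall>u. Q u \<longrightarrow> card (vsupp u) < Suc CARD('n)" by (auto simp: less_Suc_eq_le intro: card_mono)
  from ex_has_greatest_nat[of Q u1 "\<lambda>u. card (vsupp u)", OF u1 this]
  have "\<exists>u0. Q u0 \<and> (\<forall>u. Q u \<longrightarrow> card (vsupp u) \<le> card (vsupp u0))" .
  then obtain u0 where u0: "Q u0" and u0max: "\<And>u. Q u \<Longrightarrow> card (vsupp u) \<le> card (vsupp u0)"
    by blast
  obtain r0 where r0: "r0 > 0" "u0 \<in> M r0" and u0T: "u0 \<in> T" using u0 unfolding Q_def by blast
  have Tsupp: "vsupp v \<subseteq> vsupp u0" if vT: "v \<in> T" for v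
  proof -
    obtain s where s: "v \<in> M s" using vT unfolding T_def by blast
    have "u0 + v \<in> M (r0 + s)" by (rule add_lattice_points[OF r0(2) s])
    moreover have "r0 + s > 0" using r0(1) by simp
    ultimately have "Q (u0 + v)" using Tadd[OF u0T vT] unfolding Q_def by blast
    then have "card (vsupp (u0 + v)) \<le> card (vsupp u0)" by (rule u0max)
    then have "card (vsupp u0 \<union> vsupp v) \<le> card (vsupp u0)" by (simp only: vsupp_add)
    then have "vsupp u0 = vsupp u0 \<union> vsupp v" by (intro card_seteq) auto
    then show ?thesis by blast
  qed
  have suppT: "v \<in> T" if v: "v \<in> M s" and sub: "vsupp v \<subseteq> vsupp u0" for v s
  proof -
    \<comment> \<open>Large enough for N u0 to dominate v in degree and in every coordinate, so that
      v is a summand of a member of T.\<close>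
    define N where "N = 1 + s + (\<Sum>j\<in>UNIV. v $ j)"
    have le: "v $ j \<le> (N *s u0) $ j" for j
    proof (cases "j \<in> vsupp u0")
      case True
      have "v $ j \<le> (\<Sum>j\<in>UNIV. v $ j)" by (rule member_le_sum) auto
      also have "\<dots> \<le> N" by (simp add: N_def)
      also have "\<dots> \<le> N * u0 $ j" using True by (simp add: vsupp_def)
      finally show ?thesis by simp
    next
      case False
      then have "j \<notin> vsupp v" using sub by blast
      then show ?thesis by (simp add: vsupp_def)
    qed
    have "s \<le> N" by (simp add: N_def)
    also have "N \<le> N * r0" using r0(1) by simp
    finally have "s \<le> N * r0" .
    from diff_lattice_points[OF smult_lattice_points[OF r0(2)] v this le]
    obtain w where w: "w \<in> M (N * r0 - s)" "w = (\<chi> j. (N *s u0) $ j - v $ j)" by blast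
    have "v + w = N *s u0" using le by (simp add: vec_eq_iff w(2))
    then show ?thesis using Tsub[OF _ v w(1)] Tmul[OF u0T] by simp
  qed
  obtain v where v: "v \<in> M 1" "vsupp v \<subseteq> vsupp u0"
  proof -
    have "(\<chi> j. real (u0 $ j) / real r0) \<in> P" by (rule lattice_point_scaled[OF r0(2,1)])
    then obtain v where "v \<in> M 1" "vsupp v \<subseteq> vsupp (\<chi> j. real (u0 $ j) / real r0)"
      by (rule integral_vertex_exists[OF integral])
    moreover have "vsupp (\<chi> j. real (u0 $ j) / real r0) \<subseteq> vsupp u0" by (auto simp: vsupp_def)
    ultimately show ?thesis using that by blast
  qed
  have vT: "v \<in> T" by (rule suppT[OF v])
  have rv: "r *s v \<in> M r" for r using smult_lattice_points[OF v(1), of r] by simp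
  have Xrv: "X (r *s v) \<notin> \<pp>" for r using Tmul[OF vT, of r] by (simp add: T_def)
  have "\<exists>c. X u - const_poly c * X (r *s v) \<in> \<pp>" if "u \<in> M r" for u r
    by (rule res[OF Xp[OF rv] Xrv Xp[OF that]])
  \<comment> \<open>An exponent has only one degree, so the value \<phi> can be chosen as a function
    of u alone.\<close>
  then have "\<forall>u. \<exists>c. \<forall>r. u \<in> M r \<longrightarrow> X u - const_poly c * X (r *s v) \<in> \<pp>"
    using lattice_points_degree_unique by metis
  then obtain \<phi> where \<phi>: "\<And>u r. u \<in> M r \<Longrightarrow> X u - const_poly (\<phi> u) * X (r *s v) \<in> \<pp>" by metis
  have c0: "c = 0" if "const_poly c * X (r *s v) \<in> \<pp>" for c r
  proof (rule ccontr)
    assume "c \<noteq> 0"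
    then have "const_poly (1 / c) * (const_poly c * X (r *s v)) = X (r *s v)"
      by (simp add: mult_single flip: mult.assoc)
    then show False using pconst[OF that, of "1 / c"] Xrv by simp
  qed
  have piece_iff: "f \<in> \<pp> \<longleftrightarrow> (\<Sum>u\<in>Poly_Mapping.keys f. Poly_Mapping.lookup f u * \<phi> u) = 0"
    if f: "f \<in> piece r" for f r
  proof -
    define c where "c = (\<Sum>u\<in>Poly_Mapping.keys f. Poly_Mapping.lookup f u * \<phi> u)"
    have csum: "const_poly c = (\<Sum>u\<in>Poly_Mapping.keys f. const_poly (Poly_Mapping.lookup f u) * const_poly (\<phi> u) :: 'n cpoly)"
      by (rule poly_mapping_eqI) (simp add: c_def lookup_sum mult_single lookup_single when_def)
    have "(\<Sum>u\<in>Poly_Mapping.keys f. const_poly (Poly_Mapping.lookup f u) * (X u - const_poly (\<phi> u) * X (r *s v))) \<in> \<pp>"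
      using f by (intro psum pconst \<phi>) (auto simp: mem_piece)
    also have "(\<Sum>u\<in>Poly_Mapping.keys f. const_poly (Poly_Mapping.lookup f u) * (X u - const_poly (\<phi> u) * X (r *s v)))
        = f - const_poly c * X (r *s v)"
    proof -
      have "f = (\<Sum>u\<in>Poly_Mapping.keys f. const_poly (Poly_Mapping.lookup f u) * X u)"
        unfolding Xs[symmetric] by (rule expansion[symmetric])
      moreover have "const_poly c * X (r *s v) = (\<Sum>u\<in>Poly_Mapping.keys f. const_poly (Poly_Mapping.lookup f u) * (const_poly (\<phi> u) * X (r *s v)))"
        unfolding csum sum_distrib_right mult.assoc ..
      ultimately show ?thesis by (simp only: right_diff_distrib sum_subtractf)
    qed
    finally have d: "f - const_poly c * X (r *s v) \<in> \<pp>" .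
    show ?thesis
    proof
      assume "f \<in> \<pp>"
      then have "const_poly c * X (r *s v) \<in> \<pp>" using psub[OF _ d] by fastforce
      then show "(\<Sum>u\<in>Poly_Mapping.keys f. Poly_Mapping.lookup f u * \<phi> u) = 0"
        using c0 by (simp add: c_def)
    next
      assume "(\<Sum>u\<in>Poly_Mapping.keys f. Poly_Mapping.lookup f u * \<phi> u) = 0"
      then show "f \<in> \<pp>" using d by (simp add: c_def)
    qed
  qed
  have \<phi>nz: "\<phi> u \<noteq> 0 \<longleftrightarrow> u \<in> T" if "u \<in> M r" for u r
  proof -
    have "X u \<in> \<pp> \<longleftrightarrow> \<phi> u = 0" using piece_iff[OF Xp[OF that]] by (simp add: X_def)
    then show ?thesis using that by (auto simp: T_def)
  qed
  have \<phi>mult: "\<phi> (u + w) = \<phi> u * \<phi> w" if u: "u \<in> M r" and w: "w \<in> M s" for u w r s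
  proof -
    have rs: "(r + s) *s v = r *s v + s *s v" by (simp add: vec_eq_iff algebra_simps)
    have 1: "X u * X w - const_poly (\<phi> (u + w)) * (X (r *s v) * X (s *s v)) \<in> \<pp>"
      using \<phi>[OF add_lattice_points[OF u w]] by (simp only: Xadd rs)
    have 2: "X w * (X u - const_poly (\<phi> u) * X (r *s v)) \<in> \<pp>" by (rule pmul[OF \<phi>[OF u] Xc[OF w]])
    have 3: "const_poly (\<phi> u) * (X (r *s v) * (X w - const_poly (\<phi> w) * X (s *s v))) \<in> \<pp>"
      by (rule pconst[OF pmul[OF \<phi>[OF w] Xc[OF rv]]])
    have c: "const_poly (\<phi> (u + w) - \<phi> u * \<phi> w) = const_poly (\<phi> (u + w)) - const_poly (\<phi> u) * (const_poly (\<phi> w) :: 'n cpoly)"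
      by (simp add: mult_single single_diff)
    \<comment> \<open>Compares two reductions of the same monomial modulo the ideal; by
      \<open>c0\<close> the coefficients must agree.\<close>
    have "const_poly (\<phi> (u + w) - \<phi> u * \<phi> w) * X ((r + s) *s v)
        = (X w * (X u - const_poly (\<phi> u) * X (r *s v))
           + const_poly (\<phi> u) * (X (r *s v) * (X w - const_poly (\<phi> w) * X (s *s v))))
          - (X u * X w - const_poly (\<phi> (u + w)) * (X (r *s v) * X (s *s v)))"
      unfolding c rs Xadd by (simp only: algebra_simps)
    also have "\<dots> \<in> \<pp>" by (rule psub[OF padd[OF 2 3] 1])
    finally show ?thesis using c0 by fastforce
  qed
  have \<phi>0: "\<phi> 0 = 1"
  proof -
    have "\<phi> 0 = \<phi> 0 * \<phi> 0" using \<phi>mult[OF zero_lattice_points zero_lattice_points] by simp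
    moreover have "\<phi> 0 \<noteq> 0" using \<phi>nz[OF zero_lattice_points] T0 by simp
    ultimately show ?thesis by simp
  qed
  have TM: "\<exists>r. u \<in> M r" if "u \<in> T" for u using that by (auto simp: T_def)
  have \<phi>T: "\<phi> u \<noteq> 0" if "u \<in> T" for u using TM[OF that] \<phi>nz that by blast
  have \<phi>TT: "\<phi> (u + w) = \<phi> u * \<phi> w" if "u \<in> T" "w \<in> T" for u w
    using TM[OF that(1)] TM[OF that(2)] \<phi>mult by blast
  \<comment> \<open>Graph of the extension of \<phi> to the group generated by T. Passing to
    quotients is possible since \<phi> has no zero on T.\<close>
  define G where "G = {((\<chi> j. int (u $ j) - int (w $ j)) :: int^'n, \<phi> u / \<phi> w) | u w. u \<in> T \<and> w \<in> T}"
  obtain t where t: "\<And>j. t $ j \<noteq> 0" "\<And>a x. (a, x) \<in> G \<Longrightarrow> x = laurent_eval t a"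
  proof (rule character_extension[of G])
    show "(0, 1) \<in> G"
    proof -
      have "(0, 1) = ((\<chi> j. int ((0 :: nat^'n) $ j) - int ((0 :: nat^'n) $ j)) :: int^'n, \<phi> 0 / \<phi> 0)"
        by (simp add: vec_eq_iff \<phi>0)
      then show ?thesis unfolding G_def using T0 by blast
    qed
    show "(a - b, x / y) \<in> G" if ax: "(a, x) \<in> G" and bY: "(b, y) \<in> G" for a b x y
    proof -
      obtain u w where uw: "u \<in> T" "w \<in> T" "a = (\<chi> j. int (u $ j) - int (w $ j))" "x = \<phi> u / \<phi> w"
        using ax unfolding G_def by blast
      obtain u' w' where uw': "u' \<in> T" "w' \<in> T" "b = (\<chi> j. int (u' $ j) - int (w' $ j))" "y = \<phi> u' / \<phi> w'"
        using bY unfolding G_def by blast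
      have "a - b = (\<chi> j. int ((u + w') $ j) - int ((w + u') $ j))" by (simp add: uw(3) uw'(3) vec_eq_iff)
      moreover have "x / y = \<phi> (u + w') / \<phi> (w + u')"
        by (simp add: uw(4) uw'(4) \<phi>TT[OF uw(1) uw'(2)] \<phi>TT[OF uw(2) uw'(1)])
      ultimately show ?thesis unfolding G_def using Tadd[OF uw(1) uw'(2)] Tadd[OF uw(2) uw'(1)] by blast
    qed
    show "x \<noteq> 0" if "(a, x) \<in> G" for a x
      using that \<phi>T unfolding G_def by auto
    show "x = 1" if z: "(0, x) \<in> G" for x
    proof -
      obtain u w where uw: "u \<in> T" "w \<in> T" "0 = ((\<chi> j. int (u $ j) - int (w $ j)) :: int^'n)" "x = \<phi> u / \<phi> w"
        using z unfolding G_def by blast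
      have "u = w" using uw(3) by (simp add: vec_eq_iff)
      then show ?thesis using uw \<phi>T by simp
    qed
  qed blast
  \<comment> \<open>Zeros off the support of u0 kill exactly the monomials with exponent outside
    T.\<close>
  define z where "z = (\<chi> j. if j \<in> vsupp u0 then t $ j else 0)"
  have zsupp: "vsupp z = vsupp u0" using t(1) by (auto simp: z_def vsupp_def)
  have z\<phi>: "mono_eval z u = \<phi> u" if u: "u \<in> M r" for u r
  proof (cases "vsupp u \<subseteq> vsupp u0")
    case True
    have uT: "u \<in> T" by (rule suppT[OF u True])
    have "((\<chi> j. int (u $ j) - int ((0 :: nat^'n) $ j)) :: int^'n, \<phi> u / \<phi> 0) \<in> G"
      unfolding G_def using uT T0 by blast
    from t(2)[OF this] have "\<phi> u = (\<Prod>j\<in>UNIV. t $ j ^ (u $ j))" by (simp add: \<phi>0 laurent_eval_def)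
    also have "\<dots> = mono_eval z u"
      unfolding mono_eval_def
    proof (rule prod.cong)
      fix j show "t $ j ^ (u $ j) = z $ j ^ (u $ j)"
      proof (cases "j \<in> vsupp u0")
        case False
        then have "j \<notin> vsupp u" using True by blast
        then show ?thesis by (simp add: vsupp_def)
      qed (simp add: z_def)
    qed simp
    finally show ?thesis by simp
  next
    case False
    then have "u \<notin> T" using Tsupp by blast
    then have "\<phi> u = 0" using \<phi>nz[OF u] by blast
    moreover have "mono_eval z u = 0" using False by (simp add: mono_eval_eq_0_iff zsupp)
    ultimately show ?thesis by simp
  qed
  have "z \<in> semistable"
    using v zsupp by (auto simp: semistable_def mono_eval_eq_0_iff intro!: bexI[of _ v])
  then have pz: "point z \<in> proj_points A \<theta>" by (rule point_in_proj_points)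
  have "\<pp> = point z"
  proof (rule homogeneous_ideal_eqI[OF hom pr])
    show "homogeneous_ideal A \<theta> (point z)" "primeideal (point z) R"
      using pz unfolding proj_points_def by blast+
    fix r f assume f: "f \<in> piece r"
    have "poly_eval z f = (\<Sum>u\<in>Poly_Mapping.keys f. Poly_Mapping.lookup f u * \<phi> u)"
      unfolding poly_eval_def using f by (intro sum.cong) (auto simp: mem_piece z\<phi> subset_eq)
    then show "f \<in> \<pp> \<longleftrightarrow> f \<in> point z" using piece_iff[OF f] mem_point_piece[OF f, of z] by simp
  qed
  then show ?thesis using that[OF r0(2,1) zsupp] by blast
qed

end

section \<open>The quotient topology and the deformation\<close>

lemma norm_vnorm [simp]: "norm (vnorm z) = norm z"
  by (simp add: norm_vec_def L2_set_def)

lemma continuous_on_vnorm [continuous_intros]: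
  "continuous_on S f \<Longrightarrow> continuous_on S (\<lambda>x. vnorm (f x))"
  unfolding vnorm_def by (intro continuous_intros)

context toric_data begin

abbreviation "X \<equiv> toric_variety A \<theta>"

definition moment_fibre :: "(complex^'n) set" where
  "moment_fibre = {z. vnorm z \<in> P}"

lemma closed_moment_fibre: "closed moment_fibre"
proof -
  have "continuous_on UNIV (vnorm :: complex^'n \<Rightarrow> _)"
    by (rule continuous_on_vnorm[OF continuous_on_id])
  then have "closed (vnorm -` P)" by (rule closed_vimage[OF closed_degree_polyhedron])
  then show ?thesis by (simp add: moment_fibre_def vimage_def)
qed

lemma moment_fibre_vertex:
  assumes "z \<in> moment_fibre"
  shows "\<exists>v\<in>M 1. mono_eval z v \<noteq> 0"
proof -
  have "vnorm z \<in> P" using assms by (simp add: moment_fibre_def)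
  then obtain v where "v \<in> M 1" "vsupp v \<subseteq> vsupp (vnorm z)"
    by (rule integral_vertex_exists[OF integral])
  then show ?thesis by (intro bexI[of _ v]) (simp_all add: mono_eval_eq_0_iff)
qed

lemma moment_fibre_semistable: "z \<in> moment_fibre \<Longrightarrow> z \<in> semistable"
  using moment_fibre_vertex by (simp add: semistable_def)

lemma moment_fibre_representative:
  assumes "u \<in> M r" "r > 0" "vsupp z = vsupp u"
  shows "\<exists>z'\<in>moment_fibre. vsupp z' = vsupp z \<and> point z' = point z"
proof -
  obtain z' c where z': "vnorm z' \<in> P" "vsupp z' = vsupp z" "c > (0::real)"
    and eq: "\<forall>s. \<forall>m\<in>M s. mono_eval z' m = of_real (c ^ s) * mono_eval z m"
    using moment_exists[OF assms] by blast
  have "point z' = point z"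
  proof (rule point_eqI)
    show "complex_of_real c \<noteq> 0" using z'(3) by simp
    show "mono_eval z' m = complex_of_real c ^ s * mono_eval z m" if "m \<in> M s" for s m
      using eq that by simp
  qed
  then show ?thesis using z' by (intro bexI[of _ z']) (simp_all add: moment_fibre_def)
qed

lemma moment_fibre_surj: "point ` moment_fibre = proj_points A \<theta>"
proof (intro equalityI subsetI)
  fix \<pp> assume "\<pp> \<in> point ` moment_fibre"
  then show "\<pp> \<in> proj_points A \<theta>"
    using point_in_proj_points[OF moment_fibre_semistable] by auto
next
  fix \<pp> assume "\<pp> \<in> proj_points A \<theta>"
  then obtain z r u where "u \<in> M r" "r > 0" "vsupp z = vsupp u" "\<pp> = point z"
    by (rule proj_point_eq_point)
  then show "\<pp> \<in> point ` moment_fibre" using moment_fibre_representative[of u r z] by auto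
qed

text \<open>This makes the moduli, and hence the moment map, functions on the toric variety.\<close>

lemma point_eq_imp_vnorm_eq:
  assumes z: "z \<in> moment_fibre" and z': "z' \<in> moment_fibre" and eq: "point z = point z'"
  shows "vnorm z = vnorm z'"
proof -
  obtain c where "c \<noteq> 0 \<and> (\<forall>r. \<forall>u\<in>M r. mono_eval z' u = c ^ r * mono_eval z u)"
    using point_eqD[OF moment_fibre_semistable[OF z] eq] ..
  then have c: "c \<noteq> 0" "\<And>r u. u \<in> M r \<Longrightarrow> mono_eval z' u = c ^ r * mono_eval z u" by simp_all
  show ?thesis
  proof (rule moment_unique)
    show "vnorm z \<in> P" "vnorm z' \<in> P" using z z' by (auto simp: moment_fibre_def)
    show "norm c > 0" using c(1) by simp
    fix r u assume "u \<in> M r"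
    from c(2)[OF this] show "mono_eval (vnorm z') u = norm c ^ r * mono_eval (vnorm z) u"
      by (simp flip: norm_mono_eval add: norm_mult norm_power)
  qed
qed

lemma openin_basic:
  assumes "r > 0" "f \<in> piece r" "g \<in> piece r" "open U"
  shows "openin X {\<pp> \<in> proj_points A \<theta>. f \<notin> \<pp> \<and> (\<exists>c\<in>U. g - const_poly c * f \<in> \<pp>)}"
  unfolding toric_variety_def by (rule topology_generated_by_Basis) (use assms in blast)

lemma topspace_toric_variety: "topspace X = proj_points A \<theta>"
proof (intro equalityI subsetI)
  fix \<pp> assume "\<pp> \<in> topspace X"
  then show "\<pp> \<in> proj_points A \<theta>"
    unfolding toric_variety_def topology_generated_by_topspace by blast
next
  fix \<pp> assume p: "\<pp> \<in> proj_points A \<theta>"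
  then obtain r f where f: "r > 0" "f \<in> piece r" "f \<notin> \<pp>" unfolding proj_points_def by blast
  have "\<exists>c. f - const_poly c * f \<in> \<pp>" using p f unfolding proj_points_def by blast
  then have "\<pp> \<in> {\<pp> \<in> proj_points A \<theta>. f \<notin> \<pp> \<and> (\<exists>c\<in>UNIV. f - const_poly c * f \<in> \<pp>)}"
    using p f(3) by simp
  then show "\<pp> \<in> topspace X"
    using openin_subset[OF openin_basic[OF f(1,2,2) open_UNIV]] by blast
qed

lemma continuous_on_poly_eval [continuous_intros]: "continuous_on S (\<lambda>z. poly_eval z f)"
  unfolding poly_eval_def by (intro continuous_intros)

lemma continuous_map_point: "continuous_map (top_of_set moment_fibre) X point"
proof -
  have pre: "openin (top_of_set moment_fibre)
      (point -` {\<pp> \<in> proj_points A \<theta>. f \<notin> \<pp> \<and> (\<exists>c\<in>U. g - const_poly c * f \<in> \<pp>)} \<inter> moment_fibre)"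
    if fg: "f \<in> piece r" "g \<in> piece r" and U: "open U" for r f g and U :: "complex set"
  proof -
    let ?D = "{z. poly_eval z f \<noteq> 0}"
    have "open ?D" by (intro open_Collect_neq continuous_intros)
    moreover have "continuous_on ?D (\<lambda>z. poly_eval z g / poly_eval z f)"
      by (intro continuous_intros) auto
    ultimately have "open (?D \<inter> (\<lambda>z. poly_eval z g / poly_eval z f) -` U)"
      using U by (intro continuous_open_preimage)
    moreover have "point -` {\<pp> \<in> proj_points A \<theta>. f \<notin> \<pp> \<and> (\<exists>c\<in>U. g - const_poly c * f \<in> \<pp>)} \<inter> moment_fibre
        = moment_fibre \<inter> (?D \<inter> (\<lambda>z. poly_eval z g / poly_eval z f) -` U)"
    proof (rule Set.set_eqI)
      fix z
      show "z \<in> point -` {\<pp> \<in> proj_points A \<theta>. f \<notin> \<pp> \<and> (\<exists>c\<in>U. g - const_poly c * f \<in> \<pp>)} \<inter> moment_fibre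
        \<longleftrightarrow> z \<in> moment_fibre \<inter> (?D \<inter> (\<lambda>z. poly_eval z g / poly_eval z f) -` U)"
      proof (cases "z \<in> moment_fibre")
        case True
        from point_in_basic_open_iff[OF moment_fibre_semistable[OF this] fg, of U] show ?thesis using True by simp
      qed simp
    qed
    ultimately show ?thesis by (auto simp: openin_open)
  qed
  have "point ` moment_fibre \<subseteq> topspace X" using moment_fibre_surj topspace_toric_variety by simp
  then show ?thesis
    unfolding toric_variety_def continuous_on_generated_topo_iff topology_generated_by_topspace
    by (auto intro!: pre)
qed

section \<open>Properness of the quotient map\<close>

lemma openin_ratio_chart:
  assumes v: "v \<in> M 1" and u: "u \<in> M s" and U: "open U"
  shows "\<exists>W. openin X W \<and> (\<forall>z\<in>moment_fibre.
    point z \<in> W \<longleftrightarrow> mono_eval z v \<noteq> 0 \<and> mono_eval z u / mono_eval z v ^ s \<in> U)"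
proof -
  \<comment> \<open>Numerator and denominator carry one extra factor x^v, so that their degree is
    positive even for s = 0.\<close>
  define f where "f = Poly_Mapping.single (Suc s *s v) (1::complex)"
  define g where "g = Poly_Mapping.single (u + v) (1::complex)"
  have f: "f \<in> piece (Suc s)"
    unfolding f_def using piece_single[OF smult_lattice_points[OF v, of "Suc s"]] by simp
  have g: "g \<in> piece (Suc s)"
    unfolding g_def using piece_single[OF add_lattice_points[OF u v]] by simp
  define W where "W = {\<pp> \<in> proj_points A \<theta>. f \<notin> \<pp> \<and> (\<exists>c\<in>U. g - const_poly c * f \<in> \<pp>)}"
  have "openin X W" unfolding W_def by (rule openin_basic[OF zero_less_Suc f g U])
  moreover have "point z \<in> W \<longleftrightarrow> mono_eval z v \<noteq> 0 \<and> mono_eval z u / mono_eval z v ^ s \<in> U"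
    if "z \<in> moment_fibre" for z
  proof -
    have z: "z \<in> semistable" using that by (rule moment_fibre_semistable)
    have e: "poly_eval z f = mono_eval z v ^ Suc s" "poly_eval z g = mono_eval z u * mono_eval z v"
      by (simp_all only: f_def g_def poly_eval_single mono_eval_smult mono_eval_add mult_1_left)
    have "mono_eval z u * mono_eval z v / mono_eval z v ^ Suc s = mono_eval z u / mono_eval z v ^ s"
      if "mono_eval z v \<noteq> 0" using that by simp
    then show ?thesis unfolding W_def point_in_basic_open_iff[OF z f g] e by auto
  qed
  ultimately show ?thesis by (intro exI[of _ W]) simp
qed

text \<open>Properness: bounds on finitely many ratios \<open>z\<^sup>u / z\<^bsup>s v\<^esup>\<close>, for generators \<open>u\<close> of the semigroup,
  confine \<open>z\<close> to a compact set.\<close>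

lemma moment_fibre_bounded:
  assumes B: "finite B" "\<And>r u. (r, u) \<in> B \<Longrightarrow> u \<in> M r"
    and gen: "\<And>r u. u \<in> M r \<Longrightarrow> generated_by B r u"
    and L: "L \<ge> 0"
  shows "\<exists>K. \<forall>z\<in>moment_fibre. mono_eval z v \<noteq> 0 \<longrightarrow>
      (\<forall>s u. (s, u) \<in> B \<longrightarrow> norm (mono_eval z u) \<le> exp L * norm (mono_eval z v) ^ s) \<longrightarrow> norm z \<le> K"
proof (rule moment_bounded[OF L])
  fix K assume K: "\<And>p. \<lbrakk>p \<in> P; vsupp v \<subseteq> vsupp p;
      \<And>q m. m \<in> M q \<Longrightarrow>
        mono_eval p m \<le> exp (L * (real (\<Sum>j\<in>UNIV. m $ j) + real q)) * mono_eval p v ^ q\<rbrakk>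
    \<Longrightarrow> norm p \<le> K"
  show ?thesis
  proof (intro exI[of _ K] ballI impI)
    fix z assume z: "z \<in> moment_fibre" "mono_eval z v \<noteq> 0"
      and "\<forall>s u. (s, u) \<in> B \<longrightarrow> norm (mono_eval z u) \<le> exp L * norm (mono_eval z v) ^ s"
    then have le: "norm (mono_eval z u) \<le> exp L * norm (mono_eval z v) ^ s" if "(s, u) \<in> B" for s u
      using that by simp
    define a where "a = norm (mono_eval z v)"
    have "norm (vnorm z) \<le> K"
    proof (rule K)
      show "vnorm z \<in> P" using z(1) by (simp add: moment_fibre_def)
      show "vsupp v \<subseteq> vsupp (vnorm z)" using z(2) by (simp add: mono_eval_eq_0_iff)
      fix q m assume m: "m \<in> M q"
      have "norm (mono_eval z m) \<le> exp (L * (real (\<Sum>j\<in>UNIV. m $ j) + real q)) * a ^ q"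
        using gen[OF m]
      proof induction
        case (add s u t w)
        note su = add.hyps(1,2) and IH = add.IH
        \<comment> \<open>A generator other than (0, 0) has size at least 1, so its factor exp L is
          covered by the exponential of L times its size.\<close>
        have "s + (\<Sum>j\<in>UNIV. u $ j) \<noteq> 0" using su(2) by (auto simp: vec_eq_iff)
        then have "1 \<le> real (\<Sum>j\<in>UNIV. u $ j) + real s" by linarith
        then have "L * 1 \<le> L * (real (\<Sum>j\<in>UNIV. u $ j) + real s)" using L by (rule mult_left_mono)
        then have "exp L \<le> exp (L * (real (\<Sum>j\<in>UNIV. u $ j) + real s))" by simp
        then have "exp L * a ^ s \<le> exp (L * (real (\<Sum>j\<in>UNIV. u $ j) + real s)) * a ^ s"
          by (intro mult_right_mono) (auto simp: a_def)
        then have "norm (mono_eval z u) \<le> exp (L * (real (\<Sum>j\<in>UNIV. u $ j) + real s)) * a ^ s"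
          using le[OF su(1)] by (simp add: a_def)
        then have "norm (mono_eval z u) * norm (mono_eval z w)
            \<le> (exp (L * (real (\<Sum>j\<in>UNIV. u $ j) + real s)) * a ^ s) * (exp (L * (real (\<Sum>j\<in>UNIV. w $ j) + real t)) * a ^ t)"
          using IH by (intro mult_mono) (auto simp: a_def)
        also have "\<dots> = exp (L * (real (\<Sum>j\<in>UNIV. (u + w) $ j) + real (s + t))) * a ^ (s + t)"
          by (simp add: power_add sum.distrib algebra_simps exp_add)
        finally show "norm (mono_eval z (u + w)) \<le> exp (L * (real (\<Sum>j\<in>UNIV. (u + w) $ j) + real (s + t))) * a ^ (s + t)"
          by (simp only: mono_eval_add norm_mult)
      qed simp
      then show "mono_eval (vnorm z) m \<le> exp (L * (real (\<Sum>j\<in>UNIV. m $ j) + real q)) * mono_eval (vnorm z) v ^ q"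
        by (simp only: norm_mono_eval[symmetric] a_def)
    qed
    then show "norm z \<le> K" by simp
  qed
qed

text \<open>If all neighbourhoods of \<open>point z0\<close> given by finitely many ratios met the
  image of F, the bound on the moment fibre would make suitable preimages converge to some l in F.
  Passing the ratios to the limit gives \<open>point l = point z0\<close>.\<close>

lemma closed_map_point: "closed_map (top_of_set moment_fibre) X point"
  unfolding closed_map_def
proof (intro allI impI)
  fix F assume "closedin (top_of_set moment_fibre) F"
  then have F: "closed F" "F \<subseteq> moment_fibre"
    using closedin_closed_trans[OF _ closed_moment_fibre] closedin_subset[of "top_of_set moment_fibre" F]
    by simp_all
  obtain B where B: "finite B" "\<And>r u. (r, u) \<in> B \<Longrightarrow> u \<in> M r"
    and gen: "\<And>r u. u \<in> M r \<Longrightarrow> generated_by B r u"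
    using lattice_points_finitely_generated[of A \<theta>] by blast
  have "\<exists>W. openin X W \<and> \<pp> \<in> W \<and> W \<subseteq> topspace X - point ` F"
    if pp: "\<pp> \<in> topspace X - point ` F" for \<pp>
  proof -
    obtain z0 where z0: "z0 \<in> moment_fibre" "\<pp> = point z0"
      using pp moment_fibre_surj topspace_toric_variety by blast
    obtain v where v: "v \<in> M 1" "mono_eval z0 v \<noteq> 0" using moment_fibre_vertex[OF z0(1)] ..
    define \<rho> where "\<rho> z b = mono_eval z (snd b) / mono_eval z v ^ fst b" for z :: "complex^'n" and b :: "nat \<times> (nat^'n)"
    define chart where "chart k b W \<longleftrightarrow> openin X W \<and> (\<forall>z\<in>moment_fibre. point z \<in> W \<longleftrightarrow>
        mono_eval z v \<noteq> 0 \<and> \<rho> z b \<in> ball (\<rho> z0 b) (inverse (real (Suc k))))" for k b W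
    define W where "W k b = (SOME W. chart k b W)" for k b
    have "chart k b (W k b)" if "b \<in> B" for k b
    proof -
      have "snd b \<in> M (fst b)" using B(2)[of "fst b" "snd b"] that by simp
      from openin_ratio_chart[OF v(1) this open_ball[of "\<rho> z0 b" "inverse (real (Suc k))"]]
      have "\<exists>W. chart k b W" unfolding chart_def \<rho>_def .
      then show ?thesis unfolding W_def by (rule someI_ex)
    qed
    then have W1: "openin X (W k b)" and W2: "\<And>z. z \<in> moment_fibre \<Longrightarrow> point z \<in> W k b \<longleftrightarrow>
        mono_eval z v \<noteq> 0 \<and> \<rho> z b \<in> ball (\<rho> z0 b) (inverse (real (Suc k)))"
      if "b \<in> B" for k b
      using that by (simp_all add: chart_def)
    \<comment> \<open>The chart where x^v is nonzero; it secures this condition on the intersection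
      and keeps the intersected family nonempty for every B.\<close>
    obtain W0 where W0: "openin X W0 \<and> (\<forall>z\<in>moment_fibre.
        point z \<in> W0 \<longleftrightarrow> mono_eval z v \<noteq> 0 \<and> mono_eval z v / mono_eval z v ^ 1 \<in> UNIV)"
      using openin_ratio_chart[OF v(1) v(1) open_UNIV] ..
    define N where "N k = \<Inter> (insert W0 (W k ` B))" for k
    have N: "openin X (N k)" for k unfolding N_def using B(1) W1 W0 by (intro openin_Inter) auto
    have ppN: "\<pp> \<in> N k" for k
    proof -
      have "point z0 \<in> W0" using W0 z0(1) v(2) by simp
      moreover have "point z0 \<in> W k b" if "b \<in> B" for b using W2[OF that z0(1)] v(2) by simp
      ultimately show ?thesis unfolding N_def z0(2) by blast
    qed
    have "\<exists>k. N k \<inter> point ` F = {}"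
    proof (rule ccontr)
      assume "\<nexists>k. N k \<inter> point ` F = {}"
      then have "\<forall>k. \<exists>z. z \<in> F \<and> point z \<in> N k" by blast
      from choice[OF this] obtain z where z: "\<And>k. z k \<in> F" "\<And>k. point (z k) \<in> N k" by blast
      have zZ: "z k \<in> moment_fibre" for k using z(1) F(2) by blast
      have znz: "mono_eval (z k) v \<noteq> 0" for k
      proof -
        have "point (z k) \<in> W0" using z(2)[of k] unfolding N_def by blast
        then show ?thesis using W0 zZ[of k] by simp
      qed
      have zr: "dist (\<rho> z0 b) (\<rho> (z k) b) < inverse (real (Suc k))" if "b \<in> B" for k b
              proof -
        have "point (z k) \<in> W k b" using z(2)[of k] that unfolding N_def by blast
        then show ?thesis using W2[OF that zZ[of k], of k] by simp
      qed
      \<comment> \<open>Ratios at z_k differ from those at z0 by less than 1, so all are at most L,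
        hence at most exp L.\<close>
      define L where "L = (\<Sum>b\<in>B. norm (\<rho> z0 b) + 1)"
      have L: "L \<ge> 0" by (simp add: L_def sum_nonneg)
      obtain K where K: "\<forall>z\<in>moment_fibre. mono_eval z v \<noteq> 0 \<longrightarrow>
          (\<forall>s u. (s, u) \<in> B \<longrightarrow> norm (mono_eval z u) \<le> exp L * norm (mono_eval z v) ^ s) \<longrightarrow> norm z \<le> K"
        using moment_fibre_bounded[OF B gen L, of v] ..
      have "norm (z k) \<le> K" for k
      proof (rule K[rule_format, OF zZ znz])
        fix s u assume b: "(s, u) \<in> B"
        have "norm (\<rho> (z k) (s, u)) \<le> norm (\<rho> z0 (s, u)) + dist (\<rho> z0 (s, u)) (\<rho> (z k) (s, u))"
          using norm_triangle_sub[of "\<rho> (z k) (s, u)" "\<rho> z0 (s, u)"]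
          by (simp add: dist_norm norm_minus_commute)
        also have "\<dots> \<le> norm (\<rho> z0 (s, u)) + 1"
        proof -
          have "inverse (real (Suc k)) \<le> 1" by (simp add: inverse_le_1_iff)
          then show ?thesis using zr[OF b, of k] by linarith
        qed
        also have "\<dots> \<le> L" unfolding L_def by (rule member_le_sum[OF b]) (use B(1) in auto)
        also have "\<dots> \<le> exp L" using exp_ge_add_one_self[of L] by linarith
        finally have "norm (mono_eval (z k) u) / norm (mono_eval (z k) v) ^ s \<le> exp L"
          by (simp add: \<rho>_def norm_divide norm_power)
        then show "norm (mono_eval (z k) u) \<le> exp L * norm (mono_eval (z k) v) ^ s"
          using znz[of k] by (simp add: divide_le_eq)
      qed
      then have "bounded (range z)" by (auto simp: bounded_iff)
      then obtain l \<sigma> where \<sigma>: "strict_mono \<sigma>" and l: "(z \<circ> \<sigma>) \<longlonglongrightarrow> l"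
        using bounded_imp_convergent_subsequence by blast
      have lF: "l \<in> F" using closed_sequentially[OF F(1) _ l] z(1) by simp
      then have lZ: "l \<in> moment_fibre" using F(2) by blast
      have lim: "(\<lambda>k. mono_eval (z (\<sigma> k)) u) \<longlonglongrightarrow> mono_eval l u" for u
        unfolding mono_eval_def using l by (intro tendsto_intros) (simp add: o_def)
      have invlim: "(\<lambda>k. inverse (real (Suc (\<sigma> k)))) \<longlonglongrightarrow> 0"
        using LIMSEQ_subseq_LIMSEQ[OF LIMSEQ_inverse_real_of_nat \<sigma>] by (simp add: o_def)
      \<comment> \<open>Stated without division, because x^v might vanish at the limit l.\<close>
      have rel: "mono_eval l u = \<rho> z0 (s, u) * mono_eval l v ^ s" if b: "(s, u) \<in> B" for s u
      proof -
        have "norm (mono_eval l u - \<rho> z0 (s, u) * mono_eval l v ^ s) \<le> 0 * norm (mono_eval l v) ^ s"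
        proof (rule LIMSEQ_le)
          show "(\<lambda>k. norm (mono_eval (z (\<sigma> k)) u - \<rho> z0 (s, u) * mono_eval (z (\<sigma> k)) v ^ s))
              \<longlonglongrightarrow> norm (mono_eval l u - \<rho> z0 (s, u) * mono_eval l v ^ s)"
            by (intro tendsto_intros lim)
          show "(\<lambda>k. inverse (real (Suc (\<sigma> k))) * norm (mono_eval (z (\<sigma> k)) v) ^ s) \<longlonglongrightarrow> 0 * norm (mono_eval l v) ^ s"
            by (intro tendsto_intros lim invlim)
          have "norm (mono_eval (z k) u - \<rho> z0 (s, u) * mono_eval (z k) v ^ s)
              \<le> inverse (real (Suc k)) * norm (mono_eval (z k) v) ^ s" for k
          proof -
            have "mono_eval (z k) u - \<rho> z0 (s, u) * mono_eval (z k) v ^ s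
                = (\<rho> (z k) (s, u) - \<rho> z0 (s, u)) * mono_eval (z k) v ^ s"
              using znz[of k] by (simp add: \<rho>_def left_diff_distrib)
            then have "norm (mono_eval (z k) u - \<rho> z0 (s, u) * mono_eval (z k) v ^ s)
                = dist (\<rho> z0 (s, u)) (\<rho> (z k) (s, u)) * norm (mono_eval (z k) v) ^ s"
              by (simp add: norm_mult norm_power dist_norm norm_minus_commute)
            also have "\<dots> \<le> inverse (real (Suc k)) * norm (mono_eval (z k) v) ^ s"
              using zr[OF b, of k] by (intro mult_right_mono) auto
            finally show ?thesis .
          qed
          then show "\<exists>N. \<forall>k\<ge>N. norm (mono_eval (z (\<sigma> k)) u - \<rho> z0 (s, u) * mono_eval (z (\<sigma> k)) v ^ s)
              \<le> inverse (real (Suc (\<sigma> k))) * norm (mono_eval (z (\<sigma> k)) v) ^ s" by blast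
        qed
        then show ?thesis by simp
      qed
      define c where "c = mono_eval l v / mono_eval z0 v"
      have all: "mono_eval l u = c ^ r * mono_eval z0 u" if u: "u \<in> M r" for u r
        using gen[OF u]
      proof induction
        case (add s u t w)
        note su = add.hyps(1) and IH = add.IH
        have "mono_eval l u = c ^ s * mono_eval z0 u"
          using rel[OF su] v(2) by (simp add: \<rho>_def c_def power_divide)
        then show "mono_eval l (u + w) = c ^ (s + t) * mono_eval z0 (u + w)"
          using IH by (simp add: mono_eval_add power_add)
      qed simp
      \<comment> \<open>As a point of the moment fibre l has a nonvanishing monomial of degree 1,
        and that value is a multiple of c.\<close>
      have "c \<noteq> 0"
      proof
        assume "c = 0"
        obtain w where "w \<in> M 1" "mono_eval l w \<noteq> 0" using moment_fibre_vertex[OF lZ] ..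
        then show False using all[of w 1] \<open>c = 0\<close> by simp
      qed
      then have "point l = point z0" using all by (rule point_eqI)
      then show False using pp lF z0(2) by (metis DiffD2 imageI)
    qed
    then obtain k where "N k \<inter> point ` F = {}" by blast
    then show ?thesis using N[of k] ppN[of k] openin_subset[OF N[of k]] by blast
  qed
  then have "openin X (topspace X - point ` F)" by (subst openin_subopen) simp
  moreover have "point ` F \<subseteq> topspace X"
    using F(2) moment_fibre_surj topspace_toric_variety by blast
  ultimately show "closedin X (point ` F)" by (simp add: closedin_def)
qed

text \<open>Closedness of the map makes points of X closed, so fibres are closed; they are bounded
  since the moduli are constant on them.\<close>

lemma proper_map_point: "proper_map (top_of_set moment_fibre) X point"
  unfolding proper_map_def
proof (intro conjI ballI closed_map_point)
  fix y assume "y \<in> topspace X"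
  then obtain z0 where z0: "z0 \<in> moment_fibre" "y = point z0"
    using moment_fibre_surj topspace_toric_variety by blast
  let ?S = "{z \<in> topspace (top_of_set moment_fibre). point z = y}"
  have "closedin (top_of_set moment_fibre) {z0}" using z0(1) by (simp add: closed_subset)
  then have "closedin X (point ` {z0})" using closed_map_point unfolding closed_map_def by blast
  then have "closedin X {y}" using z0(2) by simp
  then have "closedin (top_of_set moment_fibre) {z \<in> topspace (top_of_set moment_fibre). point z \<in> {y}}"
    by (rule closedin_continuous_map_preimage[OF continuous_map_point])
  then have "closed ?S" using closedin_closed_trans[OF _ closed_moment_fibre] by simp
  moreover have "norm z = norm z0" if "z \<in> ?S" for z
  proof -
    have "vnorm z = vnorm z0" using point_eq_imp_vnorm_eq[of z z0] that z0 by simp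
    then have "norm (vnorm z) = norm (vnorm z0)" by simp
    then show ?thesis by simp
  qed
  then have "bounded ?S" unfolding bounded_iff by (intro exI[of _ "norm z0"]) simp
  ultimately have "compact ?S" by (simp add: compact_eq_bounded_closed)
  then show "compactin (top_of_set moment_fibre) ?S"
    by (auto simp: compactin_subtopology)
qed

section \<open>Deforming the moduli with fixed phases\<close>

definition retract_lift :: "complex^'n \<Rightarrow> complex^'n" where
  "retract_lift z = (\<chi> j. sgn (z $ j) * of_real (retract_point A \<theta> (vnorm z) $ j))"

definition deform :: "real \<Rightarrow> complex^'n \<Rightarrow> complex^'n" where
  "deform s z = (1 - s) *\<^sub>R z + s *\<^sub>R retract_lift z"

definition deform_moment :: "real \<Rightarrow> real^'n \<Rightarrow> real^'n" where
  "deform_moment s p = (1 - s) *\<^sub>R p + s *\<^sub>R retract_point A \<theta> p"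

lemma retract_point_bounds:
  assumes "p \<in> P" shows "0 \<le> retract_point A \<theta> p $ j" "retract_point A \<theta> p $ j \<le> p $ j"
  using retract_point_in_box[OF assms] by (auto simp: lower_box_def mem_degree_polyhedron)

text \<open>Both ends of the segment have the phases of z, so only moduli move. Since
  \<open>sgn 0 = 0\<close>, zero coordinates stay zero.\<close>

lemma deform_nth: "deform s z $ j = sgn (z $ j) * of_real (deform_moment s (vnorm z) $ j)"
proof -
  have e: "sgn (z $ j) * of_real (norm (z $ j)) = z $ j" by (simp add: sgn_eq)
  have "deform s z $ j = (1 - s) *\<^sub>R (sgn (z $ j) * of_real (norm (z $ j)))
      + s *\<^sub>R (sgn (z $ j) * of_real (retract_point A \<theta> (vnorm z) $ j))"
    unfolding e by (simp add: deform_def retract_lift_def)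
  also have "\<dots> = sgn (z $ j) * of_real (deform_moment s (vnorm z) $ j)"
    by (simp add: deform_moment_def scaleR_conv_of_real[where 'a = complex] algebra_simps)
  finally show ?thesis .
qed

lemma deform_moment_bounds:
  assumes "p \<in> P" "0 \<le> s" "s \<le> 1"
  shows "0 \<le> deform_moment s p $ j" "p $ j = 0 \<Longrightarrow> deform_moment s p $ j = 0"
  using retract_point_bounds[OF assms(1), of j] nonneg_degree_polyhedron[OF assms(1), of j] assms(2,3)
  by (auto simp: deform_moment_def)

lemma deform_moment_in: "\<lbrakk>p \<in> P; 0 \<le> s; s \<le> 1\<rbrakk> \<Longrightarrow> deform_moment s p \<in> P"
  unfolding deform_moment_def
  using convexD_alt[OF convex_degree_polyhedron, of p A \<theta> "retract_point A \<theta> p" s]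
    retract_point_in_box[of p A \<theta>] by (auto simp: lower_box_def)

lemma vnorm_deform:
  assumes "z \<in> moment_fibre" "0 \<le> s" "s \<le> 1"
  shows "vnorm (deform s z) = deform_moment s (vnorm z)"
proof -
  have p: "vnorm z \<in> P" using assms by (simp add: moment_fibre_def)
  have "norm (deform s z $ j) = deform_moment s (vnorm z) $ j" for j
    using deform_moment_bounds[OF p assms(2,3), of j]
    by (cases "z $ j = 0") (auto simp: deform_nth norm_mult norm_sgn)
  then show ?thesis by (simp add: vec_eq_iff)
qed

lemma deform_in: "\<lbrakk>z \<in> moment_fibre; 0 \<le> s; s \<le> 1\<rbrakk> \<Longrightarrow> deform s z \<in> moment_fibre"
  using vnorm_deform deform_moment_in by (simp add: moment_fibre_def)

lemma mono_eval_deform: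
  "mono_eval (deform s z) u = mono_eval (\<chi> j. sgn (z $ j)) u * of_real (mono_eval (deform_moment s (vnorm z)) u)"
  by (simp add: mono_eval_def deform_nth power_mult_distrib prod.distrib)

lemma mono_eval_sgn:
  "mono_eval z u = mono_eval (\<chi> j. sgn (z $ j)) u * of_real (mono_eval (vnorm z) u)"
proof -
  have e: "sgn (z $ j) * of_real (norm (z $ j)) = z $ j" for j by (simp add: sgn_eq)
  have "mono_eval z u = (\<Prod>j\<in>UNIV. (sgn (z $ j) * of_real (norm (z $ j))) ^ (u $ j))"
    unfolding e mono_eval_def ..
  then show ?thesis by (simp add: mono_eval_def power_mult_distrib prod.distrib)
qed

text \<open>The moduli agree, so cancelling them from z'^u = c^r z^u leaves the same relation for
  the phases with the same c. Multiplying by the common deformed moduli restores it; monomials that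
  vanish at z vanish along the deformation.\<close>

lemma point_deform_cong:
  assumes z: "z \<in> moment_fibre" and z': "z' \<in> moment_fibre" and eq: "point z = point z'"
    and s: "0 \<le> s" "s \<le> 1"
  shows "point (deform s z) = point (deform s z')"
proof -
  have p: "vnorm z \<in> P" using z by (simp add: moment_fibre_def)
  obtain c where "c \<noteq> 0 \<and> (\<forall>r. \<forall>u\<in>M r. mono_eval z' u = c ^ r * mono_eval z u)"
    using point_eqD[OF moment_fibre_semistable[OF z] eq] ..
  then have c: "c \<noteq> 0" "\<And>r u. u \<in> M r \<Longrightarrow> mono_eval z' u = c ^ r * mono_eval z u" by simp_all
  have vn: "vnorm z' = vnorm z" using point_eq_imp_vnorm_eq[OF z z' eq] by simp
  have "point (deform s z') = point (deform s z)"
  proof (rule point_eqI[OF c(1)])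
    fix r u assume u: "u \<in> M r"
    show "mono_eval (deform s z') u = c ^ r * mono_eval (deform s z) u"
    proof (cases "vsupp u \<subseteq> vsupp (vnorm z)")
      case True
      then have "mono_eval (vnorm z) u \<noteq> 0" by (simp add: mono_eval_eq_0_iff)
      moreover have "mono_eval (\<chi> j. sgn (z' $ j)) u * of_real (mono_eval (vnorm z) u)
          = (c ^ r * mono_eval (\<chi> j. sgn (z $ j)) u) * of_real (mono_eval (vnorm z) u)"
        using c(2)[OF u] mono_eval_sgn[of z u] mono_eval_sgn[of z' u] vn by (simp add: mult.assoc)
      ultimately have "mono_eval (\<chi> j. sgn (z' $ j)) u = c ^ r * mono_eval (\<chi> j. sgn (z $ j)) u"
        by simp
      then show ?thesis by (simp add: mono_eval_deform vn mult.assoc)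
    next
      case False
      then obtain j where j: "j \<in> vsupp u" "vnorm z $ j = 0" by (auto simp: vsupp_def)
      then have "j \<notin> vsupp (deform_moment s (vnorm z))"
        using deform_moment_bounds(2)[OF p s] by (simp add: vsupp_def)
      then have "mono_eval (deform_moment s (vnorm z)) u = 0" using j(1) by (auto simp: mono_eval_eq_0_iff)
      then show ?thesis by (simp add: mono_eval_deform vn)
    qed
  qed
  then show ?thesis by simp
qed

text \<open>The phase is discontinuous at zero coordinates, but there r(p)_j \<le> p_j = |z_j|
  squeezes the product to 0.\<close>

lemma continuous_on_retract_lift: "continuous_on moment_fibre retract_lift"
  unfolding retract_lift_def
proof (rule continuous_on_vec_lambda)
  fix j
  have r: "continuous_on moment_fibre (\<lambda>z. retract_point A \<theta> (vnorm z) $ j)"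
  proof -
    have "continuous_on moment_fibre (\<lambda>z. retract_point A \<theta> (vnorm z))"
      by (rule continuous_on_compose2[OF continuous_on_retract_point])
         (auto simp: moment_fibre_def intro: continuous_intros)
    then show ?thesis by (intro continuous_intros)
  qed
  show "continuous_on moment_fibre (\<lambda>z. sgn (z $ j) * complex_of_real (retract_point A \<theta> (vnorm z) $ j))"
    unfolding continuous_on_eq_continuous_within
  proof
    fix z assume z: "z \<in> moment_fibre"
    show "continuous (at z within moment_fibre) (\<lambda>z. sgn (z $ j) * complex_of_real (retract_point A \<theta> (vnorm z) $ j))"
    proof (cases "z $ j = 0")
      case False
      have L: "((\<lambda>z. retract_point A \<theta> (vnorm z) $ j) \<longlongrightarrow> retract_point A \<theta> (vnorm z) $ j) (at z within moment_fibre)"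
        using r z by (simp add: continuous_on_def)
      show ?thesis
        unfolding continuous_within
        by (rule tendsto_mult[OF tendsto_sgn[OF tendsto_vec_nth[OF tendsto_ident_at] False] tendsto_of_real[OF L]])
    next
      case True
      have "((\<lambda>z. sgn (z $ j) * complex_of_real (retract_point A \<theta> (vnorm z) $ j)) \<longlongrightarrow> 0) (at z within moment_fibre)"
      proof (rule Lim_null_comparison)
        have "((\<lambda>z. norm (z $ j)) \<longlongrightarrow> norm (z $ j)) (at z within moment_fibre)"
          by (intro tendsto_intros)
        then show "((\<lambda>z. norm (z $ j)) \<longlongrightarrow> 0) (at z within moment_fibre)" using True by simp
        show "\<forall>\<^sub>F z in at z within moment_fibre.
            norm (sgn (z $ j) * complex_of_real (retract_point A \<theta> (vnorm z) $ j)) \<le> norm (z $ j)"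
          unfolding eventually_at_filter
        proof (rule always_eventually, intro allI impI)
          fix z assume "z \<in> moment_fibre"
          then have "vnorm z \<in> P" by (simp add: moment_fibre_def)
          from retract_point_bounds[OF this, of j]
          show "norm (sgn (z $ j) * complex_of_real (retract_point A \<theta> (vnorm z) $ j)) \<le> norm (z $ j)"
            by (simp add: norm_mult norm_sgn)
        qed
      qed
      then show ?thesis using True by (simp add: continuous_within)
    qed
  qed
qed

definition minimal_core :: "'n cpoly set set" where
  "minimal_core = point ` {z \<in> moment_fibre. vnorm z \<in> minimal_points A \<theta>}"

lemma deform_0: "deform 0 z = z" by (simp add: deform_def)

lemma deform_minimal:
  assumes "z \<in> moment_fibre" "vnorm z \<in> minimal_points A \<theta>"
  shows "deform s z = z"
proof -
  have "deform_moment s (vnorm z) = vnorm z"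
    by (simp add: deform_moment_def retract_point_fixes[OF assms(2)] flip: scaleR_left_distrib)
  then show ?thesis by (simp add: vec_eq_iff deform_nth sgn_eq)
qed

proposition deformation_onto_minimal_core:
  obtains r where "homotopic_with (\<lambda>h. h \<in> minimal_core \<rightarrow> minimal_core) X X id r"
    "r ` topspace X \<subseteq> minimal_core"
proof -
  let ?I = "top_of_set {0..1::real}" and ?Z = "top_of_set moment_fibre"
  let ?q = "\<lambda>(s::real, z). (s, point z)"
  \<comment> \<open>Unlike the property of being a quotient map, properness passes to products
    directly; the product is then closed, hence again a quotient map.\<close>
  have "proper_map (prod_topology ?I ?Z) (prod_topology ?I X) (\<lambda>(s, z). (id s, point z))"
    unfolding proper_map_prod using proper_map_id proper_map_point by blast
  then have cl: "closed_map (prod_topology ?I ?Z) (prod_topology ?I X) ?q"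
    unfolding id_apply by (rule proper_imp_closed_map)
  have cont: "continuous_map (prod_topology ?I ?Z) (prod_topology ?I X) ?q"
  proof -
    have "continuous_map (prod_topology ?I ?Z) X (point \<circ> snd)"
      by (rule continuous_map_compose[OF continuous_map_snd continuous_map_point])
    moreover have "fst \<circ> ?q = fst" "snd \<circ> ?q = point \<circ> snd" by (auto simp: fun_eq_iff)
    ultimately show ?thesis
      unfolding continuous_map_pairwise by (simp only: continuous_map_fst simp_thms)
  qed
  have q: "quotient_map (prod_topology ?I ?Z) (prod_topology ?I X) ?q"
  proof (rule continuous_closed_imp_quotient_map[OF cont cl])
    have "?q ` (S \<times> T) = S \<times> point ` T" for S T by (auto simp: image_iff)
    then show "?q ` topspace (prod_topology ?I ?Z) = topspace (prod_topology ?I X)"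
      unfolding topspace_prod_topology topspace_toric_variety by (simp add: moment_fibre_surj)
  qed
  have d: "continuous_map (prod_topology ?I ?Z) X (\<lambda>(s, z). point (deform s z))"
  proof -
    have "continuous_on ({0..1} \<times> moment_fibre) (\<lambda>x. deform (fst x) (snd x))"
      unfolding deform_def
      by (intro continuous_intros continuous_on_compose2[OF continuous_on_retract_lift]) auto
    moreover have "(\<lambda>x. deform (fst x) (snd x)) \<in> {0..1} \<times> moment_fibre \<rightarrow> moment_fibre"
      by (rule Pi_I) (simp add: deform_in mem_Times_iff)
    moreover have "prod_topology ?I ?Z = top_of_set ({0..1} \<times> moment_fibre)" by simp
    ultimately have "continuous_map (prod_topology ?I ?Z) ?Z (\<lambda>x. deform (fst x) (snd x))"
      by simp
    from continuous_map_compose[OF this continuous_map_point]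
    show ?thesis by (simp only: o_def case_prod_unfold)
  qed
  have resp: "(\<lambda>(s, z). point (deform s z)) x = (\<lambda>(s, z). point (deform s z)) y"
    if "x \<in> topspace (prod_topology ?I ?Z)" "y \<in> topspace (prod_topology ?I ?Z)" "?q x = ?q y" for x y
  proof -
    obtain s z where x: "x = (s, z)" by (cases x)
    obtain s' z' where y: "y = (s', z')" by (cases y)
    have "s' = s" "point z = point z'" using that(3) by (simp_all add: x y)
    then show ?thesis using that(1,2) point_deform_cong[of z z' s] by (simp add: x y)
  qed
  have "\<exists>h. continuous_map (prod_topology ?I X) X h \<and>
      (\<forall>x\<in>topspace (prod_topology ?I ?Z). h (?q x) = (\<lambda>(s, z). point (deform s z)) x)"
  proof (rule quotient_map_lift_exists[OF q d])
    show "(\<lambda>(s, z). point (deform s z)) x = (\<lambda>(s, z). point (deform s z)) y"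
      if "x \<in> topspace (prod_topology ?I ?Z)" "y \<in> topspace (prod_topology ?I ?Z)" "?q x = ?q y" for x y
      using that by (rule resp)
  qed blast
  then obtain h where h: "continuous_map (prod_topology ?I X) X h"
    "\<And>x. x \<in> topspace (prod_topology ?I ?Z) \<Longrightarrow> h (?q x) = (\<lambda>(s, z). point (deform s z)) x"
    by blast
  have hp: "h (s, point z) = point (deform s z)" if "0 \<le> s" "s \<le> 1" "z \<in> moment_fibre" for s z
    using h(2)[of "(s, z)"] that by simp
  \<comment> \<open>Off the space h is replaced by the projection, because the homotopy must equal
    \<open>id\<close> at time 0 at every argument.\<close>
  define k where "k y = (if snd y \<in> topspace X then h y else snd y)" for y
  have kp: "k (s, point z) = point (deform s z)" if "0 \<le> s" "s \<le> 1" "z \<in> moment_fibre" for s z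
  proof -
    have "point z \<in> topspace X"
      unfolding topspace_toric_variety moment_fibre_surj[symmetric] by (rule imageI[OF that(3)])
    then show ?thesis using hp[OF that] by (simp add: k_def)
  qed
  have lift: "\<exists>z\<in>moment_fibre. x = point z" if "x \<in> topspace X" for x
    using that unfolding topspace_toric_variety moment_fibre_surj[symmetric] by blast
  have "continuous_map (prod_topology ?I X) X k"
    by (rule continuous_map_eq[OF h(1)]) (simp add: k_def mem_Times_iff)
  moreover have "k (0, x) = id x" for x
  proof (cases "x \<in> topspace X")
    case True
    then obtain z where "z \<in> moment_fibre" "x = point z" using lift by blast
    then show ?thesis using kp[of 0 z] by (simp add: deform_0)
  qed (simp add: k_def)
  moreover have "(\<lambda>x. k (s, x)) \<in> minimal_core \<rightarrow> minimal_core" if s: "s \<in> {0..1}" for s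
  proof
    fix x assume x: "x \<in> minimal_core"
    then obtain z where "z \<in> moment_fibre" "vnorm z \<in> minimal_points A \<theta>" "x = point z"
      unfolding minimal_core_def by blast
    then have "k (s, x) = x" using kp[of s z] s by (simp add: deform_minimal)
    then show "k (s, x) \<in> minimal_core" using x by simp
  qed
  ultimately have "homotopic_with (\<lambda>h. h \<in> minimal_core \<rightarrow> minimal_core) X X id (\<lambda>x. k (1, x))"
    unfolding homotopic_with_def by (intro exI[of _ k]) blast
  moreover have "(\<lambda>x. k (1, x)) ` topspace X \<subseteq> minimal_core"
  proof
    fix y assume "y \<in> (\<lambda>x. k (1, x)) ` topspace X"
    then obtain x where x: "x \<in> topspace X" "y = k (1, x)" by blast
    then obtain z where z: "z \<in> moment_fibre" "x = point z" using lift by blast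
    have "vnorm (deform 1 z) = retract_point A \<theta> (vnorm z)"
      using vnorm_deform[OF z(1), of 1] by (simp add: deform_moment_def)
    moreover have "vnorm z \<in> P" using z(1) by (simp add: moment_fibre_def)
    ultimately have "vnorm (deform 1 z) \<in> minimal_points A \<theta>"
      using retract_point_minimal by simp
    moreover have "y = point (deform 1 z)" using x(2) z kp[of 1 z] by simp
    moreover have "deform 1 z \<in> moment_fibre" using deform_in[OF z(1), of 1] by simp
    ultimately show "y \<in> minimal_core" unfolding minimal_core_def by blast
  qed
  ultimately show ?thesis by (rule that)
qed

end

section \<open>The core\<close>

lemma mem_kernel_space:
  "w \<in> kernel_space A \<longleftrightarrow> (\<forall>i. (\<Sum>j\<in>UNIV. real_of_int (A $ i $ j) * w $ j) = 0)"
  by (simp add: kernel_space_def vec_eq_iff matrix_vector_mult_def real_mat_def)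

lemma subspace_kernel_space: "subspace (kernel_space A)"
proof -
  have "kernel_space A = {w. (\<lambda>w. real_mat A *v w) w = 0}" by (simp add: kernel_space_def)
  then show ?thesis using linear_subspace_kernel[OF matrix_vector_mul_linear, of "real_mat A"] by simp
qed

lemma degree_polyhedron_add:
  assumes "x \<in> degree_polyhedron A \<theta>" "d \<in> kernel_space A" "\<And>j. 0 \<le> (x + d) $ j"
  shows "x + d \<in> degree_polyhedron A \<theta>"
  using assms by (simp add: mem_degree_polyhedron mem_kernel_space distrib_left sum.distrib)

lemma degree_polyhedron_diff:
  "\<lbrakk>x \<in> degree_polyhedron A \<theta>; y \<in> degree_polyhedron A \<theta>\<rbrakk> \<Longrightarrow> x - y \<in> kernel_space A"
  by (simp add: mem_degree_polyhedron mem_kernel_space right_diff_distrib sum_subtractf)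

text \<open>The direction moves only positive coordinates, so the least of them, divided by a bound
  for the entries of d, is a safe step.\<close>

lemma degree_polyhedron_perturb:
  assumes x: "x \<in> degree_polyhedron A \<theta>" and d: "d \<in> kernel_space A" "vsupp d \<subseteq> vsupp x"
  shows "\<exists>\<epsilon>>0. x + \<epsilon> *\<^sub>R d \<in> degree_polyhedron A \<theta>"
proof -
  define m where "m = Min (insert 1 ((\<lambda>j. x $ j) ` vsupp x))"
  have "x $ j > 0" if "j \<in> vsupp x" for j
    using nonneg_degree_polyhedron[OF x, of j] that by (simp add: vsupp_def)
  then have m: "m > 0" "\<And>j. j \<in> vsupp x \<Longrightarrow> m \<le> x $ j"
    by (auto simp: m_def)
  define D where "D = 1 + (\<Sum>j\<in>UNIV. \<bar>d $ j\<bar>)"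
  have D: "D \<ge> 1" by (simp add: D_def sum_nonneg)
  define \<epsilon> where "\<epsilon> = m / D"
  have e: "\<epsilon> > 0" using m(1) D by (simp add: \<epsilon>_def)
  have "x + \<epsilon> *\<^sub>R d \<in> degree_polyhedron A \<theta>"
  proof (rule degree_polyhedron_add[OF x])
    show "\<epsilon> *\<^sub>R d \<in> kernel_space A" using subspace_scale[OF subspace_kernel_space d(1)] .
    fix j
    show "0 \<le> (x + \<epsilon> *\<^sub>R d) $ j"
    proof (cases "j \<in> vsupp x")
      case True
      have "\<bar>d $ j\<bar> \<le> (\<Sum>j\<in>UNIV. \<bar>d $ j\<bar>)" by (rule member_le_sum) auto
      then have "\<bar>d $ j\<bar> \<le> D" by (simp add: D_def)
      then have "\<epsilon> * \<bar>d $ j\<bar> \<le> \<epsilon> * D" using e by simp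
      then have "\<bar>\<epsilon> * d $ j\<bar> \<le> m" using e D m(1) by (simp add: abs_mult \<epsilon>_def)
      then show ?thesis using m(2)[OF True] by simp
    next
      case False
      then have "x $ j = 0" "d $ j = 0" using d(2) by (auto simp: vsupp_def)
      then show ?thesis by simp
    qed
  qed
  then show ?thesis using e by blast
qed

text \<open>For x in the polyhedron this is the smallest face containing x.\<close>

definition support_face :: "int^'n^'d \<Rightarrow> int^'d \<Rightarrow> real^'n \<Rightarrow> (real^'n) set" where
  "support_face A \<theta> x = {y \<in> degree_polyhedron A \<theta>. vsupp y \<subseteq> vsupp x}"

lemma face_of_support_face: "support_face A \<theta> x face_of degree_polyhedron A \<theta>"
proof -
  have nn: "0 \<le> axis j 1 \<bullet> y" if "y \<in> degree_polyhedron A \<theta>" for y j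
    using nonneg_degree_polyhedron[OF that, of j] by (simp add: inner_axis')
  have f: "degree_polyhedron A \<theta> \<inter> {y. axis j 1 \<bullet> y = 0} face_of degree_polyhedron A \<theta>" for j
    by (rule face_of_Int_supporting_hyperplane_ge[OF convex_degree_polyhedron nn])
  have "support_face A \<theta> x =
      \<Inter> (insert (degree_polyhedron A \<theta>) ((\<lambda>j. degree_polyhedron A \<theta> \<inter> {y. axis j 1 \<bullet> y = 0}) ` (- vsupp x)))"
    by (auto simp: support_face_def vsupp_def inner_axis')
  also have "\<dots> face_of degree_polyhedron A \<theta>"
    by (rule face_of_Inter) (use f face_of_refl[OF convex_degree_polyhedron] in auto)
  finally show ?thesis .
qed

text \<open>Take x in F with the largest support. Midpoints show that no point of F has support
  outside it; conversely a point supported there is an end of a segment in P with x in its interior,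
  so it belongs to F.\<close>

lemma face_eq_support_face:
  fixes A :: "int^'n^'d"
  assumes F: "F face_of degree_polyhedron A \<theta>" "F \<noteq> {}"
  obtains x where "x \<in> degree_polyhedron A \<theta>" "F = support_face A \<theta> x"
proof -
  let ?P = "degree_polyhedron A \<theta>"
  have FP: "F \<subseteq> ?P" and cF: "convex F" using F(1) by (auto simp: face_of_def)
  obtain x1 where x1: "x1 \<in> F" using F(2) by blast
  have "\<forall>y. y \<in> F \<longrightarrow> card (vsupp y) < Suc CARD('n)" by (auto simp: less_Suc_eq_le intro: card_mono)
  from ex_has_greatest_nat[of "\<lambda>y. y \<in> F" x1 "\<lambda>y. card (vsupp y)", OF x1 this]
  obtain x where x: "x \<in> F" "\<And>y. y \<in> F \<Longrightarrow> card (vsupp y) \<le> card (vsupp x)" by blast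
  have xP: "x \<in> ?P" using x(1) FP by blast
  have "F = support_face A \<theta> x"
  proof (intro equalityI subsetI)
    fix y assume y: "y \<in> F"
    have yP: "y \<in> ?P" using y FP by blast
    define m where "m = (1/2) *\<^sub>R x + (1/2) *\<^sub>R y"
    have "m \<in> F" unfolding m_def using convexD[OF cF x(1) y, of "1/2" "1/2"] by simp
    moreover have "vsupp m = vsupp x \<union> vsupp y"
    proof -
      have "m $ j = 0 \<longleftrightarrow> x $ j = 0 \<and> y $ j = 0" for j
        using nonneg_degree_polyhedron[OF xP, of j] nonneg_degree_polyhedron[OF yP, of j]
        by (auto simp: m_def)
      then show ?thesis by (auto simp: vsupp_def)
    qed
    ultimately have "card (vsupp x \<union> vsupp y) \<le> card (vsupp x)" using x(2)[of m] by simp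
    then have "vsupp x = vsupp x \<union> vsupp y" by (intro card_seteq) auto
    then show "y \<in> support_face A \<theta> x" using yP by (auto simp: support_face_def)
  next
    fix y assume y: "y \<in> support_face A \<theta> x"
    then have yP: "y \<in> ?P" and sy: "vsupp y \<subseteq> vsupp x" by (auto simp: support_face_def)
    show "y \<in> F"
    proof (cases "y = x")
      case False
      have "vsupp (x - y) \<subseteq> vsupp x" using sy by (auto simp: vsupp_def)
      then obtain \<epsilon> where e: "\<epsilon> > 0" "x + \<epsilon> *\<^sub>R (x - y) \<in> ?P"
        using degree_polyhedron_perturb[OF xP degree_polyhedron_diff[OF xP yP]] by blast
      let ?w = "x + \<epsilon> *\<^sub>R (x - y)"
      have "x \<in> open_segment y ?w"
        unfolding in_segment
      \<comment> \<open>The segment beyond x is \<epsilon> times the one from y to x, which fixes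
        the weight.\<close>
      proof (intro conjI exI[of _ "1 / (1 + \<epsilon>)"])
        have "x - y \<noteq> 0" using False by simp
        then have "(1 + \<epsilon>) *\<^sub>R (x - y) \<noteq> 0" using e(1) by simp
        moreover have "?w - y = (1 + \<epsilon>) *\<^sub>R (x - y)" by (simp add: algebra_simps)
        ultimately show "y \<noteq> ?w" by (metis right_minus_eq)
        have "(1 + \<epsilon>) *\<^sub>R ((1 - 1 / (1 + \<epsilon>)) *\<^sub>R y + (1 / (1 + \<epsilon>)) *\<^sub>R ?w) = (1 + \<epsilon>) *\<^sub>R x"
        proof -
          have ab: "(1 + \<epsilon>) * (1 - 1 / (1 + \<epsilon>)) = \<epsilon>" "(1 + \<epsilon>) * (1 / (1 + \<epsilon>)) = 1"
            using e(1) by (simp_all add: right_diff_distrib)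
          have lin: "(1 + \<epsilon>) *\<^sub>R (a *\<^sub>R y + b *\<^sub>R u) = ((1 + \<epsilon>) * a) *\<^sub>R y + ((1 + \<epsilon>) * b) *\<^sub>R u" for a b u
            by (simp only: scaleR_right_distrib scaleR_scaleR)
          show ?thesis unfolding lin ab by (simp add: algebra_simps)
        qed
        then show "x = (1 - 1 / (1 + \<epsilon>)) *\<^sub>R y + (1 / (1 + \<epsilon>)) *\<^sub>R ?w"
          using e(1) by (metis add_pos_pos less_irrefl scaleR_left_imp_eq zero_less_one)
      qed (use e(1) in auto)
      then show ?thesis using F(1) yP e(2) x(1) by (auto simp: face_of_def)
    qed (use x(1) in simp)
  qed
  then show ?thesis using xP that by blast
qed

text \<open>Orthogonal projection of e: cones of the fan consist of kernel vectors, so other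
  functionals are moved there without changing them on the kernel.\<close>

lemma kernel_functional:
  fixes A :: "int^'n^'d"
  shows "\<exists>w\<in>kernel_space A. \<forall>k\<in>kernel_space A. w \<bullet> k = e \<bullet> k"
proof -
  have sp: "span (kernel_space A) = kernel_space A" using subspace_kernel_space by (simp add: span_eq_iff)
  obtain y z where yz: "y \<in> span (kernel_space A)" "\<And>w. w \<in> span (kernel_space A) \<Longrightarrow> orthogonal z w" "e = y + z"
    using orthogonal_subspace_decomp_exists[of "kernel_space A" e] by blast
  then show ?thesis unfolding sp by (intro bexI[of _ y]) (auto simp: orthogonal_def inner_add_left)
qed

text \<open>The sum of the coordinates off the support of x is nonnegative on P and vanishes exactly
  on the support face; w represents it in the kernel.\<close>

lemma support_functional:
  fixes A :: "int^'n^'d"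
  assumes x: "x \<in> degree_polyhedron A \<theta>"
  obtains w where "w \<in> kernel_space A" "w \<in> normal_cone A \<theta> (support_face A \<theta> x)"
    "\<And>k. k \<in> kernel_space A \<Longrightarrow> w \<bullet> k = (\<Sum>j\<in>- vsupp x. k $ j)"
proof -
  define e :: "real^'n" where "e = (\<chi> j. if j \<in> vsupp x then 0 else 1)"
  have e: "e \<bullet> k = (\<Sum>j\<in>- vsupp x. k $ j)" for k
    unfolding inner_vec_def by (rule sum.mono_neutral_cong_right) (auto simp: e_def)
  obtain w where w: "w \<in> kernel_space A" "\<And>k. k \<in> kernel_space A \<Longrightarrow> w \<bullet> k = e \<bullet> k"
    using kernel_functional[of A e] by blast
  have "w \<in> normal_cone A \<theta> (support_face A \<theta> x)"
    unfolding normal_cone_def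
  proof (intro CollectI conjI ballI w(1))
    fix u v assume u: "u \<in> support_face A \<theta> x" and v: "v \<in> degree_polyhedron A \<theta>"
    have uP: "u \<in> degree_polyhedron A \<theta>" using u by (simp add: support_face_def)
    have "w \<bullet> (v - u) = (\<Sum>j\<in>- vsupp x. (v - u) $ j)"
      using w(2)[OF degree_polyhedron_diff[OF v uP]] e by simp
    also have "\<dots> = (\<Sum>j\<in>- vsupp x. v $ j)"
      using u by (intro sum.cong) (auto simp: support_face_def vsupp_def)
    also have "\<dots> \<ge> 0" using nonneg_degree_polyhedron[OF v] by (intro sum_nonneg) auto
    finally show "w \<bullet> u \<le> w \<bullet> v" by (simp add: inner_diff_right)
  qed
  then show ?thesis using that[of w] w e by simp
qed

lemma support_face_self: "x \<in> degree_polyhedron A \<theta> \<Longrightarrow> x \<in> support_face A \<theta> x"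
  by (simp add: support_face_def)

text \<open>One functional decides the forward direction: on u - r x the support functional is the
  sum of the coordinates of u off the support. Conversely x can be moved slightly along r x - u
  inside P. Nothing is divided by r, so r = 0 is covered.\<close>

lemma on_dual_face_iff:
  assumes x: "x \<in> degree_polyhedron A \<theta>"
  shows "on_dual_face A \<theta> (normal_cone A \<theta> (support_face A \<theta> x)) r u
    \<longleftrightarrow> u \<in> lattice_points A \<theta> r \<and> vsupp u \<subseteq> vsupp x"
proof -
  have ker: "nat_vec u - real r *\<^sub>R x \<in> kernel_space A" if u: "u \<in> lattice_points A \<theta> r"
  proof -
    have "(\<Sum>j\<in>UNIV. real_of_int (A $ i $ j) * real (u $ j)) = real r * real_of_int (\<theta> $ i)" for i
    proof -
      have "real_of_int (\<Sum>j\<in>UNIV. A $ i $ j * int (u $ j)) = real_of_int (int r * \<theta> $ i)"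
        using u by (simp only: mem_lattice_points)
      then show ?thesis by simp
    qed
    moreover have "(\<Sum>j\<in>UNIV. real_of_int (A $ i $ j) * (real r * x $ j)) = real r * real_of_int (\<theta> $ i)" for i
      using x by (simp add: mem_degree_polyhedron mult.left_commute flip: sum_distrib_left)
    ultimately show ?thesis
      by (simp add: mem_kernel_space nat_vec_def right_diff_distrib sum_subtractf)
  qed
  show ?thesis
  proof
    assume L: "on_dual_face A \<theta> (normal_cone A \<theta> (support_face A \<theta> x)) r u"
    then have u: "u \<in> lattice_points A \<theta> r" by (simp add: on_dual_face_def lattice_points_def)
    obtain w where w: "w \<in> normal_cone A \<theta> (support_face A \<theta> x)"
      "\<And>k. k \<in> kernel_space A \<Longrightarrow> w \<bullet> k = (\<Sum>j\<in>- vsupp x. k $ j)"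
      by (rule support_functional[OF x]) blast
    have "w \<bullet> nat_vec u \<le> real r * (w \<bullet> x)" using L w(1) x by (auto simp: on_dual_face_def)
    then have "w \<bullet> (nat_vec u - real r *\<^sub>R x) \<le> 0" by (simp add: inner_diff_right)
    moreover have "w \<bullet> (nat_vec u - real r *\<^sub>R x) = (\<Sum>j\<in>- vsupp x. real (u $ j))"
      using w(2)[OF ker[OF u]] by (simp add: nat_vec_def vsupp_def)
    ultimately have "(\<Sum>j\<in>- vsupp x. real (u $ j)) \<le> 0" by simp
    then have "(\<Sum>j\<in>- vsupp x. real (u $ j)) = 0" by (simp add: antisym sum_nonneg)
    then have "\<forall>j\<in>- vsupp x. real (u $ j) = 0" by (subst (asm) sum_nonneg_eq_0_iff) auto
    then show "u \<in> lattice_points A \<theta> r \<and> vsupp u \<subseteq> vsupp x" using u by (auto simp: vsupp_def)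
  next
    assume R: "u \<in> lattice_points A \<theta> r \<and> vsupp u \<subseteq> vsupp x"
    have d: "- (nat_vec u - real r *\<^sub>R x) \<in> kernel_space A"
      using subspace_neg[OF subspace_kernel_space ker] R by blast
    have "vsupp (- (nat_vec u - real r *\<^sub>R x)) \<subseteq> vsupp x"
      using R by (auto simp: vsupp_def nat_vec_def)
    then obtain \<epsilon> where e: "\<epsilon> > 0" "x + \<epsilon> *\<^sub>R - (nat_vec u - real r *\<^sub>R x) \<in> degree_polyhedron A \<theta>"
      using degree_polyhedron_perturb[OF x d] by blast
    have "w \<bullet> nat_vec u \<le> real r * (w \<bullet> v)"
      if w: "w \<in> normal_cone A \<theta> (support_face A \<theta> x)" and v: "v \<in> degree_polyhedron A \<theta>" for w v
    proof -
      have wx: "w \<bullet> x \<le> w \<bullet> y" if "y \<in> degree_polyhedron A \<theta>" for y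
        using w that support_face_self[OF x] by (auto simp: normal_cone_def)
      have "w \<bullet> x \<le> w \<bullet> (x + \<epsilon> *\<^sub>R - (nat_vec u - real r *\<^sub>R x))" by (rule wx[OF e(2)])
      then have "\<epsilon> * (w \<bullet> nat_vec u - real r * (w \<bullet> x)) \<le> 0"
        by (simp add: inner_add_right inner_diff_right inner_minus_right algebra_simps)
      then have "w \<bullet> nat_vec u \<le> real r * (w \<bullet> x)" using e(1) by (simp add: mult_le_0_iff)
      also have "\<dots> \<le> real r * (w \<bullet> v)" using wx[OF v] by (simp add: mult_left_mono)
      finally show ?thesis .
    qed
    then show "on_dual_face A \<theta> (normal_cone A \<theta> (support_face A \<theta> x)) r u"
      using R by (simp add: on_dual_face_def lattice_points_def)
  qed
qed

text \<open>The right hand side says that the smallest face containing x has trivial recession cone.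
  It depends on x only through its support.\<close>

lemma minimal_points_iff:
  assumes x: "x \<in> degree_polyhedron A \<theta>"
  shows "x \<in> minimal_points A \<theta> \<longleftrightarrow>
    (\<forall>c\<in>kernel_space A. (\<forall>j. 0 \<le> c $ j) \<longrightarrow> vsupp c \<subseteq> vsupp x \<longrightarrow> c = 0)"
proof
  assume m: "x \<in> minimal_points A \<theta>"
  show "\<forall>c\<in>kernel_space A. (\<forall>j. 0 \<le> c $ j) \<longrightarrow> vsupp c \<subseteq> vsupp x \<longrightarrow> c = 0"
  proof (intro ballI impI)
    fix c assume c: "c \<in> kernel_space A" "\<forall>j. 0 \<le> c $ j" "vsupp c \<subseteq> vsupp x"
    have "vsupp (- c) \<subseteq> vsupp x" using c(3) by (auto simp: vsupp_def)
    then obtain \<epsilon> where e: "\<epsilon> > 0" "x + \<epsilon> *\<^sub>R - c \<in> degree_polyhedron A \<theta>"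
      using degree_polyhedron_perturb[OF x subspace_neg[OF subspace_kernel_space c(1)]] by blast
    then have "x + \<epsilon> *\<^sub>R - c \<in> lower_box A \<theta> x" using c(2) by (simp add: lower_box_def)
    then have "x + \<epsilon> *\<^sub>R - c = x" using m by (auto simp: minimal_points_def)
    then show "c = 0" using e(1) by simp
  qed
next
  assume H: "\<forall>c\<in>kernel_space A. (\<forall>j. 0 \<le> c $ j) \<longrightarrow> vsupp c \<subseteq> vsupp x \<longrightarrow> c = 0"
  have "u = x" if u: "u \<in> lower_box A \<theta> x" for u
  proof -
    have uP: "u \<in> degree_polyhedron A \<theta>" and ux: "\<And>j. u $ j \<le> x $ j" using u by (auto simp: lower_box_def)
    have "vsupp (x - u) \<subseteq> vsupp x"
    proof
      fix j assume "j \<in> vsupp (x - u)"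
      then have "x $ j \<noteq> u $ j" by (simp add: vsupp_def)
      then show "j \<in> vsupp x"
        using ux[of j] nonneg_degree_polyhedron[OF uP, of j] by (auto simp: vsupp_def)
    qed
    moreover have "\<forall>j. 0 \<le> (x - u) $ j" using ux by simp
    ultimately have "x - u = 0" using H degree_polyhedron_diff[OF x uP] by blast
    then show ?thesis by simp
  qed
  then show "x \<in> minimal_points A \<theta>" using x by (auto simp: minimal_points_def lower_box_def)
qed

section \<open>Interior cones of the normal fan and bounded faces\<close>

lemma normal_fan_support_face:
  "x \<in> degree_polyhedron A \<theta> \<Longrightarrow> normal_cone A \<theta> (support_face A \<theta> x) \<in> normal_fan A \<theta>"
  unfolding normal_fan_def using face_of_support_face support_face_self by blast

lemma normal_fan_subset_kernel: "\<Union>(normal_fan A \<theta>) \<subseteq> kernel_space A"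
  by (auto simp: normal_fan_def normal_cone_def)

text \<open>A functional that attains its minimum on P cannot decrease along a recession
  direction.\<close>

lemma normal_fan_recession_nonneg:
  assumes w: "w \<in> \<Union>(normal_fan A \<theta>)" and c: "c \<in> kernel_space A" "\<forall>j. 0 \<le> c $ j"
  shows "0 \<le> w \<bullet> c"
proof -
  obtain F where F: "F face_of degree_polyhedron A \<theta>" "F \<noteq> {}" "w \<in> normal_cone A \<theta> F"
    using w by (auto simp: normal_fan_def)
  obtain x where x: "x \<in> F" using F(2) by blast
  then have xP: "x \<in> degree_polyhedron A \<theta>" using F(1) face_of_imp_subset by blast
  have "x + c \<in> degree_polyhedron A \<theta>"
    using degree_polyhedron_add[OF xP c(1)] c(2) nonneg_degree_polyhedron[OF xP] by simp
  then have "w \<bullet> x \<le> w \<bullet> (x + c)" using F(3) x by (auto simp: normal_cone_def)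
  then show ?thesis by (simp add: inner_add_right)
qed

text \<open>If w is interior to the support of the fan, w - \<eta> c is still nonnegative on a
  recession direction c, so w is strictly positive on a nonzero c. But if c is supported on x, then
  x - \<epsilon> c lies in P, which forces w \<bullet> c \<le> 0.\<close>

lemma interior_cone_imp_minimal:
  assumes x: "x \<in> degree_polyhedron A \<theta>"
    and nb: "\<not> normal_cone A \<theta> (support_face A \<theta> x) \<subseteq> fan_boundary A \<theta>"
  shows "x \<in> minimal_points A \<theta>"
  unfolding minimal_points_iff[OF x]
proof (intro ballI impI)
  fix c assume c: "c \<in> kernel_space A" "\<forall>j. 0 \<le> c $ j" "vsupp c \<subseteq> vsupp x"
  let ?K = "kernel_space A" and ?S = "\<Union>(normal_fan A \<theta>)"
  obtain w where w: "w \<in> normal_cone A \<theta> (support_face A \<theta> x)" "w \<notin> fan_boundary A \<theta>" using nb by blast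
  have wS: "w \<in> ?S" using w(1) normal_fan_support_face[OF x] by blast
  then have "w \<in> top_of_set ?K closure_of ?S"
    using closure_of_subset[of ?S "top_of_set ?K"] normal_fan_subset_kernel[of A \<theta>] by auto
  then have "w \<in> top_of_set ?K interior_of ?S"
    using w(2) by (simp add: fan_boundary_def frontier_of_def)
  then obtain U where U: "openin (top_of_set ?K) U" "w \<in> U" "U \<subseteq> ?S"
    by (auto simp: interior_of_def)
  then obtain V where V: "open V" "U = ?K \<inter> V" by (auto simp: openin_open)
  then obtain e where e: "e > 0" "ball w e \<subseteq> V" using U(2) by (meson IntD2 open_contains_ball)
  show "c = 0"
  proof (rule ccontr)
    assume c0: "c \<noteq> 0"
    define \<eta> where "\<eta> = e / (2 * norm c)"
    have eta: "\<eta> > 0" using e(1) c0 by (simp add: \<eta>_def)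
    have "dist w (w - \<eta> *\<^sub>R c) < e" using e(1) c0 by (simp add: dist_norm \<eta>_def)
    moreover have "w - \<eta> *\<^sub>R c \<in> ?K"
      using wS normal_fan_subset_kernel[of A \<theta>] c(1) subspace_kernel_space
      by (intro subspace_diff subspace_scale) auto
    ultimately have "w - \<eta> *\<^sub>R c \<in> U" using V(2) subsetD[OF e(2)] by simp
    then have "w - \<eta> *\<^sub>R c \<in> ?S" using U(3) by blast
    then have "0 \<le> (w - \<eta> *\<^sub>R c) \<bullet> c" by (rule normal_fan_recession_nonneg[OF _ c(1,2)])
    then have pos: "\<eta> * (c \<bullet> c) \<le> w \<bullet> c" by (simp add: inner_diff_left)
    have "vsupp (- c) \<subseteq> vsupp x" using c(3) by (auto simp: vsupp_def)
    then obtain \<epsilon> where ep: "\<epsilon> > 0" "x + \<epsilon> *\<^sub>R - c \<in> degree_polyhedron A \<theta>"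
      using degree_polyhedron_perturb[OF x subspace_neg[OF subspace_kernel_space c(1)]] by blast
    then have "w \<bullet> x \<le> w \<bullet> (x + \<epsilon> *\<^sub>R - c)"
      using w(1) support_face_self[OF x] by (auto simp: normal_cone_def)
    then have "\<epsilon> * (w \<bullet> c) \<le> 0" by (simp add: inner_diff_right)
    then have "w \<bullet> c \<le> 0" using ep(1) by (simp add: mult_le_0_iff)
    moreover have "\<eta> * (c \<bullet> c) > 0" using eta c0 by simp
    ultimately show False using pos by linarith
  qed
qed

text \<open>Over a bounded face the supporting functional grows linearly on \<open>P\<^sub>\<theta>\<close>; nearby functionals are then
  bounded below as well, so the functional is interior to the support of the fan.\<close>

lemma support_sum_growth:
  fixes A :: "int^'n^'d"
  assumes x: "x \<in> minimal_points A \<theta>"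
  shows "\<exists>\<delta>>0. \<exists>K. \<forall>y\<in>degree_polyhedron A \<theta>. \<delta> * norm y - K \<le> (\<Sum>j\<in>- vsupp x. y $ j)"
proof (rule ccontr)
  assume neg: "\<not> ?thesis"
  \<comment> \<open>The negation with \<delta> = 1/(n+1) and K = n+1. Since the left hand sum is
    nonnegative, this K forces the norms to infinity.\<close>
  have "\<exists>y\<in>degree_polyhedron A \<theta>. (\<Sum>j\<in>- vsupp x. y $ j) < inverse (real (Suc n)) * norm y - real (Suc n)" for n
  proof (rule ccontr)
    assume "\<not> ?thesis"
    then have "\<forall>y\<in>degree_polyhedron A \<theta>. inverse (real (Suc n)) * norm y - real (Suc n) \<le> (\<Sum>j\<in>- vsupp x. y $ j)"
      by (simp add: not_less)
    moreover have "inverse (real (Suc n)) > 0" by simp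
    ultimately show False using neg by blast
  qed
  then have "\<forall>n. \<exists>y. y \<in> degree_polyhedron A \<theta>
      \<and> (\<Sum>j\<in>- vsupp x. y $ j) < inverse (real (Suc n)) * norm y - real (Suc n)" by blast
  from choice[OF this] obtain y where y: "\<And>n. y n \<in> degree_polyhedron A \<theta>"
    "\<And>n. (\<Sum>j\<in>- vsupp x. y n $ j) < inverse (real (Suc n)) * norm (y n) - real (Suc n)" by blast
  have large: "real (Suc n) \<le> norm (y n)" for n
  proof -
    have "0 \<le> (\<Sum>j\<in>- vsupp x. y n $ j)" using nonneg_degree_polyhedron[OF y(1)] by (intro sum_nonneg) auto
    then have "real (Suc n) \<le> inverse (real (Suc n)) * norm (y n)" using y(2)[of n] by linarith
    also have "\<dots> \<le> 1 * norm (y n)" by (intro mult_right_mono) (auto simp: inverse_le_1_iff)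
    finally show ?thesis by simp
  qed
  have pos: "norm (y n) > 0" for n using large[of n] by (rule less_le_trans[rotated]) simp
  \<comment> \<open>A limit c of these unit vectors is a recession direction, because A s_n =
    \<theta> / |y_n| tends to 0. Its coordinates off the support of x sum to 0, against minimality
    of x.\<close>
  define s where "s n = (1 / norm (y n)) *\<^sub>R y n" for n
  have ns: "norm (s n) = 1" for n using pos[of n] by (simp add: s_def)
  have "bounded (range s)" unfolding bounded_iff by (intro exI[of _ 1]) (auto simp: ns)
  then obtain c \<sigma> where \<sigma>: "strict_mono \<sigma>" and l: "(s \<circ> \<sigma>) \<longlonglongrightarrow> c"
    using bounded_imp_convergent_subsequence by blast
  have l': "(\<lambda>n. s (\<sigma> n)) \<longlonglongrightarrow> c" using l by (simp add: o_def)
  have inv: "(\<lambda>n. inverse (real (Suc (\<sigma> n)))) \<longlonglongrightarrow> 0"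
    using LIMSEQ_subseq_LIMSEQ[OF LIMSEQ_inverse_real_of_nat \<sigma>] by (simp add: o_def)
  have nc: "norm c = 1"
    using LIMSEQ_unique[OF tendsto_norm[OF l']] by (simp add: ns)
  have c0: "0 \<le> c $ j" for j
    by (rule LIMSEQ_le_const[OF tendsto_vec_nth[OF l']])
       (use nonneg_degree_polyhedron[OF y(1)] pos in \<open>auto simp: s_def less_imp_le\<close>)
  have cK: "c \<in> kernel_space A"
    unfolding mem_kernel_space
  proof
    fix i
    have lim: "(\<lambda>n. \<Sum>j\<in>UNIV. real_of_int (A $ i $ j) * s (\<sigma> n) $ j) \<longlonglongrightarrow> (\<Sum>j\<in>UNIV. real_of_int (A $ i $ j) * c $ j)"
      by (intro tendsto_intros l')
    have eq: "(\<Sum>j\<in>UNIV. real_of_int (A $ i $ j) * s n $ j) = real_of_int (\<theta> $ i) / norm (y n)" for n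
    proof -
      have "(\<Sum>j\<in>UNIV. real_of_int (A $ i $ j) * s n $ j) = (\<Sum>j\<in>UNIV. real_of_int (A $ i $ j) * y n $ j) / norm (y n)"
        by (simp add: s_def sum_divide_distrib)
      then show ?thesis using y(1)[of n] by (simp add: mem_degree_polyhedron)
    qed
    have "(\<lambda>n. real_of_int (\<theta> $ i) / norm (y (\<sigma> n))) \<longlonglongrightarrow> 0"
    proof (rule Lim_null_comparison)
      show "(\<lambda>n. \<bar>real_of_int (\<theta> $ i)\<bar> * inverse (real (Suc (\<sigma> n)))) \<longlonglongrightarrow> 0"
        using tendsto_mult_right_zero[OF inv] by simp
      have "norm (real_of_int (\<theta> $ i) / norm (y n)) \<le> \<bar>real_of_int (\<theta> $ i)\<bar> * inverse (real (Suc n))" for n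
      proof -
        have "inverse (norm (y n)) \<le> inverse (real (Suc n))" using large[of n] by (intro le_imp_inverse_le) auto
        then have "\<bar>real_of_int (\<theta> $ i)\<bar> * inverse (norm (y n)) \<le> \<bar>real_of_int (\<theta> $ i)\<bar> * inverse (real (Suc n))"
          by (intro mult_left_mono) auto
        then show ?thesis by (simp add: divide_inverse abs_mult)
      qed
      then show "\<forall>\<^sub>F n in sequentially. norm (real_of_int (\<theta> $ i) / norm (y (\<sigma> n))) \<le> \<bar>real_of_int (\<theta> $ i)\<bar> * inverse (real (Suc (\<sigma> n)))"
        by (intro always_eventually allI)
    qed
    then have "(\<lambda>n. \<Sum>j\<in>UNIV. real_of_int (A $ i $ j) * s (\<sigma> n) $ j) \<longlonglongrightarrow> 0" by (simp only: eq)
    then show "(\<Sum>j\<in>UNIV. real_of_int (A $ i $ j) * c $ j) = 0" by (rule LIMSEQ_unique[OF lim])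
  qed
  have "(\<Sum>j\<in>- vsupp x. c $ j) \<le> 0"
  proof (rule LIMSEQ_le)
    show "(\<lambda>n. \<Sum>j\<in>- vsupp x. s (\<sigma> n) $ j) \<longlonglongrightarrow> (\<Sum>j\<in>- vsupp x. c $ j)" by (intro tendsto_intros l')
    show "(\<lambda>n. inverse (real (Suc (\<sigma> n)))) \<longlonglongrightarrow> 0" by (rule inv)
    have "(\<Sum>j\<in>- vsupp x. s n $ j) \<le> inverse (real (Suc n))" for n
    proof -
      have "(\<Sum>j\<in>- vsupp x. s n $ j) = (\<Sum>j\<in>- vsupp x. y n $ j) / norm (y n)"
        by (simp add: s_def sum_divide_distrib)
      also have "\<dots> \<le> (inverse (real (Suc n)) * norm (y n)) / norm (y n)"
        using y(2)[of n] pos[of n] by (intro divide_right_mono) auto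
      also have "\<dots> = inverse (real (Suc n))" using pos[of n] by simp
      finally show ?thesis .
    qed
    then show "\<exists>N. \<forall>n\<ge>N. (\<Sum>j\<in>- vsupp x. s (\<sigma> n) $ j) \<le> inverse (real (Suc (\<sigma> n)))" by blast
  qed
  then have "(\<Sum>j\<in>- vsupp x. c $ j) = 0" using c0 by (simp add: antisym sum_nonneg)
  then have "\<forall>j\<in>- vsupp x. c $ j = 0" using c0 by (subst (asm) sum_nonneg_eq_0_iff) auto
  then have sub: "vsupp c \<subseteq> vsupp x" by (auto simp: vsupp_def)
  have xP: "x \<in> degree_polyhedron A \<theta>" using x by (simp add: minimal_points_def)
  have "c = 0" using x[unfolded minimal_points_iff[OF xP]] cK c0 sub by blast
  then show False using nc by simp
qed

lemma minimal_imp_interior_cone: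
  fixes A :: "int^'n^'d"
  assumes x: "x \<in> minimal_points A \<theta>"
  shows "\<not> normal_cone A \<theta> (support_face A \<theta> x) \<subseteq> fan_boundary A \<theta>"
proof -
  let ?P = "degree_polyhedron A \<theta>" and ?K = "kernel_space A" and ?S = "\<Union>(normal_fan A \<theta>)"
  have xP: "x \<in> ?P" using x by (simp add: minimal_points_def)
  obtain w where w: "w \<in> ?K" "w \<in> normal_cone A \<theta> (support_face A \<theta> x)"
    "\<And>k. k \<in> ?K \<Longrightarrow> w \<bullet> k = (\<Sum>j\<in>- vsupp x. k $ j)"
    by (rule support_functional[OF xP]) blast
  obtain \<delta> K where d: "\<delta> > 0" and K: "\<forall>y\<in>?P. \<delta> * norm y - K \<le> (\<Sum>j\<in>- vsupp x. y $ j)"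
    using support_sum_growth[OF x] by blast
  define C where "C = K - w \<bullet> x"
  have grow: "\<delta> * norm y - C \<le> w \<bullet> y" if y: "y \<in> ?P" for y
  proof -
    have "w \<bullet> (y - x) = (\<Sum>j\<in>- vsupp x. y $ j)"
      using w(3)[OF degree_polyhedron_diff[OF y xP]] by (simp add: vsupp_def)
    then show ?thesis using K y by (force simp: C_def inner_diff_right)
  qed
  \<comment> \<open>Within \<delta>/2 of w half of the growth survives, so w' has compact sublevel
    sets on P, attains its minimum and lies in the normal cone of the face where it does.\<close>
  have inS: "w' \<in> ?S" if w': "w' \<in> ?K" "dist w w' < \<delta> / 2" for w'
  proof -
    have grow': "\<delta> / 2 * norm y - C \<le> w' \<bullet> y" if y: "y \<in> ?P" for y
    proof -
      have "(w - w') \<bullet> y \<le> norm (w - w') * norm y" by (rule norm_cauchy_schwarz)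
      also have "\<dots> \<le> \<delta> / 2 * norm y" using w'(2) by (intro mult_right_mono) (auto simp: dist_norm)
      finally show ?thesis using grow[OF y] by (simp add: inner_diff_left)
    qed
    let ?C = "{y \<in> ?P. w' \<bullet> y \<le> w' \<bullet> x}"
    have "?C = ?P \<inter> {y. w' \<bullet> y \<le> w' \<bullet> x}" by blast
    then have "closed ?C" by (simp only: closed_Int[OF closed_degree_polyhedron closed_halfspace_le])
    moreover have "bounded ?C"
      unfolding bounded_iff
    proof (intro exI ballI)
      fix y assume y: "y \<in> ?C"
      then have "\<delta> / 2 * norm y \<le> w' \<bullet> x + C" using grow'[of y] by simp
      then show "norm y \<le> (w' \<bullet> x + C) / (\<delta> / 2)" using d by (simp add: field_simps)
    qed
    ultimately have "compact ?C" by (simp add: compact_eq_bounded_closed)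
    moreover have "x \<in> ?C" using xP by simp
    moreover have "continuous_on ?C (\<lambda>y. w' \<bullet> y)" by (intro continuous_intros)
    ultimately obtain m where m: "m \<in> ?C" "\<forall>y\<in>?C. w' \<bullet> m \<le> w' \<bullet> y"
      using continuous_attains_inf[of ?C "\<lambda>y. w' \<bullet> y"] by blast
    have min: "w' \<bullet> m \<le> w' \<bullet> y" if "y \<in> ?P" for y
      using m that by (cases "w' \<bullet> y \<le> w' \<bullet> x") auto
    let ?F = "?P \<inter> {y. w' \<bullet> y = w' \<bullet> m}"
    have "?F face_of ?P" by (rule face_of_Int_supporting_hyperplane_ge[OF convex_degree_polyhedron min])
    moreover have "?F \<noteq> {}" using m(1) by auto
    moreover have "w' \<in> normal_cone A \<theta> ?F" using w'(1) min by (auto simp: normal_cone_def)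
    ultimately show ?thesis unfolding normal_fan_def by blast
  qed
  have "openin (top_of_set ?K) (?K \<inter> ball w (\<delta> / 2))" by (intro openin_open_Int open_ball)
  moreover have "?K \<inter> ball w (\<delta> / 2) \<subseteq> ?S" using inS by auto
  moreover have "w \<in> ?K \<inter> ball w (\<delta> / 2)" using w(1) d by simp
  ultimately have "w \<in> top_of_set ?K interior_of ?S" unfolding interior_of_def by blast
  then have "w \<notin> fan_boundary A \<theta>" by (simp add: fan_boundary_def frontier_of_def)
  then show ?thesis using w(2) by blast
qed

section \<open>Torus orbits and the core\<close>

lemma lookup_torus_scale:
  "Poly_Mapping.lookup (torus_scale t f) u = mono_eval t u * Poly_Mapping.lookup f u"
proof -
  have "Poly_Mapping.lookup (torus_scale t f) u
      = (\<Sum>v\<in>Poly_Mapping.keys f. if v = u then mono_eval t v * Poly_Mapping.lookup f v else 0)"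
    by (simp add: torus_scale_def lookup_sum lookup_single when_def mono_eval_def)
  also have "\<dots> = (if u \<in> Poly_Mapping.keys f then mono_eval t u * Poly_Mapping.lookup f u else 0)"
    by (subst sum.delta) auto
  finally show ?thesis by (simp add: in_keys_iff)
qed

context toric_data begin

text \<open>By \<open>on_dual_face_iff\<close> the distinguished point is the ideal of the indicator
  vector of the support of x; the torus element t scales this vector.\<close>

lemma torus_act_distinguished_point:
  assumes x: "x \<in> P" and t: "\<And>j. t $ j \<noteq> 0"
  shows "torus_act t (distinguished_point A \<theta> (normal_cone A \<theta> (support_face A \<theta> x)))
    = point (\<chi> j. if j \<in> vsupp x then t $ j else 0)"
proof -
  define z where "z = (\<chi> j. if j \<in> vsupp x then t $ j else 0)"
  have z: "mono_eval z u = (if vsupp u \<subseteq> vsupp x then mono_eval t u else 0)" for u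
  proof (cases "vsupp u \<subseteq> vsupp x")
    case True
    have "t $ j ^ (u $ j) = z $ j ^ (u $ j)" for j
    proof (cases "j \<in> vsupp x")
      case False
      then have "j \<notin> vsupp u" using True by blast
      then show ?thesis by (simp add: vsupp_def)
    qed (simp add: z_def)
    then show ?thesis using True by (simp add: mono_eval_def)
  next
    case False
    then have "\<not> vsupp u \<subseteq> vsupp z" by (auto simp: z_def vsupp_def)
    then show ?thesis using False by (simp add: mono_eval_eq_0_iff)
  qed
  have t0: "mono_eval t u \<noteq> 0" for u using t by (simp add: mono_eval_eq_0_iff vsupp_def)
  have keys: "Poly_Mapping.keys (torus_scale t f) = Poly_Mapping.keys f" for f :: "'n cpoly"
    using t0 by (auto simp: in_keys_iff lookup_torus_scale)
  have "f \<in> torus_act t (distinguished_point A \<theta> (normal_cone A \<theta> (support_face A \<theta> x))) \<longleftrightarrow> f \<in> point z" for f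
  proof -
    have car: "torus_scale t f \<in> carrier R \<longleftrightarrow> f \<in> carrier R" by (simp add: carrier_veronese_ring keys)
    have "(\<Sum>u\<in>{u \<in> Poly_Mapping.keys (torus_scale t f). on_dual_face A \<theta> (normal_cone A \<theta> (support_face A \<theta> x)) r u}.
        Poly_Mapping.lookup (torus_scale t f) u) = Polynomial.coeff (graded_eval z f) r"
      if f: "f \<in> carrier R" for r
      unfolding coeff_graded_eval[OF f] on_dual_face_iff[OF x] keys lookup_torus_scale
      by (rule sum.mono_neutral_cong_left) (auto simp: z)
    then show ?thesis
      unfolding torus_act_def distinguished_point_def point_def
      using car by (auto simp: poly_eq_iff)
  qed
  then show ?thesis by (auto simp: z_def)
qed

text \<open>Both sides are governed by supports: an orbit consists of the ideals of the vectors with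
  one given support, minimality of a modulus vector depends on its support alone, and passing to the
  moment fibre preserves supports.\<close>

lemma core_eq_minimal_core: "core A \<theta> = minimal_core"
proof (intro equalityI subsetI)
  fix \<pp> assume "\<pp> \<in> core A \<theta>"
  then obtain \<sigma> where \<sigma>: "\<pp> \<in> torus_orbit A \<theta> \<sigma>" "\<sigma> \<in> normal_fan A \<theta>" "\<not> \<sigma> \<subseteq> fan_boundary A \<theta>"
    unfolding core_def by blast
  obtain F where F: "F face_of P" "F \<noteq> {}" "\<sigma> = normal_cone A \<theta> F"
    using \<sigma>(2) unfolding normal_fan_def by blast
  obtain x where x: "x \<in> P" "F = support_face A \<theta> x" by (rule face_eq_support_face[OF F(1,2)])
  have xmin: "x \<in> minimal_points A \<theta>"
    by (rule interior_cone_imp_minimal[OF x(1)]) (use \<sigma>(3) F(3) x(2) in simp)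
  obtain t where t: "\<forall>j. t $ j \<noteq> 0" "\<pp> = torus_act t (distinguished_point A \<theta> \<sigma>)"
    using \<sigma>(1) unfolding torus_orbit_def by blast
  define z where "z = (\<chi> j. if j \<in> vsupp x then t $ j else 0)"
  have pz: "\<pp> = point z"
    using torus_act_distinguished_point[OF x(1), of t] t by (simp add: z_def F(3) x(2))
  have zx: "vsupp z = vsupp x" using t(1) by (auto simp: z_def vsupp_def)
  obtain q m where m: "q > 0" "m \<in> M q" "vsupp m = vsupp x"
    using lattice_approximation[OF x(1) zero_less_one] by metis
  obtain z' where z': "z' \<in> moment_fibre" "vsupp z' = vsupp z" "point z' = point z"
    using moment_fibre_representative[OF m(2,1), of z] zx m(3) by auto
  have v: "vnorm z' \<in> P" using z'(1) by (simp add: moment_fibre_def)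
  have "vnorm z' \<in> minimal_points A \<theta>"
    using xmin unfolding minimal_points_iff[OF x(1)] minimal_points_iff[OF v] by (simp add: z'(2) zx)
  then show "\<pp> \<in> minimal_core" unfolding minimal_core_def using z' pz by auto
next
  fix \<pp> assume "\<pp> \<in> minimal_core"
  then obtain z where z: "z \<in> moment_fibre" "vnorm z \<in> minimal_points A \<theta>" "\<pp> = point z"
    unfolding minimal_core_def by blast
  \<comment> \<open>The entries 1 off the support make t a torus element; the indicator of the
    support cancels them.\<close>
  define t where "t = (\<chi> j. if j \<in> vsupp z then z $ j else 1)"
  have t: "t $ j \<noteq> 0" for j by (simp add: t_def vsupp_def)
  have v: "vnorm z \<in> P" using z(1) by (simp add: moment_fibre_def)
  define \<sigma> where "\<sigma> = normal_cone A \<theta> (support_face A \<theta> (vnorm z))"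
  have "(\<chi> j. if j \<in> vsupp (vnorm z) then t $ j else 0) = z"
    by (auto simp: vec_eq_iff t_def vsupp_def)
  then have "\<pp> = torus_act t (distinguished_point A \<theta> \<sigma>)"
    using torus_act_distinguished_point[OF v t] z(3) by (simp add: \<sigma>_def)
  then have "\<pp> \<in> torus_orbit A \<theta> \<sigma>" unfolding torus_orbit_def using t by blast
  moreover have "\<sigma> \<in> normal_fan A \<theta>" unfolding \<sigma>_def by (rule normal_fan_support_face[OF v])
  moreover have "\<not> \<sigma> \<subseteq> fan_boundary A \<theta>" unfolding \<sigma>_def by (rule minimal_imp_interior_cone[OF z(2)])
  ultimately show "\<pp> \<in> core A \<theta>" unfolding core_def by blast
qed

end

theorem theorem3p5:
  fixes A :: "int^'n^'d" and \<theta> :: "int^'d"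
  assumes "coprime_maximal_minors A"
    and "\<theta> \<in> column_semigroup A"
    and "generic_degree A \<theta>"
    and "integral_degree A \<theta>"
  shows "cohomology_induced p (subtopology (toric_variety A \<theta>) (core A \<theta>)) id
           \<in> iso (cohomology_group p (toric_variety A \<theta>))
                 (cohomology_group p (subtopology (toric_variety A \<theta>) (core A \<theta>)))"
proof -
  interpret toric_data A \<theta>
    by unfold_locales (use generic_degree_nonzero assms in auto)
  show ?thesis
    unfolding core_eq_minimal_core
    by (rule deformation_onto_minimal_core) (rule deformation_retract_imp_cohomology_iso)
qed

end
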